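(* Let $Y_1,\ldots,Y_n$ be i.i.d. from some distribution $F$ on $\mathbb{R}^d$, $Y\sim F$, and let $m\colon\mathbb{R}^d\times\mathcal M\times\mathbb{R}^r\to\mathbb{R}^q$, where $\mathcal M\subseteq\mathbb{R}^s$ is open, be a function continuously differentiable in the last $s+r$ arguments. Assume that $\hat P$ is some estimator satisfying $n^{-1}\sum_{i=1}^nh(Y_i,\hat P)=o_{\mathrm{pr}}(1/\sqrt n)$ for a function $h\colon\mathbb{R}^{d+r}\to\mathbb{R}^r$, and that the empirical likelihood function $\mathrm{EL}_n$ is constructed using the estimating function $(y,\mu)\mapsto m(y,\mu,\hat P)$. Let $\hat\mu(\hat P)$ be the MEL estimator (the maximizer of $\mathrm{EL}_n$) and unique critical point of $\log\mathrm{EL}_n$, and assume there is a unique solution $\hat\lambda$ to $0=n^{-1}\sum_{i=1}^nm(Y_i,\hat\mu(\hat P),\hat P)/[1+\lambda^Tm(Y_i,\hat\mu(\hat P),\hat P)]$. For $\alpha_P=(\mu,\lambda,P)$ set $$\psi_{\mathrm{EL}}^P(y,\alpha_P)=[1+\lambda^Tm(y,\mu,P)]^{-1}\left(m(y,\mu,P)^T,\ \lambda^T\partial_\mu m(y,\mu,P)\right)^T,\quad \Gamma_P^{\mathrm{EL}}(\alpha_P)=\left(\mathrm{E}[\psi_{\mathrm{EL}}^P(Y,\alpha_P)]^T,\mathrm{E}[h(Y,P)]^T\right)^T,$$ with $\partial_\mu m=\partial m/\partial\mu$, and assume $\Gamma_P^{\mathrm{EL}}$ has a unique root $\alpha_{P,0}$.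 Assume there exists a neighbourhood $\mathcal N$ of $\alpha_{P,0}$ on which: (1) $\Gamma_P^{\mathrm{EL}}$ is continuously differentiable with non-singular Jacobian matrix at $\alpha_{P,0}$; (2) $\Pr(1+\lambda^Tm(Y,\mu,P)>L)=1$ for all $(\mu,\lambda,P)\in\mathcal N$ and some $L>0$; (3) the norm of $m$ and all first and second order partial derivatives of $m$ with respect to $\mu$ and $P$ are bounded by functions $p_j$ (of $y$ only) for $j=0,1,2$ respectively, with $\mathrm{E}[p_0(Y)^4],\mathrm{E}[p_1(Y)^4]<\infty$ and $\mathrm{E}[p_2(Y)^2]<\infty$; (4) the norm of $h(y,P)$ and all first order partial derivatives of $h$ with respect to $P$ are bounded by functions $q_1$ and $q_2$, respectively, not depending on $P$ and with $\mathrm{E}[q_1(Y)^2],\mathrm{E}[q_2(Y)^2]<\infty$. Furthermore, let $\lambda(\mu,P)$ and $P_0$ denote the solutions to $0=\mathrm{E}\{m(Y,\mu,P)/[1+\lambda^Tm(Y,\mu,P)]\}$ and $\mathrm{E}\,h(Y,P)=0$ respectively, and assume that the function $\mu\mapsto-\mathrm{E}\log[1+\lambda(\mu,P)^Tm(Y,\mu,P)]$ has a maximizer $\mu(P)$ for each $P$. Then the MEL estimator $\hat\mu(\hat P)$ is consistent for $\mu_0=\mu(P_0)$ and $$\hat\mu(\hat P)=\hat\mu(P_0)+\mu'(P_0)(\hat P-P_0)+o_{\mathrm{pr}}(1/\sqrt n),$$ where $\hat\mu(P_0)$ is the MEL estimator when $P$ is fixed at $P_0$ and $\mu'(P_0)$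 is the Jacobian matrix of $P\mapsto\mu(P)$ at $P_0$.
   Context: For a fixed value of $P$, the empirical likelihood function constructed with the estimating function $(y,\mu)\mapsto m(y,\mu,P)$ is $$\mu\mapsto\max\Big\{\prod_{i=1}^nw_i\colon \sum_{i=1}^nw_i=1,\ \sum_{i=1}^nw_im(Y_i,\mu,P)=0,\ w_i\ge0\Big\},$$ equal to $0$ if the constraints cannot be satisfied; $\hat\mu(P)$ denotes its maximizer (the maximum empirical likelihood, MEL, estimator), and $\mathrm{EL}_n$ is this function with $P=\hat P$. Solutions $\lambda$ of the empirical equation are taken subject to $1+\lambda^Tm(Y_i,\hat\mu(\hat P),\hat P)>0$ for all $i$, and $\lambda(\mu,P)$ is the solution of its equation with $\Pr(1+\lambda^Tm(Y,\mu,P)\le0)=0$. $o_{\mathrm{pr}}(r_n)$ denotes a term which, divided by $r_n$, tends to $0$ in probability.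
   Formalization: Added: P̂ is consistent for P_0; μ̂(P_0) is also the unique critical point of its log empirical likelihood; the maximizer μ(P_0) is unique; P↦μ(P) is continuous at P_0 (differentiability is proved). Conditions on the MEL estimators are only required with probability tending to one. *)

theory Defs
  imports "HOL-Probability.Probability"
begin

subsection \<open>Calculus\<close>

definition C1_on :: "('a::real_normed_vector \<Rightarrow> 'b::real_normed_vector) \<Rightarrow> 'a set \<Rightarrow> bool" where
  "C1_on f S \<longleftrightarrow>
     (\<exists>f'. (\<forall>x\<in>S. (f has_derivative blinfun_apply (f' x)) (at x)) \<and> continuous_on S f')"

text \<open>The partial derivative in the direction of a basis vector \<open>b\<close>. The value is only meaningful
  when it exists, which is the content of \<open>has_partial\<close>.\<close>

definition has_partial ::
  "('a::real_normed_vector \<Rightarrow> 'b::real_normed_vector) \<Rightarrow> 'a \<Rightarrow> 'a \<Rightarrow> bool" where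
  "has_partial f b x \<longleftrightarrow> (\<lambda>t::real. f (x + t *\<^sub>R b)) differentiable (at 0)"

definition partial ::
  "('a::real_normed_vector \<Rightarrow> 'b::real_normed_vector) \<Rightarrow> 'a \<Rightarrow> 'a \<Rightarrow> 'b" where
  "partial f b x = vector_derivative (\<lambda>t::real. f (x + t *\<^sub>R b)) (at 0)"

subsection \<open>Stochastic order\<close>

text \<open>Only used for Borel measurable \<open>X n\<close>; the measure of a non-measurable set is \<open>0\<close>.\<close>

definition o_pr ::
  "'w measure \<Rightarrow> (nat \<Rightarrow> real) \<Rightarrow> (nat \<Rightarrow> 'w \<Rightarrow> 'b::real_normed_vector) \<Rightarrow> bool" where
  "o_pr M r X \<longleftrightarrow>
     (\<forall>\<epsilon>>0. (\<lambda>n. measure M {\<omega> \<in> space M. norm (X n \<omega> /\<^sub>R r n) > \<epsilon>}) \<longlonglongrightarrow> 0)"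

definition conv_in_prob ::
  "'w measure \<Rightarrow> (nat \<Rightarrow> 'w \<Rightarrow> 'b::real_normed_vector) \<Rightarrow> 'b \<Rightarrow> bool" where
  "conv_in_prob M X x \<longleftrightarrow> o_pr M (\<lambda>n. 1) (\<lambda>n \<omega>. X n \<omega> - x)"

text \<open>\<open>Q n\<close> holds with probability tending to one. The events \<open>A n\<close> are there because
  \<open>{\<omega>. Q n \<omega>}\<close> itself need not be measurable.\<close>

definition whp :: "'w measure \<Rightarrow> (nat \<Rightarrow> 'w \<Rightarrow> bool) \<Rightarrow> bool" where
  "whp M Q \<longleftrightarrow>
     (\<exists>A. (\<forall>n. A n \<in> sets M \<and> (\<forall>\<omega>\<in>A n. Q n \<omega>)) \<and> (\<lambda>n. measure M (A n)) \<longlonglongrightarrow> 1)"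

subsection \<open>Empirical likelihood\<close>

text \<open>Here \<open>v i\<close> stands for the value of the estimating function at the observation \<open>i\<close>,
  and observations are indexed by \<open>i < n\<close>. The supremum is attained, the feasible set of weights
  being compact.\<close>

definition el_weights :: "nat \<Rightarrow> (nat \<Rightarrow> 'q::real_vector) \<Rightarrow> (nat \<Rightarrow> real) set" where
  "el_weights n v =
     {w. (\<Sum>i<n. w i) = 1 \<and> (\<Sum>i<n. w i *\<^sub>R v i) = 0 \<and> (\<forall>i<n. w i \<ge> 0)}"

definition emp_lik :: "nat \<Rightarrow> (nat \<Rightarrow> 'q::real_vector) \<Rightarrow> real" where
  "emp_lik n v =
     (if el_weights n v = {} then 0 else (SUP w\<in>el_weights n v. \<Prod>i<n. w i))"

text \<open>In the next two definitions \<open>L\<close> is an empirical likelihood function on \<open>\<Theta>\<close>.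
  Positivity of \<open>L \<mu>\<close> has to be required of a critical point of the logarithm, because
  \<open>ln 0 = 0\<close> would make every interior point of the zero set of \<open>L\<close> critical.\<close>

definition is_MEL :: "'s set \<Rightarrow> ('s \<Rightarrow> real) \<Rightarrow> 's \<Rightarrow> bool" where
  "is_MEL \<Theta> L \<mu> \<longleftrightarrow> \<mu> \<in> \<Theta> \<and> (\<forall>\<mu>'\<in>\<Theta>. L \<mu>' \<le> L \<mu>)"

definition log_critical ::
  "'s::real_normed_vector set \<Rightarrow> ('s \<Rightarrow> real) \<Rightarrow> 's \<Rightarrow> bool" where
  "log_critical \<Theta> L \<mu> \<longleftrightarrow>
     \<mu> \<in> \<Theta> \<and> L \<mu> > 0 \<and> ((\<lambda>\<mu>'. ln (L \<mu>')) has_derivative (\<lambda>_. 0)) (at \<mu>)"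

definition unique_log_critical ::
  "'s::real_normed_vector set \<Rightarrow> ('s \<Rightarrow> real) \<Rightarrow> 's \<Rightarrow> bool" where
  "unique_log_critical \<Theta> L \<mu> \<longleftrightarrow> (\<forall>\<mu>'. log_critical \<Theta> L \<mu>' \<longleftrightarrow> \<mu>' = \<mu>)"

definition solves_emp :: "nat \<Rightarrow> (nat \<Rightarrow> 'q::real_inner) \<Rightarrow> 'q \<Rightarrow> bool" where
  "solves_emp n v l \<longleftrightarrow>
     (\<forall>i<n. 1 + l \<bullet> v i > 0) \<and> (\<Sum>i<n. v i /\<^sub>R (1 + l \<bullet> v i)) /\<^sub>R real n = 0"

subsection \<open>Population quantities\<close>

text \<open>Bochner integrals of non-integrable functions are \<open>0\<close>, so integrability is stated
  wherever an expectation is required to have a certain value.\<close>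

definition solves_pop ::
  "'y measure \<Rightarrow> ('y \<Rightarrow> 'q::euclidean_space) \<Rightarrow> 'q \<Rightarrow> bool" where
  "solves_pop F g l \<longleftrightarrow>
     (AE y in F. \<not> 1 + l \<bullet> g y \<le> 0) \<and>
     integrable F (\<lambda>y. g y /\<^sub>R (1 + l \<bullet> g y)) \<and> (\<integral>y. g y /\<^sub>R (1 + l \<bullet> g y) \<partial>F) = 0"

text \<open>The parameter values at which \<open>lam \<mu> P\<close> actually is a solution and the expected
  logarithm is finite; this is where the population profile is defined.\<close>

definition profile_dom ::
  "'y measure \<Rightarrow> ('y \<Rightarrow> 's \<Rightarrow> 'r \<Rightarrow> 'q::euclidean_space) \<Rightarrow> 's set \<Rightarrow> ('s \<Rightarrow> 'r \<Rightarrow> 'q) \<Rightarrow> 'r \<Rightarrow> 's set" where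
  "profile_dom F m \<Theta> lam P =
     {\<mu> \<in> \<Theta>. solves_pop F (\<lambda>y. m y \<mu> P) (lam \<mu> P) \<and>
             integrable F (\<lambda>y. ln (1 + lam \<mu> P \<bullet> m y \<mu> P))}"

definition profile ::
  "'y measure \<Rightarrow> ('y \<Rightarrow> 's \<Rightarrow> 'r \<Rightarrow> 'q::euclidean_space) \<Rightarrow> ('s \<Rightarrow> 'r \<Rightarrow> 'q) \<Rightarrow> 'r \<Rightarrow> 's \<Rightarrow> real" where
  "profile F m lam P \<mu> = - (\<integral>y. ln (1 + lam \<mu> P \<bullet> m y \<mu> P) \<partial>F)"

definition psi_EL ::
  "('y \<Rightarrow> real^'s \<Rightarrow> real^'r \<Rightarrow> real^'q) \<Rightarrow> 'y \<Rightarrow> (real^'s) \<times> (real^'q) \<times> (real^'r) \<Rightarrow>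
     (real^'q) \<times> (real^'s)" where
  "psi_EL m y = (\<lambda>(\<mu>, l, P).
     (m y \<mu> P, l v* jacobian (\<lambda>\<mu>'. m y \<mu>' P) (at \<mu>))
       /\<^sub>R (1 + l \<bullet> m y \<mu> P))"

definition Gamma_EL ::
  "'y measure \<Rightarrow> ('y \<Rightarrow> real^'s \<Rightarrow> real^'r \<Rightarrow> real^'q) \<Rightarrow> ('y \<Rightarrow> real^'r \<Rightarrow> real^'r) \<Rightarrow>
     (real^'s) \<times> (real^'q) \<times> (real^'r) \<Rightarrow> ((real^'q) \<times> (real^'s)) \<times> (real^'r)" where
  "Gamma_EL F m h = (\<lambda>(\<mu>, l, P). (\<integral>y. psi_EL m y (\<mu>, l, P) \<partial>F, \<integral>y. h y P \<partial>F))"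

text \<open>The roots are sought where \<open>Gamma_EL\<close> is well defined: the expectations exist and
  \<open>l\<close> satisfies the same positivity constraint as in \<open>solves_pop\<close>.\<close>

definition Gamma_root ::
  "'y measure \<Rightarrow> ('y \<Rightarrow> real^'s \<Rightarrow> real^'r \<Rightarrow> real^'q) \<Rightarrow> ('y \<Rightarrow> real^'r \<Rightarrow> real^'r) \<Rightarrow> (real^'s) set \<Rightarrow>
     (real^'s) \<times> (real^'q) \<times> (real^'r) \<Rightarrow> bool" where
  "Gamma_root F m h \<Theta> = (\<lambda>(\<mu>, l, P).
     \<mu> \<in> \<Theta> \<and> (AE y in F. \<not> 1 + l \<bullet> m y \<mu> P \<le> 0) \<and>
     integrable F (\<lambda>y. psi_EL m y (\<mu>, l, P)) \<and> integrable F (\<lambda>y. h y P) \<and>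
     Gamma_EL F m h (\<mu>, l, P) = 0)"

end

theory Submission
  imports Defs "HOL-Real_Asymp.Real_Asymp"
begin

text \<open>
  Write \<open>f y \<alpha> = (\<psi> y \<alpha>, h y P)\<close>, so that \<open>\<Gamma> = E f\<close> is the population version of the empirical
  mean \<open>\<Gamma>n\<close> of \<open>f\<close>. Near \<open>\<alpha>0\<close> the function \<open>f\<close> is Lipschitz in \<open>\<alpha>\<close> with a square integrable
  constant, and Chebyshev's inequality on finite nets at dyadic scales gives
  \<open>\<Gamma>n \<alpha> - \<Gamma>n \<alpha>0 - \<Gamma> \<alpha> = o(norm (\<alpha> - \<alpha>0) + 1 / sqrt n)\<close> uniformly. As \<open>D = \<Gamma>'(\<alpha>0)\<close> is
  invertible, Brouwer's theorem yields a root of the \<open>\<psi>\<close>-part of \<open>\<Gamma>n\<close> near \<open>\<alpha>0\<close> for every \<open>P\<close> near \<open>P0\<close>.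
  Since \<open>\<psi>\<close> is the gradient of \<open>ln (1 + \<lambda> \<bullet> m)\<close>, such a root gives a critical point of the log
  empirical likelihood, which by uniqueness is the MEL estimator; this is where consistency comes
  from. Linearising at the roots for the estimated \<open>P\<close> and for \<open>P0\<close> and subtracting leaves \<open>\<mu>'(P0)\<close>
  times the error of \<open>P\<close>, because \<open>(\<mu> P, \<lambda> (\<mu> P) P, P)\<close> is a root of the \<open>\<psi>\<close>-part of \<open>\<Gamma>\<close> by the
  envelope theorem.
\<close>

section \<open>Events of large probability\<close>

text \<open>The \<open>h\<close>-block of \<Gamma> involves \<open>P\<close> only, so
  \<open>D\<close> is block triangular. In the \<psi>-part, the expansions at two roots contain the
  same leading fluctuation \<open>Gn \<alpha>0\<close>; subtraction removes it and leaves a linear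
  relation between the differences of the components. The weak modulus is enough because each root
  is first located within \<open>O(1 / sqrt n)\<close> of \<alpha>0, where the modulus is
  \<open>o(1 / sqrt n)\<close>. Nondegeneracy of \<open>m\<close> has to be derived. It comes from
  uniqueness of the population multiplier: a direction almost surely orthogonal to \<open>m\<close>
  could be added to the multiplier and would give a second solution. The same uniqueness identifies
  the multipliers found by Brouwer's theorem with \<open>lam\<close>, so \<open>lam\<close> is
  handled by monotonicity alone and is never differentiated. A root of \<Gamma> is a priori only a
  critical point of the profile. That its first component is \<open>mu P0\<close> needs a global
  comparison, made between empirical likelihoods at \<open>P0\<close>, whose maximiser is already
  known to be close to \<mu>0.\<close>

definition prob_ge :: "'w measure \<Rightarrow> real \<Rightarrow> ('w \<Rightarrow> bool) \<Rightarrow> bool" where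
  "prob_ge M c Q \<longleftrightarrow> (\<exists>A\<in>sets M. (\<forall>\<omega>\<in>A. Q \<omega>) \<and> measure M A \<ge> c)"

text \<open>The inner probability of \<open>Q n\<close> tends to one. Existence of a root or a
  supremum over a ball need not be a measurable event, so both notions ask for a measurable subset.
  Unlike in \<open>whp\<close>, the subset may change with \<open>\<eta>\<close>, and no sequence of
  events has to be built.\<close>

definition likely :: "'w measure \<Rightarrow> (nat \<Rightarrow> 'w \<Rightarrow> bool) \<Rightarrow> bool" where
  "likely M Q \<longleftrightarrow> (\<forall>\<eta>>0. \<forall>\<^sub>F n in sequentially. prob_ge M (1 - \<eta>) (Q n))"

context prob_space
begin

lemma prob_ge_mono:
  assumes "prob_ge M c P" "\<And>\<omega>. P \<omega> \<Longrightarrow> Q \<omega>" "c' \<le> c"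
  shows "prob_ge M c' Q"
  using assms unfolding prob_ge_def by (meson order_trans)

lemma prob_ge_conj:
  assumes "prob_ge M (1 - a) P" "prob_ge M (1 - b) Q"
  shows "prob_ge M (1 - (a + b)) (\<lambda>\<omega>. P \<omega> \<and> Q \<omega>)"
proof -
  obtain A where A: "A \<in> sets M" "\<forall>\<omega>\<in>A. P \<omega>" "measure M A \<ge> 1 - a"
    using assms(1) unfolding prob_ge_def by blast
  obtain B where B: "B \<in> sets M" "\<forall>\<omega>\<in>B. Q \<omega>" "measure M B \<ge> 1 - b"
    using assms(2) unfolding prob_ge_def by blast
  have "measure M (A \<union> B) = measure M A + measure M B - measure M (A \<inter> B)"
    using A B by (intro measure_Un3) (auto simp: fmeasurable_eq_sets)
  moreover have "measure M (A \<union> B) \<le> 1" by simp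
  ultimately have "measure M (A \<inter> B) \<ge> 1 - (a + b)" using A B by linarith
  then show ?thesis unfolding prob_ge_def using A B by (intro bexI[of _ "A \<inter> B"]) auto
qed

lemma prob_ge_Ball:
  assumes "finite I" "\<And>i. i \<in> I \<Longrightarrow> prob_ge M (1 - a) (P i)"
  shows "prob_ge M (1 - real (card I) * a) (\<lambda>\<omega>. \<forall>i\<in>I. P i \<omega>)"
  using assms
proof (induction I rule: finite_induct)
  case empty
  then show ?case unfolding prob_ge_def by (intro bexI[of _ "space M"]) (auto simp: prob_space)
next
  case (insert x I)
  then have "prob_ge M (1 - (a + real (card I) * a)) (\<lambda>\<omega>. P x \<omega> \<and> (\<forall>i\<in>I. P i \<omega>))"
    by (intro prob_ge_conj) auto
  then show ?case by (rule prob_ge_mono) (use insert in \<open>auto simp: algebra_simps\<close>)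
qed

lemma AE_prob_ge:
  assumes "AE \<omega> in M. Q \<omega>" "c \<le> 1"
  shows "prob_ge M c Q"
proof -
  obtain N where N: "N \<in> null_sets M" "{\<omega>\<in>space M. \<not> Q \<omega>} \<subseteq> N"
    using AE_E2 assms by (metis (mono_tags, lifting) eventually_ae_filter)
  have "measure M (space M - N) = 1"
    using N by (subst prob_compl) (auto simp: measure_eq_0_null_sets)
  then show ?thesis unfolding prob_ge_def using N assms
    by (intro bexI[of _ "space M - N"]) auto
qed

lemma likely_mono:
  assumes "likely M P" "\<forall>\<^sub>F n in sequentially. \<forall>\<omega>. P n \<omega> \<longrightarrow> Q n \<omega>"
  shows "likely M Q"
  unfolding likely_def
proof (intro allI impI)
  fix \<eta> :: real assume "\<eta> > 0"
  then have "\<forall>\<^sub>F n in sequentially. prob_ge M (1 - \<eta>) (P n)"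
    using assms(1) unfolding likely_def by blast
  then show "\<forall>\<^sub>F n in sequentially. prob_ge M (1 - \<eta>) (Q n)"
    using assms(2) by eventually_elim (auto intro: prob_ge_mono)
qed

lemma likely_mono':
  assumes "likely M P" "\<And>n \<omega>. P n \<omega> \<Longrightarrow> Q n \<omega>"
  shows "likely M Q"
  using assms by (intro likely_mono[OF assms(1)]) auto

lemma likely_conj:
  assumes "likely M P" "likely M Q"
  shows "likely M (\<lambda>n \<omega>. P n \<omega> \<and> Q n \<omega>)"
  unfolding likely_def
proof (intro allI impI)
  fix \<eta> :: real assume "\<eta> > 0"
  then have "\<forall>\<^sub>F n in sequentially. prob_ge M (1 - \<eta>/2) (P n)"
    "\<forall>\<^sub>F n in sequentially. prob_ge M (1 - \<eta>/2) (Q n)"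
    using assms unfolding likely_def by (meson half_gt_zero)+
  then show "\<forall>\<^sub>F n in sequentially. prob_ge M (1 - \<eta>) (\<lambda>\<omega>. P n \<omega> \<and> Q n \<omega>)"
    by eventually_elim (use prob_ge_conj[of "\<eta>/2" _ "\<eta>/2"] in auto)
qed

lemma likely_eventually:
  assumes "\<forall>\<^sub>F n in sequentially. P n"
  shows "likely M (\<lambda>n \<omega>. P n)"
  unfolding likely_def
proof (intro allI impI)
  fix \<eta> :: real assume "\<eta> > 0"
  then show "\<forall>\<^sub>F n in sequentially. prob_ge M (1 - \<eta>) (\<lambda>\<omega>. P n)"
    using assms by (auto elim!: eventually_mono intro: AE_prob_ge)
qed

lemma likely_AE:
  assumes "AE \<omega> in M. \<forall>n. Q n \<omega>"
  shows "likely M Q"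
proof -
  have "AE \<omega> in M. Q n \<omega>" for n using assms by (rule eventually_mono) auto
  then have "prob_ge M (1 - \<eta>) (Q n)" if "\<eta> > 0" for n \<eta>
    using that by (intro AE_prob_ge) auto
  then show ?thesis unfolding likely_def by simp
qed

lemma likely_bound:
  assumes "\<And>n. n \<ge> 1 \<Longrightarrow> prob_ge M (1 - c n) (Q n)" "c \<longlonglongrightarrow> 0"
  shows "likely M Q"
  unfolding likely_def
proof (intro allI impI)
  fix \<eta> :: real assume "\<eta> > 0"
  then have "\<forall>\<^sub>F n in sequentially. c n < \<eta>" using assms(2) by (rule order_tendstoD(2)[rotated])
  then show "\<forall>\<^sub>F n in sequentially. prob_ge M (1 - \<eta>) (Q n)"
    using eventually_ge_at_top[of 1]
  proof eventually_elim
    case (elim n)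
    show ?case by (rule prob_ge_mono[OF assms(1)]) (use elim in auto)
  qed
qed

text \<open>Extracts deterministic conclusions: if events that are jointly likely imply an
  inequality between numbers, a single sample point on which they all hold proves it.\<close>

lemma likely_nonempty:
  assumes "likely M Q"
  shows "\<forall>\<^sub>F n in sequentially. \<exists>\<omega>. Q n \<omega>"
proof -
  have "\<forall>\<^sub>F n in sequentially. prob_ge M (1 - 1/2) (Q n)"
    using assms unfolding likely_def by (meson half_gt_zero zero_less_one)
  then show ?thesis
  proof eventually_elim
    case (elim n)
    then obtain A where "A \<in> sets M" "\<forall>\<omega>\<in>A. Q n \<omega>" "measure M A \<ge> 1/2"
      unfolding prob_ge_def by auto
    then show ?case by (cases "A = {}") auto
  qed
qed

lemma whp_likely:
  assumes "whp M Q"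
  shows "likely M Q"
  unfolding likely_def
proof (intro allI impI)
  fix \<eta> :: real assume eta: "\<eta> > 0"
  obtain A where A: "\<forall>n. A n \<in> sets M \<and> (\<forall>\<omega>\<in>A n. Q n \<omega>)" "(\<lambda>n. measure M (A n)) \<longlonglongrightarrow> 1"
    using assms unfolding whp_def by blast
  have "\<forall>\<^sub>F n in sequentially. measure M (A n) > 1 - \<eta>"
    using A(2) by (rule order_tendstoD) (use eta in auto)
  then show "\<forall>\<^sub>F n in sequentially. prob_ge M (1 - \<eta>) (Q n)"
    unfolding prob_ge_def by eventually_elim (use A(1) in \<open>auto intro!: bexI[of _ "A _"]\<close>)
qed

lemma o_pr_likely:
  fixes X :: "nat \<Rightarrow> 'a \<Rightarrow> 'b::euclidean_space"
  assumes "o_pr M r X" "\<And>n. X n \<in> borel_measurable M" "\<epsilon> > 0" "\<And>n. n \<ge> 1 \<Longrightarrow> r n > 0"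
  shows "likely M (\<lambda>n \<omega>. norm (X n \<omega>) \<le> \<epsilon> * r n)"
proof (rule likely_bound)
  show "(\<lambda>n. measure M {\<omega> \<in> space M. norm (X n \<omega> /\<^sub>R r n) > \<epsilon>}) \<longlonglongrightarrow> 0"
    using assms(1,3) unfolding o_pr_def by blast
  fix n :: nat assume n: "n \<ge> 1"
  note [measurable] = assms(2)
  have "measure M {\<omega>\<in>space M. \<not> norm (X n \<omega> /\<^sub>R r n) > \<epsilon>} =
    1 - measure M {\<omega>\<in>space M. norm (X n \<omega> /\<^sub>R r n) > \<epsilon>}"
    by (rule prob_neg) measurable
  then show "prob_ge M (1 - measure M {\<omega>\<in>space M. norm (X n \<omega> /\<^sub>R r n) > \<epsilon>})
      (\<lambda>\<omega>. norm (X n \<omega>) \<le> \<epsilon> * r n)"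
    unfolding prob_ge_def using assms(4)[OF n]
    by (intro bexI[of _ "{\<omega>\<in>space M. \<not> norm (X n \<omega> /\<^sub>R r n) > \<epsilon>}"])
       (auto simp: field_simps)
qed

text \<open>The hypothesis is \<open>likely\<close> unfolded, so that a proof may fix
  \<open>\<eta>\<close> first and work with constants that depend on it, such as a tightness
  bound.\<close>

lemma o_prI:
  fixes X :: "nat \<Rightarrow> 'a \<Rightarrow> 'b::euclidean_space"
  assumes "\<And>n. X n \<in> borel_measurable M" "\<And>n. n \<ge> 1 \<Longrightarrow> r n > 0"
    "\<And>\<epsilon> \<eta>. \<epsilon> > 0 \<Longrightarrow> \<eta> > 0 \<Longrightarrow>
      \<forall>\<^sub>F n in sequentially. prob_ge M (1 - \<eta>) (\<lambda>\<omega>. norm (X n \<omega>) \<le> \<epsilon> * r n)"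
  shows "o_pr M r X"
  unfolding o_pr_def
proof (intro allI impI tendstoI)
  fix \<epsilon> \<eta> :: real assume eps: "\<epsilon> > 0" "\<eta> > 0"
  note [measurable] = assms(1)
  have "\<forall>\<^sub>F n in sequentially. prob_ge M (1 - \<eta>/2) (\<lambda>\<omega>. norm (X n \<omega>) \<le> \<epsilon> * r n)"
    using eps by (intro assms(3)) auto
  then show "\<forall>\<^sub>F n in sequentially. dist (measure M {\<omega>\<in>space M. norm (X n \<omega> /\<^sub>R r n) > \<epsilon>}) 0 < \<eta>"
    using eventually_ge_at_top[of 1]
  proof eventually_elim
    case (elim n)
    then obtain A where A: "A \<in> sets M" "\<forall>\<omega>\<in>A. norm (X n \<omega>) \<le> \<epsilon> * r n" "measure M A \<ge> 1 - \<eta>/2"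
      unfolding prob_ge_def by blast
    have r: "r n > 0" using assms(2) elim by simp
    let ?B = "{\<omega>\<in>space M. norm (X n \<omega> /\<^sub>R r n) > \<epsilon>}"
    have "measure M ?B \<le> measure M (space M - A)"
    proof (rule finite_measure_mono)
      have "\<omega> \<notin> A" if "norm (X n \<omega> /\<^sub>R r n) > \<epsilon>" for \<omega>
        using A(2) r that by (force simp: field_simps)
      then show "?B \<subseteq> space M - A" by blast
    qed (use A in auto)
    also have "\<dots> = 1 - measure M A" using A by (rule_tac prob_compl)
    finally show ?case using A(3) eps by (simp add: dist_norm)
  qed
qed

end

section \<open>Empirical means\<close>

definition emean :: "nat \<Rightarrow> (nat \<Rightarrow> 'b::real_vector) \<Rightarrow> 'b" where
  "emean n X = (\<Sum>i<n. X i) /\<^sub>R real n"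

lemma emean_diff: "emean n (\<lambda>i. X i - Z i) = emean n X - emean n Z"
  by (simp add: emean_def sum_subtractf scaleR_diff_right)

lemma emean_add: "emean n (\<lambda>i. X i + Z i) = emean n X + emean n Z"
  by (simp add: emean_def sum.distrib scaleR_add_right)

lemma emean_const: "n \<ge> 1 \<Longrightarrow> emean n (\<lambda>i. c) = c"
  by (simp add: emean_def sum_constant_scaleR)

lemma emean_linear: "linear T \<Longrightarrow> emean n (\<lambda>i. T (X i)) = T (emean n X)"
  by (simp add: emean_def linear_scale linear_sum)

lemma emean_mult: "emean n (\<lambda>i. c * X i) = c * emean n X" for X :: "nat \<Rightarrow> real"
  by (simp add: emean_def sum_distrib_left[symmetric])

lemma emean_mono: "(\<And>i. i < n \<Longrightarrow> X i \<le> Z i) \<Longrightarrow> emean n X \<le> emean n Z" for X :: "nat \<Rightarrow> real"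
  by (auto simp: emean_def intro!: sum_mono mult_left_mono)

lemma norm_emean_le: "norm (emean n X) \<le> emean n (\<lambda>i. norm (X i))" for X :: "nat \<Rightarrow> 'b::real_normed_vector"
  by (auto simp: emean_def intro!: mult_left_mono norm_sum)

lemma norm_emean_diff_le:
  fixes X :: "nat \<Rightarrow> 'b::real_normed_vector"
  assumes "\<And>i. i < n \<Longrightarrow> norm (X i - Z i) \<le> q i * c"
  shows "norm (emean n X - emean n Z) \<le> emean n q * c"
proof -
  have "norm (emean n X - emean n Z) \<le> emean n (\<lambda>i. norm (X i - Z i))"
    unfolding emean_diff[symmetric] by (rule norm_emean_le)
  also have "\<dots> \<le> emean n (\<lambda>i. c * q i)"
    using assms by (intro emean_mono) (auto simp: mult.commute)
  finally show ?thesis by (simp add: emean_mult mult.commute)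
qed

section \<open>Second moments and laws of large numbers for an i.i.d. sample\<close>

locale iid_sample = prob_space M for M :: "'w measure" +
  fixes F :: "'y::topological_space measure" and Y :: "nat \<Rightarrow> 'w \<Rightarrow> 'y"
  assumes indep: "indep_vars (\<lambda>_. borel) Y UNIV"
    and ident: "\<And>i. distr M borel (Y i) = F"
begin

lemma Y_measurable [measurable]: "Y i \<in> measurable M borel"
  using indep unfolding indep_vars_def by auto

lemma sets_F [measurable_cong]: "sets F = sets borel"
  using ident[of 0] by (metis sets_distr)

lemma prob_space_F: "prob_space F"
  unfolding ident[of 0, symmetric] by (rule prob_space_distr) simp

sublocale F: prob_space F by (rule prob_space_F)

lemma measurable_F: "borel_measurable F = borel_measurable borel"
  by (rule measurable_cong_sets) (auto simp: sets_F)

lemma integral_Y: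
  fixes g :: "'y \<Rightarrow> 'b::{banach, second_countable_topology}"
  assumes [measurable]: "g \<in> borel_measurable borel"
  shows "(\<integral>\<omega>. g (Y i \<omega>) \<partial>M) = (\<integral>y. g y \<partial>F)"
  unfolding ident[of i, symmetric] by (subst integral_distr) auto

lemma integrable_Y:
  fixes g :: "'y \<Rightarrow> 'b::{banach, second_countable_topology}"
  assumes "integrable F g"
  shows "integrable M (\<lambda>\<omega>. g (Y i \<omega>))"
  by (rule integrable_distr[OF Y_measurable]) (subst ident, rule assms)

lemma AE_Y:
  assumes "AE y in F. P y"
  shows "AE \<omega> in M. \<forall>i. P (Y i \<omega>)"
  unfolding AE_all_countable
proof
  fix i
  show "AE \<omega> in M. P (Y i \<omega>)"
    by (rule AE_distrD[OF Y_measurable]) (subst ident, rule assms)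
qed

text \<open>Independence and centring make the off-diagonal products vanish in the expectation; only
  the \<open>n\<close> diagonal terms survive.\<close>

lemma integral_sum_square:
  fixes g :: "'y \<Rightarrow> real"
  assumes g [measurable]: "g \<in> borel_measurable borel" and g2: "integrable F (\<lambda>y. (g y)\<^sup>2)"
    and g0: "(\<integral>y. g y \<partial>F) = 0"
  shows "integrable M (\<lambda>\<omega>. (\<Sum>i<n. g (Y i \<omega>))\<^sup>2)" (is ?int)
    and "(\<integral>\<omega>. (\<Sum>i<n. g (Y i \<omega>))\<^sup>2 \<partial>M) = real n * (\<integral>y. (g y)\<^sup>2 \<partial>F)" (is ?eq)
proof -
  have g1: "integrable F g"
    by (rule F.square_integrable_imp_integrable[OF _ g2]) (simp add: measurable_F)
  have *: "integrable M (\<lambda>\<omega>. g (Y i \<omega>) * g (Y j \<omega>)) \<and>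
     (\<integral>\<omega>. g (Y i \<omega>) * g (Y j \<omega>) \<partial>M) = (if i = j then (\<integral>y. (g y)\<^sup>2 \<partial>F) else 0)" for i j
  proof (cases "i = j")
    case True
    have "(\<integral>\<omega>. (g (Y j \<omega>))\<^sup>2 \<partial>M) = (\<integral>y. (g y)\<^sup>2 \<partial>F)"
      by (rule integral_Y) measurable
    then show ?thesis using integrable_Y[OF g2, of j] True by (simp add: power2_eq_square)
  next
    case False
    have ind: "indep_vars (\<lambda>_. borel) (\<lambda>k \<omega>. g (Y k \<omega>)) {i, j}"
      by (rule indep_vars_compose2[where X = Y and M' = "\<lambda>_. borel"])
         (auto intro: indep_vars_subset[OF indep])
    have "integrable M (\<lambda>\<omega>. \<Prod>k\<in>{i,j}. g (Y k \<omega>))"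
      "(\<integral>\<omega>. (\<Prod>k\<in>{i,j}. g (Y k \<omega>)) \<partial>M) = (\<Prod>k\<in>{i,j}. \<integral>\<omega>. g (Y k \<omega>) \<partial>M)"
      by (rule indep_vars_integrable indep_vars_lebesgue_integral, simp, rule ind,
          rule integrable_Y[OF g1])+
    then show ?thesis using False g0 by (simp add: integral_Y)
  qed
  have eq: "(\<Sum>i<n. g (Y i \<omega>))\<^sup>2 = (\<Sum>i<n. \<Sum>j<n. g (Y i \<omega>) * g (Y j \<omega>))" for \<omega>
    by (simp add: power2_eq_square sum_product)
  show ?int unfolding eq using * by (intro Bochner_Integration.integrable_sum) auto
  show ?eq unfolding eq using *
    by (simp add: Bochner_Integration.integrable_sum Bochner_Integration.integral_sum)
qed

text \<open>The raw second moment replaces the variance: it is no smaller, and for increments of a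
  Lipschitz function it is bounded directly by the squared envelope.\<close>

lemma chebyshev_real:
  fixes g :: "'y \<Rightarrow> real"
  assumes g [measurable]: "g \<in> borel_measurable borel" and g2: "integrable F (\<lambda>y. (g y)\<^sup>2)"
    and "\<epsilon> > 0" "n \<ge> 1"
  shows "prob_ge M (1 - (\<integral>y. (g y)\<^sup>2 \<partial>F) / (real n * \<epsilon>\<^sup>2))
    (\<lambda>\<omega>. \<bar>emean n (\<lambda>i. g (Y i \<omega>)) - (\<integral>y. g y \<partial>F)\<bar> \<le> \<epsilon>)"
proof -
  define c where "c = (\<integral>y. g y \<partial>F)"
  define g' where "g' y = g y - c" for y
  have g'm [measurable]: "g' \<in> borel_measurable borel" unfolding g'_def by measurable
  have g1: "integrable F g"
    by (rule F.square_integrable_imp_integrable[OF _ g2]) (simp add: measurable_F)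
  have int2: "integrable F (\<lambda>y. (g' y)\<^sup>2)"
    unfolding g'_def power2_diff using g1 g2 by simp
  have "(\<integral>y. (g' y)\<^sup>2 \<partial>F) = (\<integral>y. (g y)\<^sup>2 \<partial>F) - c\<^sup>2"
    unfolding g'_def c_def using g1 g2 by (subst F.variance_eq) auto
  then have le: "(\<integral>y. (g' y)\<^sup>2 \<partial>F) \<le> (\<integral>y. (g y)\<^sup>2 \<partial>F)" by simp
  have zero: "(\<integral>y. g' y \<partial>F) = 0"
    unfolding g'_def c_def using g1 by (simp add: F.prob_space)
  note S = integral_sum_square[OF g'm int2 zero, of n]
  define X where "X \<omega> = (\<Sum>i<n. g' (Y i \<omega>))" for \<omega>
  have X_m [measurable]: "X \<in> borel_measurable M" unfolding X_def by measurable
  have em: "emean n (\<lambda>i. g (Y i \<omega>)) - c = X \<omega> / real n" for \<omega>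
    using assms(4) by (simp add: X_def emean_def g'_def sum_subtractf field_simps)
  have "measure M {\<omega>\<in>space M. \<bar>X \<omega>\<bar> \<ge> real n * \<epsilon>} \<le> (\<integral>\<omega>. (X \<omega>)\<^sup>2 \<partial>M) / (real n * \<epsilon>)\<^sup>2"
    using S(1) assms unfolding X_def by (intro second_moment_method) auto
  also have "\<dots> = (\<integral>y. (g' y)\<^sup>2 \<partial>F) / (real n * \<epsilon>\<^sup>2)"
    using S(2) assms unfolding X_def by (simp add: power2_eq_square)
  also have "\<dots> \<le> (\<integral>y. (g y)\<^sup>2 \<partial>F) / (real n * \<epsilon>\<^sup>2)"
    using le by (intro divide_right_mono) auto
  finally have *: "measure M {\<omega>\<in>space M. \<bar>X \<omega>\<bar> \<ge> real n * \<epsilon>} \<le> (\<integral>y. (g y)\<^sup>2 \<partial>F) / (real n * \<epsilon>\<^sup>2)" .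
  have "measure M {\<omega>\<in>space M. \<not> \<bar>X \<omega>\<bar> \<ge> real n * \<epsilon>} = 1 - measure M {\<omega>\<in>space M. \<bar>X \<omega>\<bar> \<ge> real n * \<epsilon>}"
    by (rule prob_neg) measurable
  with * have "measure M {\<omega>\<in>space M. \<not> \<bar>X \<omega>\<bar> \<ge> real n * \<epsilon>} \<ge> 1 - (\<integral>y. (g y)\<^sup>2 \<partial>F) / (real n * \<epsilon>\<^sup>2)"
    by linarith
  then show ?thesis unfolding prob_ge_def em[unfolded c_def] using assms
    by (intro bexI[of _ "{\<omega>\<in>space M. \<not> \<bar>X \<omega>\<bar> \<ge> real n * \<epsilon>}"]) (auto simp: field_simps)
qed

text \<open>A tolerance of \<open>\<epsilon>\<close> divided by the dimension in every coordinate
  costs the square of the dimension, and the union over the coordinates one more factor; hence the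
  cube.\<close>

lemma chebyshev:
  fixes g :: "'y \<Rightarrow> 'b::euclidean_space"
  assumes g [measurable]: "g \<in> borel_measurable borel" and g2: "integrable F (\<lambda>y. (norm (g y))\<^sup>2)"
    and eps: "\<epsilon> > 0" "n \<ge> 1"
  shows "prob_ge M (1 - real (DIM('b))^3 * (\<integral>y. (norm (g y))\<^sup>2 \<partial>F) / (real n * \<epsilon>\<^sup>2))
    (\<lambda>\<omega>. norm (emean n (\<lambda>i. g (Y i \<omega>)) - (\<integral>y. g y \<partial>F)) \<le> \<epsilon>)"
proof -
  define D where "D = real (DIM('b))"
  have D: "D > 0" unfolding D_def by simp
  have nm: "integrable F (\<lambda>y. norm (g y))"
    by (rule F.square_integrable_imp_integrable[OF _ g2]) (simp add: measurable_F)
  have g1: "integrable F g"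
    by (rule Bochner_Integration.integrable_bound[OF nm]) (auto simp: measurable_F)
  define a where "a = (\<integral>y. (norm (g y))\<^sup>2 \<partial>F) / (real n * (\<epsilon>/D)\<^sup>2)"
  have "prob_ge M (1 - a) (\<lambda>\<omega>. \<bar>emean n (\<lambda>i. g (Y i \<omega>) \<bullet> b) - (\<integral>y. g y \<bullet> b \<partial>F)\<bar> \<le> \<epsilon>/D)"
    if b: "b \<in> Basis" for b
  proof (rule prob_ge_mono[OF chebyshev_real])
    have le: "(g y \<bullet> b)\<^sup>2 \<le> (norm (g y))\<^sup>2" for y
      using Basis_le_norm[OF b, of "g y"] by (metis abs_ge_zero power2_abs power_mono)
    show i2: "integrable F (\<lambda>y. (g y \<bullet> b)\<^sup>2)"
      by (rule Bochner_Integration.integrable_bound[OF g2]) (use le in \<open>auto simp: measurable_F\<close>)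
    have "(\<integral>y. (g y \<bullet> b)\<^sup>2 \<partial>F) \<le> (\<integral>y. (norm (g y))\<^sup>2 \<partial>F)"
      using le by (intro integral_mono i2 g2)
    then show "1 - a \<le> 1 - (\<integral>y. (g y \<bullet> b)\<^sup>2 \<partial>F) / (real n * (\<epsilon>/D)\<^sup>2)"
      unfolding a_def using divide_right_mono[of _ _ "real n * (\<epsilon>/D)\<^sup>2"] by force
  qed (use eps D in auto)
  then have "prob_ge M (1 - real (card (Basis::'b set)) * a)
     (\<lambda>\<omega>. \<forall>b\<in>Basis. \<bar>emean n (\<lambda>i. g (Y i \<omega>) \<bullet> b) - (\<integral>y. g y \<bullet> b \<partial>F)\<bar> \<le> \<epsilon>/D)"
    by (intro prob_ge_Ball) auto
  then show ?thesis
  proof (rule prob_ge_mono)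
    fix \<omega> assume *: "\<forall>b\<in>Basis. \<bar>emean n (\<lambda>i. g (Y i \<omega>) \<bullet> b) - (\<integral>y. g y \<bullet> b \<partial>F)\<bar> \<le> \<epsilon>/D"
    have "norm (emean n (\<lambda>i. g (Y i \<omega>)) - (\<integral>y. g y \<partial>F)) \<le>
        (\<Sum>b\<in>Basis. \<bar>(emean n (\<lambda>i. g (Y i \<omega>)) - (\<integral>y. g y \<partial>F)) \<bullet> b\<bar>)"
      by (rule norm_le_l1)
    also have "\<dots> \<le> (\<Sum>b\<in>(Basis::'b set). \<epsilon>/D)"
    proof (rule sum_mono)
      fix b :: 'b assume "b \<in> Basis"
      moreover have "emean n (\<lambda>i. g (Y i \<omega>) \<bullet> b) = emean n (\<lambda>i. g (Y i \<omega>)) \<bullet> b"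
        by (rule emean_linear[of "\<lambda>x. x \<bullet> b"])
           (rule bounded_linear.linear[OF bounded_linear_inner_left])
      ultimately show "\<bar>(emean n (\<lambda>i. g (Y i \<omega>)) - (\<integral>y. g y \<partial>F)) \<bullet> b\<bar> \<le> \<epsilon>/D"
        using * g1 by (auto simp: inner_diff_left)
    qed
    also have "\<dots> = \<epsilon>" using D by (simp add: D_def)
    finally show "norm (emean n (\<lambda>i. g (Y i \<omega>)) - (\<integral>y. g y \<partial>F)) \<le> \<epsilon>" .
  next
    have "real (card (Basis::'b set)) * a = real (DIM('b))^3 * (\<integral>y. (norm (g y))\<^sup>2 \<partial>F) / (real n * \<epsilon>\<^sup>2)"
      unfolding a_def D_def by (simp add: power2_eq_square power3_eq_cube)
    then show "1 - real (DIM('b))^3 * (\<integral>y. (norm (g y))\<^sup>2 \<partial>F) / (real n * \<epsilon>\<^sup>2)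
        \<le> 1 - real (card (Basis::'b set)) * a" by linarith
  qed
qed

text \<open>Truncation: the bounded part obeys Chebyshev's inequality, and the remainder has a small
  first moment, so Markov's inequality applies to it. First moments have to suffice because, at an
  arbitrary point of the profile domain, \<open>solves_pop\<close> and the logarithm provide no more
  than integrability.\<close>

lemma weak_law:
  fixes g :: "'y \<Rightarrow> 'b::euclidean_space"
  assumes g: "integrable F g" and eps: "\<epsilon> > 0"
  shows "likely M (\<lambda>n \<omega>. norm (emean n (\<lambda>i. g (Y i \<omega>)) - (\<integral>y. g y \<partial>F)) \<le> \<epsilon>)"
  unfolding likely_def
proof (intro allI impI)
  fix \<eta> :: real assume eta: "\<eta> > 0"
  have gm [measurable]: "g \<in> borel_measurable borel"
    using g by (simp add: integrable_iff_bounded measurable_F)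
  define r where "r k y = (if norm (g y) \<le> real k then 0 else g y)" for k y
  define t where "t k y = (if norm (g y) \<le> real k then g y else 0)" for k y
  have rm [measurable]: "r k \<in> borel_measurable borel" for k unfolding r_def by measurable
  have tm [measurable]: "t k \<in> borel_measurable borel" for k unfolding t_def by measurable
  have gtr: "g y = t k y + r k y" for k y by (simp add: t_def r_def)
  have ri: "integrable F (r k)" for k
    by (rule Bochner_Integration.integrable_bound[OF g]) (auto simp: measurable_F r_def)
  have ti: "integrable F (t k)" for k
    by (rule Bochner_Integration.integrable_bound[OF g]) (auto simp: measurable_F t_def)
  have "(\<lambda>k. \<integral>y. norm (r k y) \<partial>F) \<longlonglongrightarrow> (\<integral>y. 0 \<partial>F)"
  proof (rule integral_dominated_convergence[where w = "\<lambda>y. norm (g y)"])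
    show "AE y in F. (\<lambda>k. norm (r k y)) \<longlonglongrightarrow> 0"
    proof (rule AE_I2)
      fix y
      have "\<forall>\<^sub>F k in sequentially. real k \<ge> norm (g y)"
        by (rule eventually_at_top_linorderI[of "nat \<lceil>norm (g y)\<rceil>"]) linarith
      then have "\<forall>\<^sub>F k in sequentially. norm (r k y) = 0"
        by eventually_elim (simp add: r_def)
      then show "(\<lambda>k. norm (r k y)) \<longlonglongrightarrow> 0"
        by (rule tendsto_eventually)
    qed
  qed (use g in \<open>auto simp: measurable_F r_def\<close>)
  then have *: "(\<lambda>k. \<integral>y. norm (r k y) \<partial>F) \<longlonglongrightarrow> 0" by simp
  \<comment> \<open>The first bound controls the expectation of the remainder, the second makes
    Markov's inequality at level \<open>\<epsilon>/4\<close> cost at most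
    \<open>\<eta>/2\<close>.\<close>
  define e where "e = min (\<epsilon>/4) (\<epsilon>*\<eta>/8)"
  have "e > 0" using eps eta by (simp add: e_def)
  with * have "\<forall>\<^sub>F k in sequentially. (\<integral>y. norm (r k y) \<partial>F) < e"
    by (rule order_tendstoD(2))
  then obtain k where k: "(\<integral>y. norm (r k y) \<partial>F) < e" by (auto simp: eventually_sequentially)
  let ?C = "real (DIM('b))^3 * (\<integral>y. (norm (t k y))\<^sup>2 \<partial>F)"
  have "(\<lambda>n. ?C / (real n * (\<epsilon>/2)\<^sup>2)) \<longlonglongrightarrow> 0"
    using lim_const_over_n[of "?C / (\<epsilon>/2)\<^sup>2"] by (simp add: field_simps)
  then have "\<forall>\<^sub>F n in sequentially. ?C / (real n * (\<epsilon>/2)\<^sup>2) < \<eta>/2"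
    by (rule order_tendstoD(2)) (use eta in simp)
  then show "\<forall>\<^sub>F n in sequentially. prob_ge M (1 - \<eta>)
      (\<lambda>\<omega>. norm (emean n (\<lambda>i. g (Y i \<omega>)) - (\<integral>y. g y \<partial>F)) \<le> \<epsilon>)"
    using eventually_ge_at_top[of 1]
  proof eventually_elim
    case (elim n)
    have "integrable F (\<lambda>y. (norm (t k y))\<^sup>2)"
      by (rule F.integrable_const_bound[of _ "(real k)\<^sup>2"])
         (auto simp: t_def measurable_F intro!: AE_I2 power_mono)
    from chebyshev[OF tm this, of "\<epsilon>/2" n] eps elim
    have 1: "prob_ge M (1 - \<eta>/2) (\<lambda>\<omega>. norm (emean n (\<lambda>i. t k (Y i \<omega>)) - (\<integral>y. t k y \<partial>F)) \<le> \<epsilon>/2)"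
      by (auto elim: prob_ge_mono)
    define u where "u \<omega> = emean n (\<lambda>i. norm (r k (Y i \<omega>)))" for \<omega>
    have um [measurable]: "u \<in> borel_measurable M" unfolding u_def emean_def by measurable
    have ui: "integrable M u" unfolding u_def emean_def
      using integrable_Y[OF ri] by auto
    have u0: "u \<omega> \<ge> 0" for \<omega> unfolding u_def emean_def by (auto intro!: sum_nonneg mult_nonneg_nonneg)
    have "(\<integral>\<omega>. u \<omega> \<partial>M) = (\<integral>y. norm (r k y) \<partial>F)"
      unfolding u_def emean_def using elim integrable_Y[OF ri]
      by (simp add: Bochner_Integration.integral_sum integral_Y[of "\<lambda>y. norm (r k y)"])
    then have le: "(\<integral>\<omega>. u \<omega> \<partial>M) \<le> e" using k by simp
    have "measure M {\<omega>\<in>space M. u \<omega> \<ge> \<epsilon>/4} \<le> (\<integral>\<omega>. u \<omega> \<partial>M) / (\<epsilon>/4)"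
      by (rule integral_Markov_inequality_measure[OF ui sets.empty_sets]) (use u0 eps in auto)
    also have "\<dots> \<le> e / (\<epsilon>/4)" using le eps by (intro divide_right_mono) auto
    also have "\<dots> \<le> \<eta>/2" using eps by (simp add: e_def field_simps min_def)
    finally have "measure M {\<omega>\<in>space M. \<not> u \<omega> \<ge> \<epsilon>/4} \<ge> 1 - \<eta>/2"
      by (subst prob_neg) auto
    then have 2: "prob_ge M (1 - \<eta>/2) (\<lambda>\<omega>. u \<omega> \<le> \<epsilon>/4)"
      unfolding prob_ge_def by (intro bexI[of _ "{\<omega>\<in>space M. \<not> u \<omega> \<ge> \<epsilon>/4}"]) auto
    from prob_ge_conj[OF 1 2] show ?case
    proof (rule prob_ge_mono)
      fix \<omega> assume w: "norm (emean n (\<lambda>i. t k (Y i \<omega>)) - (\<integral>y. t k y \<partial>F)) \<le> \<epsilon>/2 \<and> u \<omega> \<le> \<epsilon>/4"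
      have "norm (emean n (\<lambda>i. r k (Y i \<omega>))) \<le> \<epsilon>/4"
        using norm_emean_le[of n "\<lambda>i. r k (Y i \<omega>)"] w by (simp add: u_def)
      moreover have "norm (\<integral>y. r k y \<partial>F) \<le> \<epsilon>/4"
        by (rule order_trans[OF integral_norm_bound]) (use k in \<open>simp add: e_def\<close>)
      ultimately have le: "norm (emean n (\<lambda>i. r k (Y i \<omega>)) - (\<integral>y. r k y \<partial>F)) \<le> \<epsilon>/4 + \<epsilon>/4"
        by (intro norm_triangle_le_diff) auto
      have "emean n (\<lambda>i. g (Y i \<omega>)) = emean n (\<lambda>i. t k (Y i \<omega>)) + emean n (\<lambda>i. r k (Y i \<omega>))"
        by (subst gtr[of _ k]) (rule emean_add)
      moreover have "(\<integral>y. g y \<partial>F) = (\<integral>y. t k y \<partial>F) + (\<integral>y. r k y \<partial>F)"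
        by (subst gtr[of _ k]) (rule Bochner_Integration.integral_add[OF ti ri])
      ultimately have "emean n (\<lambda>i. g (Y i \<omega>)) - (\<integral>y. g y \<partial>F) =
         (emean n (\<lambda>i. t k (Y i \<omega>)) - (\<integral>y. t k y \<partial>F)) + (emean n (\<lambda>i. r k (Y i \<omega>)) - (\<integral>y. r k y \<partial>F))"
        by simp
      also have "norm \<dots> \<le> \<epsilon>/2 + (\<epsilon>/4 + \<epsilon>/4)"
        using w le by (intro norm_triangle_mono) auto
      finally show "norm (emean n (\<lambda>i. g (Y i \<omega>)) - (\<integral>y. g y \<partial>F)) \<le> \<epsilon>" by simp
    qed auto
  qed
qed

end

section \<open>Local modulus of the empirical process\<close>

lemma norm_integral_le_AE:
  fixes f :: "'a \<Rightarrow> 'b::{banach, second_countable_topology}" and g :: "'a \<Rightarrow> real"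
  assumes "integrable M f" "integrable M g" "AE x in M. norm (f x) \<le> g x"
  shows "norm (\<integral>x. f x \<partial>M) \<le> (\<integral>x. g x \<partial>M)"
  using assms by (intro order_trans[OF integral_norm_bound integral_mono_AE]) auto

text \<open>Places a distance in a dyadic shell whose outer radius exceeds it by at most a factor
  two, so that a bound proportional to the radius becomes one proportional to the distance.\<close>

lemma dyadic_scale:
  fixes r \<rho> :: real
  assumes "r \<le> \<rho>"
  shows "r \<le> \<rho> * (1/2)^K \<or> (\<exists>k<K. \<rho> * (1/2)^k / 2 < r \<and> r \<le> \<rho> * (1/2)^k)"
proof (induction K)
  case (Suc K)
  show ?case
  proof (cases "r \<le> \<rho> * (1/2)^Suc K")
    case False
    from Suc show ?thesis
    proof (elim disjE exE conjE)
      assume "r \<le> \<rho> * (1/2)^K"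
      with False show ?thesis by (intro disjI2 exI[of _ K]) auto
    next
      fix k assume "k < K" "\<rho> * (1/2)^k / 2 < r" "r \<le> \<rho> * (1/2)^k"
      then show ?thesis by (intro disjI2 exI[of _ k]) auto
    qed
  qed simp
qed (use assms in simp)

context iid_sample
begin

text \<open>The increment from \<open>a0\<close> to \<open>a\<close> of the centred empirical
  process, without the factor \<open>sqrt n\<close>.\<close>

definition increment :: "('y \<Rightarrow> 'a \<Rightarrow> 'b::{real_normed_vector, second_countable_topology, banach}) \<Rightarrow> 'a \<Rightarrow> nat \<Rightarrow> 'w \<Rightarrow> 'a \<Rightarrow> 'b" where
  "increment f a0 n \<omega> a = emean n (\<lambda>i. f (Y i \<omega>) a) - emean n (\<lambda>i. f (Y i \<omega>) a0)
     - ((\<integral>y. f y a \<partial>F) - (\<integral>y. f y a0 \<partial>F))"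

text \<open>Only finitely many points of the ball matter, and rescaling the net of the unit ball makes
  their number independent of the radius; hence the uniformity of \<open>C\<close> in \<open>R\<close>.\<close>

lemma modulus_one_scale:
  fixes f :: "'y \<Rightarrow> 'a::euclidean_space \<Rightarrow> 'b::euclidean_space"
  assumes f_meas: "\<And>a. a \<in> cball a0 \<rho> \<Longrightarrow> (\<lambda>y. f y a) \<in> borel_measurable borel"
    and f0: "integrable F (\<lambda>y. f y a0)"
    and lip: "AE y in F. \<forall>a\<in>cball a0 \<rho>. \<forall>b\<in>cball a0 \<rho>. norm (f y a - f y b) \<le> Q y * dist a b"
    and Q_meas: "Q \<in> borel_measurable borel" and Q2: "integrable F (\<lambda>y. (Q y)\<^sup>2)"
    and eps: "\<epsilon> > 0"
  obtains C where "C \<ge> 0" "\<And>R n. 0 < R \<Longrightarrow> R \<le> \<rho> \<Longrightarrow> n \<ge> 1 \<Longrightarrow> prob_ge M (1 - C / real n) (\<lambda>\<omega>.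
      \<forall>a\<in>cball a0 R. norm (increment f a0 n \<omega> a) \<le> \<epsilon> * R)"
proof -
  define q where "q = (\<integral>y. Q y \<partial>F)"
  define q2 where "q2 = (\<integral>y. (Q y)\<^sup>2 \<partial>F)"
  have Q1: "integrable F Q"
    by (rule F.square_integrable_imp_integrable[OF _ Q2]) (simp add: measurable_F Q_meas)
  have q20: "q2 \<ge> 0" unfolding q2_def by (rule integral_nonneg_AE) simp
  \<comment> \<open>Moving from a point to its neighbour in the net changes the empirical mean by at
    most \<open>(\<bar>q\<bar> + 1) * \<eta> * R\<close> and the expectation by at most
    \<open>\<bar>q\<bar> * \<eta> * R\<close>; together this is half of the allowance
    \<open>\<epsilon> * R\<close>.\<close>
  define \<eta> where "\<eta> = \<epsilon> / (2 * (2 * \<bar>q\<bar> + 1))"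
  have eta: "\<eta> > 0" "(2 * \<bar>q\<bar> + 1) * \<eta> = \<epsilon>/2" using eps by (auto simp: \<eta>_def field_simps)
  obtain T where T: "T \<subseteq> cball (0::'a) 1" "finite T" "cball (0::'a) 1 \<subseteq> (\<Union>t\<in>T. ball t \<eta>)"
  proof (rule compactE_image[OF compact_cball[of "0::'a" 1], of "cball 0 1" "\<lambda>t. ball t \<eta>"])
    show "cball (0::'a) 1 \<subseteq> (\<Union>t\<in>cball 0 1. ball t \<eta>)"
      using centre_in_ball eta(1) by blast
  qed auto
  \<comment> \<open>No radius appears: an increment over distance at most \<open>R\<close> has
    second moment at most \<open>R\<^sup>2 * q2\<close>, and the tolerance is itself proportional to
    \<open>R\<close>.\<close>
  define C1 where "C1 = real (DIM('b))^3 * q2 / (\<epsilon>/2)\<^sup>2"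
  have C1: "C1 \<ge> 0" unfolding C1_def using q20 by simp
  show thesis
  \<comment> \<open>The first summand pays for the net points, the second for keeping the empirical
    mean of \<open>Q\<close> within one of its expectation.\<close>
  proof (rule that[of "real (card T) * C1 + q2"])
    show "real (card T) * C1 + q2 \<ge> 0" using C1 q20 by simp
    fix R :: real and n :: nat assume R: "0 < R" "R \<le> \<rho>" and n: "n \<ge> 1"
    have a0: "a0 \<in> cball a0 \<rho>" using R by simp
    have fi: "integrable F (\<lambda>y. f y a)" if a: "a \<in> cball a0 \<rho>" for a
    proof -
      have "integrable F (\<lambda>y. f y a - f y a0)"
      proof (rule Bochner_Integration.integrable_bound)
        show "integrable F (\<lambda>y. Q y * dist a a0)" using Q1 by simp
        show "(\<lambda>y. f y a - f y a0) \<in> borel_measurable F"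
          using f_meas[OF a] f_meas[OF a0] by (simp add: measurable_F)
        show "AE y in F. norm (f y a - f y a0) \<le> norm (Q y * dist a a0)"
          using lip by eventually_elim (use a a0 in fastforce)
      qed
      from Bochner_Integration.integrable_add[OF this f0] show ?thesis by simp
    qed
    define dev where "dev \<omega> a = emean n (\<lambda>i. f (Y i \<omega>) a) - (\<integral>y. f y a \<partial>F)" for \<omega> a
    have 1: "prob_ge M (1 - C1 / real n) (\<lambda>\<omega>. norm (dev \<omega> (a0 + R *\<^sub>R t) - dev \<omega> a0) \<le> \<epsilon>/2 * R)"
      if t: "t \<in> T" for t
    proof -
      have t1: "norm t \<le> 1" using T(1) t by auto
      have "R * norm t \<le> \<rho>" using t1 R mult_mono[of R \<rho> "norm t" 1] by simp
      then have a: "a0 + R *\<^sub>R t \<in> cball a0 \<rho>" using R by (simp add: dist_norm)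
      define g where "g y = f y (a0 + R *\<^sub>R t) - f y a0" for y
      have g [measurable]: "g \<in> borel_measurable borel" unfolding g_def
        using f_meas[OF a] f_meas[OF a0] by simp
      have gb: "AE y in F. (norm (g y))\<^sup>2 \<le> R\<^sup>2 * (Q y)\<^sup>2"
        using lip
      proof eventually_elim
        case (elim y)
        then have "norm (f y (a0 + R *\<^sub>R t) - f y a0) \<le> Q y * dist (a0 + R *\<^sub>R t) a0"
          using a a0 by blast
        then have "norm (g y) \<le> Q y * (R * norm t)" unfolding g_def using R by (simp add: dist_norm)
        also have "\<dots> \<le> \<bar>Q y\<bar> * (R * 1)" using t1 R by (intro mult_mono) auto
        finally have "(norm (g y))\<^sup>2 \<le> (\<bar>Q y\<bar> * R)\<^sup>2" by (intro power_mono) auto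
        then show ?case by (simp add: power_mult_distrib mult.commute)
      qed
      have g2: "integrable F (\<lambda>y. (norm (g y))\<^sup>2)"
        by (rule Bochner_Integration.integrable_bound[of F "\<lambda>y. R\<^sup>2 * (Q y)\<^sup>2"])
           (use gb Q2 in \<open>auto simp: measurable_F\<close>)
      have le: "(\<integral>y. (norm (g y))\<^sup>2 \<partial>F) \<le> R\<^sup>2 * q2"
        unfolding q2_def using integral_mono_AE[OF g2 _ gb] Q2 by simp
      have "prob_ge M (1 - real (DIM('b))^3 * (\<integral>y. (norm (g y))\<^sup>2 \<partial>F) / (real n * (\<epsilon>/2*R)\<^sup>2))
         (\<lambda>\<omega>. norm (emean n (\<lambda>i. g (Y i \<omega>)) - (\<integral>y. g y \<partial>F)) \<le> \<epsilon>/2 * R)"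
        using eps R n by (intro chebyshev g g2) auto
      then show ?thesis
      proof (rule prob_ge_mono)
        fix \<omega> assume "norm (emean n (\<lambda>i. g (Y i \<omega>)) - (\<integral>y. g y \<partial>F)) \<le> \<epsilon>/2 * R"
        then show "norm (dev \<omega> (a0 + R *\<^sub>R t) - dev \<omega> a0) \<le> \<epsilon>/2 * R"
          unfolding g_def dev_def using fi[OF a] fi[OF a0] by (simp add: emean_diff algebra_simps)
      next
        have "real (DIM('b))^3 * (\<integral>y. (norm (g y))\<^sup>2 \<partial>F) / (real n * (\<epsilon>/2*R)\<^sup>2)
          \<le> real (DIM('b))^3 * (R\<^sup>2 * q2) / (real n * (\<epsilon>/2*R)\<^sup>2)"
          using le by (intro divide_right_mono mult_left_mono) auto
        also have "\<dots> = C1 / real n" using R eps n by (simp add: C1_def power_mult_distrib field_simps)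
        finally show "1 - C1 / real n \<le>
            1 - real (DIM('b))^3 * (\<integral>y. (norm (g y))\<^sup>2 \<partial>F) / (real n * (\<epsilon>/2*R)\<^sup>2)" by simp
      qed
    qed
    have 2: "prob_ge M (1 - q2 / (real n * 1\<^sup>2)) (\<lambda>\<omega>. \<bar>emean n (\<lambda>i. Q (Y i \<omega>)) - q\<bar> \<le> 1)"
      unfolding q2_def q_def using n by (intro chebyshev_real Q_meas Q2) auto
    have 3: "prob_ge M (1 - 0) (\<lambda>\<omega>. \<forall>i. \<forall>a\<in>cball a0 \<rho>. \<forall>b\<in>cball a0 \<rho>.
        norm (f (Y i \<omega>) a - f (Y i \<omega>) b) \<le> Q (Y i \<omega>) * dist a b)"
      by (rule AE_prob_ge[OF AE_Y[OF lip]]) simp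
    have 4: "prob_ge M (1 - real (card T) * (C1 / real n))
        (\<lambda>\<omega>. \<forall>t\<in>T. norm (dev \<omega> (a0 + R *\<^sub>R t) - dev \<omega> a0) \<le> \<epsilon>/2 * R)"
      by (rule prob_ge_Ball[OF T(2) 1])
    from prob_ge_conj[OF prob_ge_conj[OF 2 3] 4]
    show "prob_ge M (1 - (real (card T) * C1 + q2) / real n) (\<lambda>\<omega>.
      \<forall>a\<in>cball a0 R. norm (increment f a0 n \<omega> a) \<le> \<epsilon> * R)"
    proof (rule prob_ge_mono)
      fix \<omega>
      assume "(\<bar>emean n (\<lambda>i. Q (Y i \<omega>)) - q\<bar> \<le> 1 \<and> (\<forall>i. \<forall>a\<in>cball a0 \<rho>. \<forall>b\<in>cball a0 \<rho>.
          norm (f (Y i \<omega>) a - f (Y i \<omega>) b) \<le> Q (Y i \<omega>) * dist a b)) \<and>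
          (\<forall>t\<in>T. norm (dev \<omega> (a0 + R *\<^sub>R t) - dev \<omega> a0) \<le> \<epsilon>/2 * R)"
      then have w1: "emean n (\<lambda>i. Q (Y i \<omega>)) \<le> \<bar>q\<bar> + 1"
        and w2: "\<And>i a b. a \<in> cball a0 \<rho> \<Longrightarrow> b \<in> cball a0 \<rho> \<Longrightarrow>
           norm (f (Y i \<omega>) a - f (Y i \<omega>) b) \<le> Q (Y i \<omega>) * dist a b"
        and w3: "\<And>t. t \<in> T \<Longrightarrow> norm (dev \<omega> (a0 + R *\<^sub>R t) - dev \<omega> a0) \<le> \<epsilon>/2 * R"
        by auto
      show "\<forall>a\<in>cball a0 R. norm (increment f a0 n \<omega> a) \<le> \<epsilon> * R"
      proof
        fix a assume a: "a \<in> cball a0 R"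
        then have a': "a \<in> cball a0 \<rho>" using R by auto
        have "norm (a - a0) \<le> R" using a by (simp add: dist_norm norm_minus_commute)
        then have "inverse R * norm (a - a0) \<le> inverse R * R" using R by (intro mult_left_mono) auto
        then have "(a - a0) /\<^sub>R R \<in> cball 0 1" using R by simp
        then obtain t where "t \<in> T" "(a - a0) /\<^sub>R R \<in> ball t \<eta>" using T(3) by blast
        then have t: "t \<in> T" "norm ((a - a0) /\<^sub>R R - t) < \<eta>"
          by (simp_all add: dist_norm norm_minus_commute)
        define b where "b = a0 + R *\<^sub>R t"
        have "norm t \<le> 1" using T(1) t by auto
        then have "R * norm t \<le> \<rho>" using R mult_mono[of R \<rho> "norm t" 1] by simp
        then have b: "b \<in> cball a0 \<rho>" using R by (simp add: dist_norm b_def)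
        have "a - b = R *\<^sub>R ((a - a0) /\<^sub>R R - t)" using R by (simp add: b_def algebra_simps)
        then have d: "dist a b \<le> R * \<eta>" using t R by (simp add: dist_norm)
        have "norm (emean n (\<lambda>i. f (Y i \<omega>) a) - emean n (\<lambda>i. f (Y i \<omega>) b))
          \<le> emean n (\<lambda>i. Q (Y i \<omega>)) * dist a b"
          using w2[OF a' b] by (rule norm_emean_diff_le)
        also have "\<dots> \<le> (\<bar>q\<bar> + 1) * (R * \<eta>)"
          using w1 d eta R by (intro mult_mono) auto
        finally have e1: "norm (emean n (\<lambda>i. f (Y i \<omega>) a) - emean n (\<lambda>i. f (Y i \<omega>) b))
          \<le> (\<bar>q\<bar> + 1) * (R * \<eta>)" .
        have "norm (\<integral>y. f y a - f y b \<partial>F) \<le> (\<integral>y. Q y * dist a b \<partial>F)"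
        proof (rule norm_integral_le_AE)
          show "AE y in F. norm (f y a - f y b) \<le> Q y * dist a b"
            using lip a' b by auto
        qed (use fi[OF a'] fi[OF b] Q1 in auto)
        also have "\<dots> = q * dist a b" using Q1 by (simp add: q_def)
        also have "\<dots> \<le> \<bar>q\<bar> * (R * \<eta>)" using d by (intro mult_mono) auto
        finally have e2: "norm ((\<integral>y. f y a \<partial>F) - (\<integral>y. f y b \<partial>F)) \<le> \<bar>q\<bar> * (R * \<eta>)"
          using fi[OF a'] fi[OF b] by simp
        have "norm (dev \<omega> a - dev \<omega> b) \<le> (\<bar>q\<bar> + 1) * (R * \<eta>) + \<bar>q\<bar> * (R * \<eta>)"
          unfolding dev_def using norm_triangle_ineq4[of "emean n (\<lambda>i. f (Y i \<omega>) a) - emean n (\<lambda>i. f (Y i \<omega>) b)"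
            "(\<integral>y. f y a \<partial>F) - (\<integral>y. f y b \<partial>F)"] e1 e2 by (simp add: algebra_simps)
        also have "\<dots> = ((2 * \<bar>q\<bar> + 1) * \<eta>) * R" by (simp add: algebra_simps)
        also have "\<dots> = \<epsilon>/2 * R" by (simp only: eta(2))
        finally have "norm (dev \<omega> a - dev \<omega> b) \<le> \<epsilon>/2 * R" .
        moreover have "norm (dev \<omega> b - dev \<omega> a0) \<le> \<epsilon>/2 * R" using w3[OF t(1)] by (simp add: b_def)
        ultimately have "norm (dev \<omega> a - dev \<omega> a0) \<le> \<epsilon> * R"
          using norm_triangle_ineq[of "dev \<omega> a - dev \<omega> b" "dev \<omega> b - dev \<omega> a0"] by simp
        moreover have "increment f a0 n \<omega> a = dev \<omega> a - dev \<omega> a0" by (simp add: dev_def increment_def)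
        ultimately show "norm (increment f a0 n \<omega> a) \<le> \<epsilon> * R"
          by (simp only:)
      qed
    next
      show "1 - (real (card T) * C1 + q2) / real n \<le> 1 - (q2 / (real n * 1\<^sup>2) + 0 + real (card T) * (C1 / real n))"
        by (simp add: add_divide_distrib)
    qed
  qed
qed

text \<open>Chebyshev's inequality costs \<open>O(1/n)\<close> per dyadic scale and only \<open>o(n)\<close> scales lie between
  \<open>\<rho>\<close> and \<open>1 / sqrt n\<close>, so no chaining is needed for a modulus of this strength.\<close>

lemma modulus:
  fixes f :: "'y \<Rightarrow> 'a::euclidean_space \<Rightarrow> 'b::euclidean_space"
  assumes f_meas: "\<And>a. a \<in> cball a0 \<rho> \<Longrightarrow> (\<lambda>y. f y a) \<in> borel_measurable borel"
    and f0: "integrable F (\<lambda>y. f y a0)"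
    and lip: "AE y in F. \<forall>a\<in>cball a0 \<rho>. \<forall>b\<in>cball a0 \<rho>. norm (f y a - f y b) \<le> Q y * dist a b"
    and Q_meas: "Q \<in> borel_measurable borel" and Q2: "integrable F (\<lambda>y. (Q y)\<^sup>2)"
    and eps: "\<epsilon> > 0" and rho: "\<rho> > 0"
  shows "likely M (\<lambda>n \<omega>.
      \<forall>a\<in>cball a0 \<rho>. norm (increment f a0 n \<omega> a) \<le> \<epsilon> * max (dist a a0) (1 / sqrt (real n)))"
proof -
  obtain C where C: "C \<ge> 0" "\<And>R n. 0 < R \<Longrightarrow> R \<le> \<rho> \<Longrightarrow> n \<ge> 1 \<Longrightarrow> prob_ge M (1 - C / real n) (\<lambda>\<omega>.
      \<forall>a\<in>cball a0 R. norm (increment f a0 n \<omega> a) \<le> \<epsilon>/2 * R)"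
    by (rule modulus_one_scale[OF f_meas f0 lip Q_meas Q2 half_gt_zero[OF eps]]) (assumption | rule that)+
  \<comment> \<open>Order \<open>log n\<close> scales would reach \<open>1 / sqrt n\<close>; taking
    about \<open>sqrt n\<close> of them still costs only \<open>O(1 / sqrt n)\<close> in
    probability, and the last radius is then exponentially small in \<open>sqrt n\<close>.\<close>
  define K where "K n = nat \<lfloor>sqrt (real n)\<rfloor>" for n :: nat
  have K: "real (K n) \<le> sqrt (real n)" "real (K n) \<ge> sqrt (real n) - 1" for n
    unfolding K_def by (auto simp: of_nat_nat)
  have "likely M (\<lambda>n \<omega>. \<forall>k\<in>{..K n}.
      \<forall>a\<in>cball a0 (\<rho> * (1/2)^k). norm (increment f a0 n \<omega> a) \<le> \<epsilon>/2 * (\<rho> * (1/2)^k))"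
  proof (rule likely_bound)
    fix n :: nat assume n: "n \<ge> 1"
    show "prob_ge M (1 - real (card {..K n}) * (C / real n)) (\<lambda>\<omega>. \<forall>k\<in>{..K n}.
      \<forall>a\<in>cball a0 (\<rho> * (1/2)^k). norm (increment f a0 n \<omega> a) \<le> \<epsilon>/2 * (\<rho> * (1/2)^k))"
      using rho n by (intro prob_ge_Ball C(2)) (auto simp: mult_le_cancel_left1 power_le_one)
  next
    show "(\<lambda>n. real (card {..K n}) * (C / real n)) \<longlonglongrightarrow> 0"
    proof (rule tendsto_sandwich[of "\<lambda>_. 0"])
      show "\<forall>\<^sub>F n in sequentially. real (card {..K n}) * (C / real n) \<le> (sqrt (real n) + 1) * (C / real n)"
        using K C by (intro always_eventually allI mult_right_mono) auto
      have "(\<lambda>n::nat. (sqrt (real n) + 1) / real n) \<longlonglongrightarrow> 0" by real_asymp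
      from tendsto_mult_left_zero[OF this, of C]
      show "(\<lambda>n. (sqrt (real n) + 1) * (C / real n)) \<longlonglongrightarrow> 0" by simp
    qed (use C in auto)
  qed
  then show ?thesis
  proof (rule likely_mono)
    have "(\<lambda>n::nat. 2 * 2 powr (- sqrt (real n)) * sqrt (real n)) \<longlonglongrightarrow> 0"
      by real_asymp
    then have "\<forall>\<^sub>F n::nat in sequentially. 2 * 2 powr (- sqrt (real n)) * sqrt (real n) < 1 / \<rho>"
      by (rule order_tendstoD(2)) (use rho in simp)
    then have "\<forall>\<^sub>F n::nat in sequentially. \<rho> * (2 * 2 powr (- sqrt (real n))) \<le> 1 / sqrt (real n)"
      using eventually_gt_at_top[of 0]
      by eventually_elim (use rho in \<open>simp add: field_simps\<close>)
    then show "\<forall>\<^sub>F n in sequentially. \<forall>\<omega>. (\<forall>k\<in>{..K n}.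
      \<forall>a\<in>cball a0 (\<rho> * (1/2)^k). norm (increment f a0 n \<omega> a) \<le> \<epsilon>/2 * (\<rho> * (1/2)^k)) \<longrightarrow>
      (\<forall>a\<in>cball a0 \<rho>. norm (increment f a0 n \<omega> a) \<le> \<epsilon> * max (dist a a0) (1 / sqrt (real n)))"
    proof eventually_elim
      case (elim n)
      have "(1/2)^K n = 2 powr (- real (K n))"
        by (simp add: powr_minus_divide powr_realpow power_one_over)
      also have "\<dots> \<le> 2 powr (1 - sqrt (real n))" using K(2)[of n] by simp
      also have "\<dots> = 2 * 2 powr (- sqrt (real n))" by (simp add: powr_diff powr_minus_divide)
      finally have "\<rho> * (1/2)^K n \<le> \<rho> * (2 * 2 powr (- sqrt (real n)))"
        using rho by (intro mult_left_mono) auto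
      with elim have last: "\<rho> * (1/2)^K n \<le> 1 / sqrt (real n)" by linarith
      show ?case
      proof (intro allI impI ballI)
        fix \<omega> a
        assume w: "\<forall>k\<in>{..K n}.
      \<forall>a\<in>cball a0 (\<rho> * (1/2)^k). norm (increment f a0 n \<omega> a) \<le> \<epsilon>/2 * (\<rho> * (1/2)^k)"
        assume a: "a \<in> cball a0 \<rho>"
        then obtain k where k: "k \<le> K n" "dist a a0 \<le> \<rho> * (1/2)^k"
          "\<rho> * (1/2)^k \<le> 2 * max (dist a a0) (1 / sqrt (real n))"
        proof -
          have "dist a a0 \<le> \<rho>" using a by (simp add: dist_commute)
          from dyadic_scale[OF this, of "K n"] show ?thesis
          proof (elim disjE exE conjE)
            \<comment> \<open>Below the last scale the distance itself gives no lower bound; the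
              floor \<open>1 / sqrt n\<close> in the maximum takes over.\<close>
            assume *: "dist a a0 \<le> \<rho> * (1/2)^K n"
            have "1 / sqrt (real n) \<ge> 0" by simp
            then have "\<rho> * (1/2)^K n \<le> 2 * max (dist a a0) (1 / sqrt (real n))"
              using last by linarith
            with * show ?thesis by (intro that[of "K n"]) auto
          next
            fix k assume "k < K n" "\<rho> * (1/2)^k / 2 < dist a a0" "dist a a0 \<le> \<rho> * (1/2)^k"
            then show ?thesis by (intro that[of k]) auto
          qed
        qed
        have "norm (increment f a0 n \<omega> a) \<le> \<epsilon>/2 * (\<rho> * (1/2)^k)"
          using w k by (auto simp: dist_commute)
        also have "\<dots> \<le> \<epsilon>/2 * (2 * max (dist a a0) (1 / sqrt (real n)))"
          using k eps by (intro mult_left_mono) auto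
        finally show "norm (increment f a0 n \<omega> a) \<le> \<epsilon> * max (dist a a0) (1 / sqrt (real n))" by simp
      qed
    qed
  qed
qed

end

section \<open>Empirical likelihood and its dual problem\<close>

lemma ln_le_tangent:
  fixes x y :: real
  assumes "x > 0" "y > 0"
  shows "ln y \<le> ln x + (y - x) / x"
proof -
  have "ln (y / x) \<le> y / x - 1" using assms by (intro ln_le_minus_one) auto
  then show ?thesis using assms by (simp add: ln_div diff_divide_distrib)
qed

lemma ln_less_tangent:
  fixes x y :: real
  assumes "x > 0" "y > 0" "x \<noteq> y"
  shows "ln y < ln x + (y - x) / x"
proof -
  have "ln (y / x) \<le> y / x - 1" "ln (y / x) \<noteq> y / x - 1"
    using assms ln_eq_minus_one[of "y/x"] by (auto intro: ln_le_minus_one)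
  then show ?thesis using assms by (simp add: ln_div diff_divide_distrib)
qed

lemma ln_lipschitz:
  fixes x y c :: real
  assumes "c > 0" "x \<ge> c" "y \<ge> c"
  shows "\<bar>ln x - ln y\<bar> \<le> \<bar>x - y\<bar> / c"
proof -
  have *: "ln y - ln x \<le> \<bar>x - y\<bar> / c" if "x \<ge> c" "y \<ge> c" for x y
  proof -
    have "(y - x) / x \<le> \<bar>x - y\<bar> / c" using that assms(1) by (intro frac_le) auto
    then show ?thesis using ln_le_tangent[of x y] that assms(1) by linarith
  qed
  show ?thesis using *[of x y] *[of y x] assms by (auto simp: abs_minus_commute)
qed

text \<open>The gap \<open>u - ln (1 + u)\<close> grows linearly in \<open>\<bar>u\<bar>\<close>, so
  first absolute moments control it. For \<open>u \<ge> 0\<close> this is the tangent at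
  \<open>1 + u = 2\<close> together with \<open>ln 2 \<le> 1\<close>; for negative \<open>u\<close>
  the correction \<open>1/2 - \<bar>u\<bar>/2\<close> is nonnegative.\<close>

lemma ln_one_plus_upper:
  fixes u :: real
  assumes "u > -1"
  shows "ln (1 + u) \<le> u - \<bar>u\<bar>/2 + 1/2"
proof (cases "u \<ge> 0")
  case True
  have "ln ((1 + u) / 2) \<le> (1 + u) / 2 - 1" using assms by (intro ln_le_minus_one) auto
  moreover have "ln ((1 + u) / 2) = ln (1 + u) - ln 2" using assms by (simp add: ln_div)
  moreover have "ln (2::real) \<le> 1" using ln_le_minus_one[of "2::real"] by simp
  ultimately show ?thesis using True by (simp add: field_simps)
next
  case False
  then show ?thesis using ln_le_minus_one[of "1 + u"] assms by simp
qed

text \<open>Weak duality. For feasible weights the numbers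
  \<open>real n * (w i * (1 + l \<bullet> v i))\<close> have mean one, so their product is at most
  one by the inequality of arithmetic and geometric means, obtained here from
  \<open>x \<le> exp (x - 1)\<close>. Boundedness is recorded because the supremum is one of real
  numbers.\<close>

lemma emp_lik_le:
  fixes v :: "nat \<Rightarrow> 'q::real_inner"
  assumes n: "n \<ge> 1" and pos: "\<And>i. i < n \<Longrightarrow> 1 + l \<bullet> v i > 0"
  shows "emp_lik n v \<le> (\<Prod>i<n. 1 / (real n * (1 + l \<bullet> v i)))"
    and "bdd_above ((\<lambda>w. \<Prod>i<n. w i) ` el_weights n v)"
proof -
  let ?U = "\<Prod>i<n. 1 / (real n * (1 + l \<bullet> v i))"
  have U: "?U \<ge> 0" using pos by (intro prod_nonneg) (auto intro: less_imp_le)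
  have *: "(\<Prod>i<n. w i) \<le> ?U" if w: "w \<in> el_weights n v" for w
  proof -
    have w': "(\<Sum>i<n. w i) = 1" "(\<Sum>i<n. w i *\<^sub>R v i) = 0" "\<And>i. i < n \<Longrightarrow> w i \<ge> 0"
      using w by (auto simp: el_weights_def)
    have "(\<Sum>i<n. w i * (l \<bullet> v i)) = l \<bullet> (\<Sum>i<n. w i *\<^sub>R v i)"
      by (simp add: inner_sum_right)
    then have s: "(\<Sum>i<n. w i * (1 + l \<bullet> v i)) = 1" using w' by (simp add: algebra_simps sum.distrib)
    define x where "x i = real n * (w i * (1 + l \<bullet> v i))" for i
    have "(\<Prod>i<n. x i) \<le> (\<Prod>i<n. exp (x i - 1))"
    proof (rule prod_mono)
      fix i assume "i \<in> {..<n}"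
      then show "0 \<le> x i \<and> x i \<le> exp (x i - 1)"
        using w'(3)[of i] pos[of i] exp_ge_add_one_self[of "x i - 1"] by (auto simp: x_def)
    qed
    also have "\<dots> = exp (\<Sum>i<n. x i - 1)" by (simp add: exp_sum)
    also have "(\<Sum>i<n. x i - 1) = 0"
      using s by (simp add: x_def sum_subtractf sum_distrib_left[symmetric])
    finally have le1: "(\<Prod>i<n. x i) \<le> 1" by simp
    have "(\<Prod>i<n. w i) = (\<Prod>i<n. x i * (1 / (real n * (1 + l \<bullet> v i))))"
      by (rule prod.cong) (use pos n in \<open>force simp: x_def\<close>)+
    also have "\<dots> = (\<Prod>i<n. x i) * ?U" by (rule prod.distrib)
    also have "\<dots> \<le> 1 * ?U" using le1 U by (intro mult_right_mono) auto
    finally show ?thesis by simp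
  qed
  then show "bdd_above ((\<lambda>w. \<Prod>i<n. w i) ` el_weights n v)" by (auto intro!: bdd_aboveI)
  show "emp_lik n v \<le> ?U"
    unfolding emp_lik_def using * U by (auto intro: cSUP_least)
qed

lemma ln_prod_weights:
  fixes v :: "nat \<Rightarrow> 'q::real_inner"
  assumes n: "n \<ge> 1" and pos: "\<And>i. i < n \<Longrightarrow> 1 + l \<bullet> v i > 0"
  shows "ln (\<Prod>i<n. 1 / (real n * (1 + l \<bullet> v i))) = - real n * ln (real n) - (\<Sum>i<n. ln (1 + l \<bullet> v i))"
proof -
  have "ln (\<Prod>i<n. 1 / (real n * (1 + l \<bullet> v i))) = (\<Sum>i<n. ln (1 / (real n * (1 + l \<bullet> v i))))"
    using n by (intro ln_prod) (auto dest: pos)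
  also have "\<dots> = (\<Sum>i<n. - ln (real n) - ln (1 + l \<bullet> v i))"
    by (rule sum.cong) (use n pos in \<open>force simp: ln_div ln_mult\<close>)+
  finally show ?thesis by (simp add: sum_subtractf)
qed

text \<open>Strong duality: the reciprocal weights are feasible and attain the upper bound. They sum
  to one because the sum of \<open>w i * (1 + l \<bullet> v i)\<close> is one and the estimating
  equation removes the term with \<open>l\<close>.\<close>

lemma emp_lik_eq:
  fixes v :: "nat \<Rightarrow> 'q::real_inner"
  assumes n: "n \<ge> 1" and sol: "solves_emp n v l"
  shows "emp_lik n v = (\<Prod>i<n. 1 / (real n * (1 + l \<bullet> v i)))"
proof (rule antisym)
  have pos: "\<And>i. i < n \<Longrightarrow> 1 + l \<bullet> v i > 0" and zero: "(\<Sum>i<n. v i /\<^sub>R (1 + l \<bullet> v i)) = 0"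
    using sol n by (auto simp: solves_emp_def)
  show "emp_lik n v \<le> (\<Prod>i<n. 1 / (real n * (1 + l \<bullet> v i)))"
    using emp_lik_le[OF n pos] by simp
  define w where "w i = 1 / (real n * (1 + l \<bullet> v i))" for i
  have "(\<Sum>i<n. w i *\<^sub>R v i) = (\<Sum>i<n. v i /\<^sub>R (1 + l \<bullet> v i)) /\<^sub>R real n"
    by (simp add: w_def scaleR_sum_right divide_inverse mult.commute)
  then have wv: "(\<Sum>i<n. w i *\<^sub>R v i) = 0" using zero by simp
  have "(\<Sum>i<n. w i * (1 + l \<bullet> v i)) = (\<Sum>i<n. 1 / real n)"
    by (rule sum.cong) (use pos in \<open>force simp: w_def\<close>)+
  then have "(\<Sum>i<n. w i * (1 + l \<bullet> v i)) = 1" using n by simp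
  moreover have "(\<Sum>i<n. w i * (l \<bullet> v i)) = l \<bullet> (\<Sum>i<n. w i *\<^sub>R v i)"
    by (simp add: inner_sum_right)
  ultimately have "(\<Sum>i<n. w i) = 1" using wv by (simp add: algebra_simps sum.distrib)
  then have w: "w \<in> el_weights n v"
    using wv pos by (auto simp: el_weights_def w_def intro: less_imp_le)
  then have "(\<Prod>i<n. w i) \<le> (SUP w\<in>el_weights n v. \<Prod>i<n. w i)"
    using emp_lik_le(2)[OF n pos] by (intro cSUP_upper) auto
  then show "(\<Prod>i<n. 1 / (real n * (1 + l \<bullet> v i))) \<le> emp_lik n v"
    using w by (auto simp: emp_lik_def w_def)
qed

lemma ln_emp_lik_le:
  fixes v :: "nat \<Rightarrow> 'q::real_inner"
  assumes n: "n \<ge> 1" and pos: "\<And>i. i < n \<Longrightarrow> 1 + l \<bullet> v i > 0" and "emp_lik n v > 0"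
  shows "ln (emp_lik n v) \<le> - real n * ln (real n) - (\<Sum>i<n. ln (1 + l \<bullet> v i))"
proof -
  have "emp_lik n v \<le> (\<Prod>i<n. 1 / (real n * (1 + l \<bullet> v i)))"
    using emp_lik_le(1)[of n l v] n pos by blast
  then have "ln (emp_lik n v) \<le> ln (\<Prod>i<n. 1 / (real n * (1 + l \<bullet> v i)))"
    using assms(3) by simp
  also have "\<dots> = - real n * ln (real n) - (\<Sum>i<n. ln (1 + l \<bullet> v i))"
    using ln_prod_weights[of n l v] n pos by blast
  finally show ?thesis .
qed

lemma ln_emp_lik_eq:
  fixes v :: "nat \<Rightarrow> 'q::real_inner"
  assumes n: "n \<ge> 1" and sol: "solves_emp n v l"
  shows "emp_lik n v > 0" "ln (emp_lik n v) = - real n * ln (real n) - (\<Sum>i<n. ln (1 + l \<bullet> v i))"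
proof -
  have pos: "\<And>i. i < n \<Longrightarrow> 1 + l \<bullet> v i > 0"
    using sol n by (auto simp: solves_emp_def)
  show "emp_lik n v > 0" unfolding emp_lik_eq[OF assms] using pos n by (auto intro!: prod_pos)
  show "ln (emp_lik n v) = - real n * ln (real n) - (\<Sum>i<n. ln (1 + l \<bullet> v i))"
    unfolding emp_lik_eq[OF assms] using n pos by (rule ln_prod_weights)
qed

text \<open>The dual objective is maximised as a product, not as a sum of logarithms: the product is
  continuous on the compact set where the factors are nonnegative and vanishes where a factor does.
  A maximiser therefore has positive factors, the hypothesis on the sphere keeps it inside the ball,
  and the vanishing gradient is the equation sought.\<close>

lemma solves_emp_exists:
  fixes v :: "nat \<Rightarrow> 'q::euclidean_space"
  assumes n: "n \<ge> 1" and pos: "\<And>i. i < n \<Longrightarrow> 1 + l1 \<bullet> v i > 0" and R: "R > 0"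
    and sphere: "\<And>l. norm (l - l1) = R \<Longrightarrow> (\<And>i. i < n \<Longrightarrow> 1 + l \<bullet> v i > 0) \<Longrightarrow>
      (\<Sum>i<n. ln (1 + l \<bullet> v i)) < (\<Sum>i<n. ln (1 + l1 \<bullet> v i))"
  obtains l where "norm (l - l1) < R" "solves_emp n v l"
proof -
  define K where "K = cball l1 R \<inter> (\<Inter>i<n. {l. 0 \<le> 1 + l \<bullet> v i})"
  define f where "f l = (\<Prod>i<n. 1 + l \<bullet> v i)" for l
  have K: "compact K" unfolding K_def
    by (intro compact_Int_closed compact_cball closed_INT ballI closed_Collect_le continuous_intros)
  have l1: "l1 \<in> K" unfolding K_def using pos R by (auto intro: less_imp_le)
  have "continuous_on K f" unfolding f_def by (intro continuous_intros)
  from continuous_attains_sup[OF K _ this] l1 obtain l where l: "l \<in> K" "\<And>x. x \<in> K \<Longrightarrow> f x \<le> f l" by blast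
  have f1: "f l1 > 0" unfolding f_def using pos by (intro prod_pos) auto
  with l(2)[OF l1] have fl: "f l > 0" by linarith
  have lpos: "1 + l \<bullet> v i > 0" if "i < n" for i
  proof -
    have "1 + l \<bullet> v i \<noteq> 0" using fl that unfolding f_def by (metis finite_lessThan lessThan_iff less_irrefl prod_zero_iff)
    moreover have "1 + l \<bullet> v i \<ge> 0" using l(1) that by (auto simp: K_def)
    ultimately show ?thesis by linarith
  qed
  have lnf: "ln (f x) = (\<Sum>i<n. ln (1 + x \<bullet> v i))" if "\<And>i. i < n \<Longrightarrow> 1 + x \<bullet> v i > 0" for x
    unfolding f_def by (intro ln_prod) (auto dest: that)
  have "ln (f l1) \<le> ln (f l)" using l(2)[OF l1] f1 fl by simp
  then have "norm (l - l1) \<noteq> R" using sphere[of l] lpos lnf pos by force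
  moreover have "norm (l - l1) \<le> R" using l(1) by (auto simp: K_def dist_norm norm_minus_commute)
  ultimately have less: "norm (l - l1) < R" by simp
  define U where "U = ball l1 R \<inter> (\<Inter>i<n. {l. 0 < 1 + l \<bullet> v i})"
  have U: "open U" unfolding U_def
    by (intro open_Int open_ball open_INT ballI open_Collect_less continuous_intros) auto
  have lU: "l \<in> U" using less lpos by (auto simp: U_def dist_norm norm_minus_commute)
  define S where "S x = (\<Sum>i<n. ln (1 + x \<bullet> v i))" for x
  have der: "(S has_derivative (\<lambda>h. \<Sum>i<n. (h \<bullet> v i) * inverse (1 + l \<bullet> v i))) (at l)"
    unfolding S_def using lpos by (auto intro!: derivative_eq_intros simp: mult.commute)
  have "S x \<le> S l" if x: "x \<in> U" for x
  proof -
    have xp: "\<And>i. i < n \<Longrightarrow> 1 + x \<bullet> v i > 0" using x by (auto simp: U_def)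
    have "x \<in> K" using x by (auto simp: U_def K_def intro: less_imp_le)
    then have "f x \<le> f l" by (rule l(2))
    moreover have "f x > 0" unfolding f_def using xp by (intro prod_pos) auto
    ultimately have "ln (f x) \<le> ln (f l)" by simp
    then show ?thesis using lnf[OF xp] lnf[OF lpos] by (simp add: S_def)
  qed
  with differential_zero_maxmin[OF lU U der]
  have z: "(\<lambda>h. \<Sum>i<n. (h \<bullet> v i) * inverse (1 + l \<bullet> v i)) = (\<lambda>h. 0)" by blast
  define g where "g = (\<Sum>i<n. v i /\<^sub>R (1 + l \<bullet> v i))"
  have "x \<bullet> g = (\<Sum>i<n. (x \<bullet> v i) * inverse (1 + l \<bullet> v i))" for x
    unfolding g_def inner_sum_right by (simp add: mult.commute)
  then have "g \<bullet> g = (\<Sum>i<n. (g \<bullet> v i) * inverse (1 + l \<bullet> v i))" .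
  also have "\<dots> = 0" using fun_cong[OF z, of g] by simp
  finally have "g = 0" by simp
  then have "solves_emp n v l" using lpos by (simp add: solves_emp_def g_def)
  with less show ?thesis by (rule that)
qed

text \<open>The radius \<open>4 / \<kappa>\<close> is large enough for the linear growth of \<open>u - ln (1 + u)\<close> to beat its
  additive constant.\<close>

lemma emp_lik_lower:
  fixes v :: "nat \<Rightarrow> 'q::euclidean_space"
  assumes n: "n \<ge> 1" and pos: "\<And>i. i < n \<Longrightarrow> 1 + l1 \<bullet> v i > 0" and kappa: "\<kappa> > 0"
    and nondeg: "\<And>d. emean n (\<lambda>i. \<bar>d \<bullet> (v i /\<^sub>R (1 + l1 \<bullet> v i))\<bar>) \<ge> \<kappa> * norm d"
    and small: "norm (emean n (\<lambda>i. v i /\<^sub>R (1 + l1 \<bullet> v i))) \<le> \<kappa>/16"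
  shows "emp_lik n v > 0"
    and "ln (emp_lik n v) \<ge> - real n * ln (real n) - real n * (emean n (\<lambda>i. ln (1 + l1 \<bullet> v i))
       + 4 / \<kappa> * norm (emean n (\<lambda>i. v i /\<^sub>R (1 + l1 \<bullet> v i))))"
proof -
  define g where "g i = v i /\<^sub>R (1 + l1 \<bullet> v i)" for i
  \<comment> \<open>Recentring the multiplier at \<open>l1\<close> gives a dual problem of the same
    form with \<open>g\<close> in place of \<open>v\<close>, and the empirical mean of
    \<open>g\<close> is small.\<close>
  have split: "1 + l \<bullet> v i = (1 + l1 \<bullet> v i) * (1 + (l - l1) \<bullet> g i)" if "i < n" for l i
    using pos[OF that] by (simp add: g_def inner_diff_left field_simps)
  have lin: "emean n (\<lambda>i. d \<bullet> g i) = d \<bullet> emean n g" for d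
    by (rule emean_linear[of "\<lambda>x. d \<bullet> x"]) (rule bounded_linear.linear[OF bounded_linear_inner_right])
  have *: "1 + (l - l1) \<bullet> g i > 0" "ln (1 + l \<bullet> v i) = ln (1 + l1 \<bullet> v i) + ln (1 + (l - l1) \<bullet> g i)"
    if "i < n" "1 + l \<bullet> v i > 0" for l i
  proof -
    show p: "1 + (l - l1) \<bullet> g i > 0"
      using that pos[OF that(1)] unfolding split[OF that(1), of l] by (simp add: zero_less_mult_iff)
    show "ln (1 + l \<bullet> v i) = ln (1 + l1 \<bullet> v i) + ln (1 + (l - l1) \<bullet> g i)"
      unfolding split[OF that(1), of l] using p pos[OF that(1)] by (intro ln_mult_pos) auto
  qed
  have "\<exists>l. norm (l - l1) < 4/\<kappa> \<and> solves_emp n v l"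
  proof (rule solves_emp_exists[OF n, of l1 v "4/\<kappa>"])
    fix l assume l: "norm (l - l1) = 4/\<kappa>" "\<And>i. i < n \<Longrightarrow> 1 + l \<bullet> v i > 0"
    let ?d = "l - l1"
    have "emean n (\<lambda>i. ln (1 + l \<bullet> v i)) = emean n (\<lambda>i. ln (1 + l1 \<bullet> v i) + ln (1 + ?d \<bullet> g i))"
      unfolding emean_def using *(2) l(2) by simp
    also have "\<dots> = emean n (\<lambda>i. ln (1 + l1 \<bullet> v i)) + emean n (\<lambda>i. ln (1 + ?d \<bullet> g i))"
      by (rule emean_add)
    also have "emean n (\<lambda>i. ln (1 + ?d \<bullet> g i)) \<le> emean n (\<lambda>i. ?d \<bullet> g i + (1/2 + (- 1/2) * \<bar>?d \<bullet> g i\<bar>))"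
    proof (rule emean_mono)
      fix i assume "i < n"
      then show "ln (1 + ?d \<bullet> g i) \<le> ?d \<bullet> g i + (1/2 + (- 1/2) * \<bar>?d \<bullet> g i\<bar>)"
        using ln_one_plus_upper[of "?d \<bullet> g i"] *(1)[of i l] l(2) by force
    qed
    also have "\<dots> = ?d \<bullet> emean n g + (1/2 - 1/2 * emean n (\<lambda>i. \<bar>?d \<bullet> g i\<bar>))"
      unfolding emean_add lin emean_mult emean_const[OF n] by simp
    \<comment> \<open>The linear term contributes at most \<open>1/4\<close>, the additive constant
      \<open>1/2\<close>, and the growth term subtracts \<open>2\<close>.\<close>
    also have "\<dots> \<le> 4/\<kappa> * (\<kappa>/16) + (1/2 - 1/2 * (\<kappa> * (4/\<kappa>)))"
    proof -
      have "?d \<bullet> emean n g \<le> norm ?d * norm (emean n g)" by (rule norm_cauchy_schwarz)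
      also have "\<dots> \<le> 4/\<kappa> * (\<kappa>/16)" using l(1) small kappa unfolding g_def
        by (intro mult_mono) auto
      finally show ?thesis using nondeg[of ?d] l(1) unfolding g_def by simp
    qed
    also have "\<dots> < 0" using kappa by simp
    finally have "emean n (\<lambda>i. ln (1 + l \<bullet> v i)) < emean n (\<lambda>i. ln (1 + l1 \<bullet> v i))" by simp
    then show "(\<Sum>i<n. ln (1 + l \<bullet> v i)) < (\<Sum>i<n. ln (1 + l1 \<bullet> v i))"
      using n by (simp add: emean_def)
  qed (use pos kappa in auto)
  then obtain l where l: "norm (l - l1) < 4/\<kappa>" "solves_emp n v l" by blast
  show "emp_lik n v > 0" by (rule ln_emp_lik_eq(1)[OF n l(2)])
  have lpos: "\<And>i. i < n \<Longrightarrow> 1 + l \<bullet> v i > 0" using l(2) by (simp add: solves_emp_def)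
  have "emean n (\<lambda>i. ln (1 + l \<bullet> v i)) \<le> emean n (\<lambda>i. ln (1 + l1 \<bullet> v i) + (l - l1) \<bullet> g i)"
  proof (rule emean_mono)
    fix i assume i: "i < n"
    show "ln (1 + l \<bullet> v i) \<le> ln (1 + l1 \<bullet> v i) + (l - l1) \<bullet> g i"
      using *[OF i lpos[OF i]] ln_le_minus_one[of "1 + (l - l1) \<bullet> g i"] by simp
  qed
  also have "\<dots> = emean n (\<lambda>i. ln (1 + l1 \<bullet> v i)) + (l - l1) \<bullet> emean n g"
    by (simp add: emean_add lin)
  also have "(l - l1) \<bullet> emean n g \<le> norm (l - l1) * norm (emean n g)" by (rule norm_cauchy_schwarz)
  also have "\<dots> \<le> 4/\<kappa> * norm (emean n g)" using l(1) by (intro mult_right_mono) auto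
  finally have "emean n (\<lambda>i. ln (1 + l \<bullet> v i)) \<le> emean n (\<lambda>i. ln (1 + l1 \<bullet> v i)) + 4/\<kappa> * norm (emean n g)"
    by simp
  then have "real n * emean n (\<lambda>i. ln (1 + l \<bullet> v i)) \<le>
      real n * (emean n (\<lambda>i. ln (1 + l1 \<bullet> v i)) + 4/\<kappa> * norm (emean n g))"
    by (rule mult_left_mono) simp
  moreover have "real n * emean n (\<lambda>i. ln (1 + l \<bullet> v i)) = (\<Sum>i<n. ln (1 + l \<bullet> v i))"
    using n by (simp add: emean_def)
  ultimately show "ln (emp_lik n v) \<ge> - real n * ln (real n) - real n * (emean n (\<lambda>i. ln (1 + l1 \<bullet> v i))
       + 4 / \<kappa> * norm (emean n (\<lambda>i. v i /\<^sub>R (1 + l1 \<bullet> v i))))"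
    using ln_emp_lik_eq(2)[OF n l(2)] unfolding g_def by linarith
qed

text \<open>The tube lemma with the second factor replaced by a filter. It lets a strict inequality
  on a whole sphere of multipliers persist when the other parameters move.\<close>

lemma eventually_compact_uniform:
  fixes K :: "'a::topological_space set"
  assumes K: "compact K"
    and ev: "\<And>x. x \<in> K \<Longrightarrow> \<forall>\<^sub>F p in nhds x \<times>\<^sub>F G. P (fst p) (snd p)"
  shows "\<forall>\<^sub>F y in G. \<forall>x\<in>K. P x y"
proof -
  have "\<exists>U Q. open U \<and> x \<in> U \<and> eventually Q G \<and> (\<forall>x'\<in>U. \<forall>y. Q y \<longrightarrow> P x' y)" if x: "x \<in> K" for x
  proof -
    obtain A Q where "eventually A (nhds x)" "eventually Q G" "\<And>x' y. A x' \<Longrightarrow> Q y \<Longrightarrow> P x' y"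
      using ev[OF x] unfolding eventually_prod_filter by auto
    then show ?thesis unfolding eventually_nhds by blast
  qed
  then obtain U Q where UQ: "\<And>x. x \<in> K \<Longrightarrow> open (U x)" "\<And>x. x \<in> K \<Longrightarrow> x \<in> U x"
    "\<And>x. x \<in> K \<Longrightarrow> eventually (Q x) G" "\<And>x x' y. x \<in> K \<Longrightarrow> x' \<in> U x \<Longrightarrow> Q x y \<Longrightarrow> P x' y"
    by metis
  have cov: "K \<subseteq> (\<Union>x\<in>K. U x)" using UQ(2) by blast
  obtain T where T: "T \<subseteq> K" "finite T" "K \<subseteq> (\<Union>x\<in>T. U x)"
    by (rule compactE_image[OF K UQ(1) cov]) (assumption | rule that)+
  have "\<forall>\<^sub>F y in G. \<forall>x\<in>T. Q x y" using T UQ(3) by (intro eventually_ball_finite) auto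
  then show ?thesis
  proof eventually_elim
    case (elim y)
    show ?case using T elim UQ(4) by blast
  qed
qed

lemma sum_ln_less_tangent:
  fixes v :: "nat \<Rightarrow> 'q::real_inner"
  assumes pos1: "\<And>i. i < n \<Longrightarrow> 1 + l1 \<bullet> v i > 0" and pos: "\<And>i. i < n \<Longrightarrow> 1 + l \<bullet> v i > 0"
  shows "(\<Sum>i<n. ln (1 + l \<bullet> v i)) \<le> (\<Sum>i<n. ln (1 + l1 \<bullet> v i)) + (l - l1) \<bullet> (\<Sum>i<n. v i /\<^sub>R (1 + l1 \<bullet> v i))"
    and "\<exists>i<n. (l - l1) \<bullet> v i \<noteq> 0 \<Longrightarrow> (\<Sum>i<n. ln (1 + l \<bullet> v i)) <
      (\<Sum>i<n. ln (1 + l1 \<bullet> v i)) + (l - l1) \<bullet> (\<Sum>i<n. v i /\<^sub>R (1 + l1 \<bullet> v i))"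
proof -
  let ?t = "\<lambda>i. ln (1 + l1 \<bullet> v i) + ((1 + l \<bullet> v i) - (1 + l1 \<bullet> v i)) / (1 + l1 \<bullet> v i)"
  have le: "ln (1 + l \<bullet> v i) \<le> ?t i" if "i < n" for i
    using ln_le_tangent[OF pos1[OF that] pos[OF that]] .
  have eq: "(\<Sum>i<n. ?t i) = (\<Sum>i<n. ln (1 + l1 \<bullet> v i)) + (l - l1) \<bullet> (\<Sum>i<n. v i /\<^sub>R (1 + l1 \<bullet> v i))"
    by (simp add: sum.distrib inner_sum_right inner_diff_left divide_inverse mult.commute)
  show "(\<Sum>i<n. ln (1 + l \<bullet> v i)) \<le> (\<Sum>i<n. ln (1 + l1 \<bullet> v i)) + (l - l1) \<bullet> (\<Sum>i<n. v i /\<^sub>R (1 + l1 \<bullet> v i))"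
    unfolding eq[symmetric] using le by (intro sum_mono) auto
  show "(\<Sum>i<n. ln (1 + l \<bullet> v i)) <
      (\<Sum>i<n. ln (1 + l1 \<bullet> v i)) + (l - l1) \<bullet> (\<Sum>i<n. v i /\<^sub>R (1 + l1 \<bullet> v i))"
    if ex: "\<exists>i<n. (l - l1) \<bullet> v i \<noteq> 0"
    unfolding eq[symmetric]
  proof (rule sum_strict_mono_ex1)
    obtain i where i: "i < n" "(l - l1) \<bullet> v i \<noteq> 0" using ex by blast
    then have "ln (1 + l \<bullet> v i) < ?t i"
      by (intro ln_less_tangent pos pos1) (auto simp: inner_diff_left)
    with i show "\<exists>i\<in>{..<n}. ln (1 + l \<bullet> v i) < ?t i" by blast
  qed (use le in auto)
qed

text \<open>The dual problem squeezes \<open>ln (emp_lik n (v \<mu>))\<close> between two functions with the same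
  derivative at \<open>\<mu>1\<close>, so the multiplier never has to be differentiated as a function of \<open>\<mu>\<close>.\<close>

lemma log_critical_profile:
  fixes v :: "nat \<Rightarrow> 'a::real_normed_vector \<Rightarrow> 'q::euclidean_space"
  assumes n: "n \<ge> 1" and \<mu>1: "\<mu>1 \<in> \<Theta>"
    and der: "\<And>i. i < n \<Longrightarrow> (v i has_derivative v' i) (at \<mu>1)"
    and sol: "solves_emp n (\<lambda>i. v i \<mu>1) l1"
    and crit: "\<And>e. (\<Sum>i<n. (l1 \<bullet> v' i e) / (1 + l1 \<bullet> v i \<mu>1)) = 0"
    and nondeg: "\<And>d. d \<noteq> 0 \<Longrightarrow> \<exists>i<n. d \<bullet> v i \<mu>1 \<noteq> 0"
  shows "log_critical \<Theta> (\<lambda>\<mu>. emp_lik n (\<lambda>i. v i \<mu>)) \<mu>1"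
proof -
  have pos: "\<And>i. i < n \<Longrightarrow> 1 + l1 \<bullet> v i \<mu>1 > 0" and zero: "(\<Sum>i<n. v i \<mu>1 /\<^sub>R (1 + l1 \<bullet> v i \<mu>1)) = 0"
    using sol n by (auto simp: solves_emp_def)
  have cont: "(v i \<longlongrightarrow> v i \<mu>1) (nhds \<mu>1)" if "i < n" for i
    using has_derivative_continuous[OF der[OF that]] by (simp add: continuous_at tendsto_at_iff_tendsto_nhds)
  have "open (\<Inter>i<n. {l. 0 < 1 + l \<bullet> v i \<mu>1})"
    by (intro open_INT ballI open_Collect_less continuous_intros) auto
  moreover have "l1 \<in> (\<Inter>i<n. {l. 0 < 1 + l \<bullet> v i \<mu>1})" using pos by auto
  ultimately obtain r0 where r0: "r0 > 0" "ball l1 r0 \<subseteq> (\<Inter>i<n. {l. 0 < 1 + l \<bullet> v i \<mu>1})"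
    using open_contains_ball by blast
  \<comment> \<open>At \<open>\<mu>1\<close> the dual objective is strictly smaller on the sphere
    than at its centre, by strict concavity and nondegeneracy. Compactness preserves this for nearby
    \<open>\<mu>\<close>, so the multiplier stays within any prescribed distance of
    \<open>l1\<close>.\<close>
  have near: "\<forall>\<^sub>F \<mu> in nhds \<mu>1. (\<forall>i<n. 1 + l1 \<bullet> v i \<mu> > 0) \<and>
     (\<exists>l. norm (l - l1) < r \<and> solves_emp n (\<lambda>i. v i \<mu>) l)" if r: "0 < r" "r < r0" for r
  proof -
    define S where "S l \<mu> = (\<Sum>i<n. ln (1 + l \<bullet> v i \<mu>))" for l \<mu>
    have "\<forall>\<^sub>F p in nhds l \<times>\<^sub>F nhds \<mu>1. S (fst p) (snd p) < S l1 (snd p)" if l: "l \<in> sphere l1 r" for l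
    proof -
      have lpos: "\<And>i. i < n \<Longrightarrow> 0 < 1 + l \<bullet> v i \<mu>1" using l r r0(2) by (auto simp: subset_eq)
      have l_ne: "l - l1 \<noteq> 0" using l r by auto
      have less: "S l \<mu>1 < S l1 \<mu>1"
        unfolding S_def using sum_ln_less_tangent(2)[OF pos lpos, of n, OF _ _ nondeg[OF l_ne]]
        by (simp add: zero)
      have f: "(fst \<longlongrightarrow> l) (nhds l \<times>\<^sub>F nhds \<mu>1)" by (rule filterlim_fst)
      have s: "((\<lambda>p. v i (snd p)) \<longlongrightarrow> v i \<mu>1) (nhds l \<times>\<^sub>F nhds \<mu>1)" if "i < n" for i
        by (rule filterlim_compose[OF cont[OF that] filterlim_snd])
      have "((\<lambda>p. S (fst p) (snd p)) \<longlongrightarrow> S l \<mu>1) (nhds l \<times>\<^sub>F nhds \<mu>1)"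
        "((\<lambda>p. S l1 (snd p)) \<longlongrightarrow> S l1 \<mu>1) (nhds l \<times>\<^sub>F nhds \<mu>1)"
        unfolding S_def using s f lpos pos by (auto intro!: tendsto_intros simp: less_imp_neq[symmetric])
      from order_tendstoD(1)[OF tendsto_diff[OF this(2) this(1)], of 0] less
      show ?thesis by simp
    qed
    from eventually_compact_uniform[OF compact_sphere this]
    have ev1: "\<forall>\<^sub>F \<mu> in nhds \<mu>1. \<forall>l\<in>sphere l1 r. S l \<mu> < S l1 \<mu>" by blast
    have "\<forall>\<^sub>F \<mu> in nhds \<mu>1. \<forall>i\<in>{..<n}. 1 + l1 \<bullet> v i \<mu> > 0"
    proof (intro eventually_ball_finite ballI finite_lessThan)
      fix i assume "i \<in> {..<n}"
      then show "\<forall>\<^sub>F \<mu> in nhds \<mu>1. 1 + l1 \<bullet> v i \<mu> > 0"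
        using pos by (intro order_tendstoD(1)[of _ "1 + l1 \<bullet> v i \<mu>1"] tendsto_intros cont) auto
    qed
    with ev1 show ?thesis
    proof eventually_elim
      case (elim \<mu>)
      have "\<exists>l. norm (l - l1) < r \<and> solves_emp n (\<lambda>i. v i \<mu>) l"
      proof (rule solves_emp_exists[OF n, of l1 "\<lambda>i. v i \<mu>" r])
        fix l assume "norm (l - l1) = r"
        then show "(\<Sum>i<n. ln (1 + l \<bullet> v i \<mu>)) < (\<Sum>i<n. ln (1 + l1 \<bullet> v i \<mu>))"
          using elim(1) by (auto simp: S_def dist_norm norm_minus_commute)
      qed (use elim(2) r in auto)
      then show ?case using elim(2) by auto
    qed
  qed
  define U where "U \<mu> = - real n * ln (real n) - (\<Sum>i<n. ln (1 + l1 \<bullet> v i \<mu>))" for \<mu>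
  define E where "E \<mu> = ln (emp_lik n (\<lambda>i. v i \<mu>))" for \<mu>
  define g where "g \<mu> = (\<Sum>i<n. v i \<mu> /\<^sub>R (1 + l1 \<bullet> v i \<mu>))" for \<mu>
  have EU1: "E \<mu>1 = U \<mu>1" unfolding E_def U_def by (rule ln_emp_lik_eq(2)[OF n sol])
  have "((\<lambda>\<mu>. \<Sum>i<n. ln (1 + l1 \<bullet> v i \<mu>)) has_derivative
      (\<lambda>e. \<Sum>i<n. (l1 \<bullet> v' i e) * inverse (1 + l1 \<bullet> v i \<mu>1))) (at \<mu>1)"
    using pos by (auto intro!: derivative_eq_intros der simp: mult.commute)
  also have "(\<lambda>e. \<Sum>i<n. (l1 \<bullet> v' i e) * inverse (1 + l1 \<bullet> v i \<mu>1)) = (\<lambda>e. 0)"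
    using crit by (simp add: divide_inverse)
  finally have "(U has_derivative (\<lambda>e. 0 - 0)) (at \<mu>1)"
    unfolding U_def by (intro has_derivative_diff has_derivative_const)
  then have derU: "(U has_derivative (\<lambda>e. 0)) (at \<mu>1)" by simp
  have "\<exists>g'. (g has_derivative g') (at \<mu>1)"
  proof -
    have "(\<lambda>\<mu>. v i \<mu> /\<^sub>R (1 + l1 \<bullet> v i \<mu>)) differentiable (at \<mu>1)" if "i \<in> {..<n}" for i
    proof -
      have vd: "v i differentiable (at \<mu>1)" using der that by (auto simp: differentiable_def)
      have "(\<lambda>\<mu>. l1 \<bullet> v i \<mu>) differentiable (at \<mu>1)"
        using has_derivative_inner_right[OF der[of i], of l1] that by (auto simp: differentiable_def)
      then show ?thesis using pos[of i] that vd
        by (intro differentiable_scaleR differentiable_inverse differentiable_add) auto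
    qed
    then have "g differentiable (at \<mu>1)" unfolding g_def by (intro differentiable_sum) auto
    then show ?thesis by (simp add: differentiable_def)
  qed
  then obtain g' where g': "(g has_derivative g') (at \<mu>1)" by blast
  have "g \<mu>1 = 0" using zero by (simp add: g_def)
  obtain C where C: "C > 0" "\<forall>\<^sub>F \<mu> in nhds \<mu>1. norm (g \<mu>) \<le> C * norm (\<mu> - \<mu>1)"
  proof -
    obtain B where B: "B > 0" "\<And>x. norm (g' x) \<le> norm x * B"
      using bounded_linear.pos_bounded[OF has_derivative_bounded_linear[OF g']] by blast
    obtain d where d: "d > 0" "\<And>y. norm (y - \<mu>1) < d \<Longrightarrow> norm (g y - g \<mu>1 - g' (y - \<mu>1)) \<le> 1 * norm (y - \<mu>1)"
      using g' unfolding has_derivative_at_alt by (metis zero_less_one)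
    have "\<forall>\<^sub>F \<mu> in nhds \<mu>1. norm (g \<mu>) \<le> (B + 1) * norm (\<mu> - \<mu>1)"
      unfolding eventually_nhds_metric
    proof (intro exI conjI allI impI)
      fix \<mu> assume "dist \<mu> \<mu>1 < d"
      then have "norm (g \<mu> - g' (\<mu> - \<mu>1)) \<le> norm (\<mu> - \<mu>1)"
        using d(2)[of \<mu>] \<open>g \<mu>1 = 0\<close> by (simp add: dist_norm)
      moreover have "norm (g \<mu>) \<le> norm (g \<mu> - g' (\<mu> - \<mu>1)) + norm (g' (\<mu> - \<mu>1))"
        using norm_triangle_ineq[of "g \<mu> - g' (\<mu> - \<mu>1)" "g' (\<mu> - \<mu>1)"] by simp
      ultimately show "norm (g \<mu>) \<le> (B + 1) * norm (\<mu> - \<mu>1)"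
        using B(2)[of "\<mu> - \<mu>1"] by (simp add: algebra_simps)
    qed (use d in auto)
    with B(1) show ?thesis by (intro that[of "B + 1"]) auto
  qed
  have "(E has_derivative (\<lambda>e. 0)) (at \<mu>1)"
    unfolding has_derivative_at_alt
  proof (intro conjI allI impI)
    show "bounded_linear (\<lambda>e::'a. 0::real)" by (rule bounded_linear_zero)
    fix \<epsilon> :: real assume eps: "\<epsilon> > 0"
    \<comment> \<open>One half of \<open>\<epsilon>\<close> is spent on the change of multiplier,
      the other on the derivative of \<open>U\<close>.\<close>
    define r where "r = min (r0/2) (\<epsilon> / (2 * C))"
    have r: "0 < r" "r < r0" using r0(1) eps C(1) by (auto simp: r_def)
    have "r \<le> \<epsilon> / (2 * C)" unfolding r_def by simp
    then have rC: "r * C \<le> \<epsilon>/2" using C(1) by (simp add: field_simps)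
    have "\<forall>\<^sub>F \<mu> in nhds \<mu>1. norm (U \<mu> - U \<mu>1) \<le> \<epsilon>/2 * norm (\<mu> - \<mu>1)"
    proof -
      have "\<exists>d>0. \<forall>y. norm (y - \<mu>1) < d \<longrightarrow> norm (U y - U \<mu>1 - 0) \<le> \<epsilon>/2 * norm (y - \<mu>1)"
        using derU eps unfolding has_derivative_at_alt by (metis half_gt_zero)
      then show ?thesis unfolding eventually_nhds_metric by (simp add: dist_norm)
    qed
    with near[OF r] C(2) have "\<forall>\<^sub>F \<mu> in nhds \<mu>1. norm (E \<mu> - E \<mu>1) \<le> \<epsilon> * norm (\<mu> - \<mu>1)"
    proof eventually_elim
      case (elim \<mu>)
      then obtain l where l: "norm (l - l1) < r" "solves_emp n (\<lambda>i. v i \<mu>) l" by blast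
      have p1: "\<And>i. i < n \<Longrightarrow> 1 + l1 \<bullet> v i \<mu> > 0" using elim(1) by blast
      have pl: "\<And>i. i < n \<Longrightarrow> 1 + l \<bullet> v i \<mu> > 0" using l(2) by (simp add: solves_emp_def)
      have up: "E \<mu> \<le> U \<mu>" unfolding E_def U_def
        using ln_emp_lik_le[of n l1 "\<lambda>i. v i \<mu>"] n p1 ln_emp_lik_eq(1)[OF n l(2)] by blast
      have "E \<mu> = - real n * ln (real n) - (\<Sum>i<n. ln (1 + l \<bullet> v i \<mu>))"
        unfolding E_def by (rule ln_emp_lik_eq(2)[OF n l(2)])
      moreover have "(\<Sum>i<n. ln (1 + l \<bullet> v i \<mu>)) \<le> (\<Sum>i<n. ln (1 + l1 \<bullet> v i \<mu>)) + (l - l1) \<bullet> g \<mu>"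
        unfolding g_def by (rule sum_ln_less_tangent(1)) (use p1 pl in auto)
      ultimately have low: "E \<mu> \<ge> U \<mu> - (l - l1) \<bullet> g \<mu>" unfolding U_def by linarith
      have "(l - l1) \<bullet> g \<mu> \<le> norm (l - l1) * norm (g \<mu>)" by (rule norm_cauchy_schwarz)
      also have "\<dots> \<le> r * (C * norm (\<mu> - \<mu>1))" using l(1) elim(2) r by (intro mult_mono) auto
      also have "\<dots> \<le> \<epsilon>/2 * norm (\<mu> - \<mu>1)"
        using mult_right_mono[OF rC, of "norm (\<mu> - \<mu>1)"] by (simp add: mult.assoc)
      finally show ?case using up low elim(3) unfolding EU1 real_norm_def by linarith
    qed
    then show "\<exists>d>0. \<forall>y. norm (y - \<mu>1) < d \<longrightarrow> norm (E y - E \<mu>1 - 0) \<le> \<epsilon> * norm (y - \<mu>1)"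
      unfolding eventually_nhds_metric by (simp add: dist_norm)
  qed
  then show ?thesis
    unfolding log_critical_def E_def using \<mu>1 ln_emp_lik_eq(1)[OF n sol] by simp
qed

section \<open>The population profile\<close>

text \<open>Brouwer's theorem for the projection of \<open>x + G x\<close> onto the ball. By the
  variational inequality of the projection, a fixed point on the sphere would have \<open>G\<close>
  pointing outward or zero, which is excluded; at an interior fixed point a short step along a
  nonzero \<open>G\<close> would still lie in the ball and contradict that inequality.\<close>

lemma inward_field_zero:
  fixes G :: "'a::euclidean_space \<Rightarrow> 'a"
  assumes r: "r > 0" and cont: "continuous_on (cball c r) G"
    and inward: "\<And>x. x \<in> sphere c r \<Longrightarrow> (x - c) \<bullet> G x < 0"
  obtains x where "x \<in> cball c r" "G x = 0"
proof -
  let ?S = "cball c r"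
  define f where "f x = closest_point ?S (x + G x)" for x
  have c: "c \<in> ?S" using r by simp
  have S: "closed ?S" "?S \<noteq> {}" "convex ?S" using r by auto
  have "continuous_on UNIV (closest_point ?S)" using S by (intro continuous_on_closest_point) auto
  then have "continuous_on ?S f" unfolding f_def
    by (rule continuous_on_compose2[where f = "\<lambda>x. x + G x"]) (auto intro!: continuous_intros cont)
  moreover have "f \<in> ?S \<rightarrow> ?S" unfolding f_def using closest_point_in_set[OF S(1,2)] by blast
  ultimately obtain x where x: "x \<in> ?S" "f x = x" by (rule brouwer_ball[OF r])
  have "\<forall>z\<in>?S. dist (x + G x) x \<le> dist (x + G x) z"
    using closest_point_exists(2)[OF S(1,2), of "x + G x"] x(2) by (simp add: f_def)
  from any_closest_point_dot[OF S(3,1) x(1) _ this]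
  have dot: "G x \<bullet> (y - x) \<le> 0" if "y \<in> ?S" for y using that by simp
  have nin: "x \<notin> sphere c r"
  proof
    assume "x \<in> sphere c r"
    from inward[OF this] dot[OF c] show False by (simp add: inner_diff_left inner_diff_right inner_commute)
  qed
  have "G x = 0"
  proof (rule ccontr)
    assume G: "G x \<noteq> 0"
    have x': "norm (x - c) < r" using x(1) nin by (auto simp: dist_norm norm_minus_commute)
    define t where "t = (r - norm (x - c)) / norm (G x)"
    have t: "t > 0" using x' G by (simp add: t_def)
    have "norm (x + t *\<^sub>R G x - c) \<le> norm (x - c) + t * norm (G x)"
      using norm_triangle_ineq[of "x - c" "t *\<^sub>R G x"] t by (simp add: algebra_simps)
    also have "\<dots> = r" using G by (simp add: t_def)
    finally have "x + t *\<^sub>R G x \<in> ?S" by (simp add: dist_norm norm_minus_commute)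
    from dot[OF this] have "t * (G x \<bullet> G x) \<le> 0" by simp
    moreover have "t * (G x \<bullet> G x) > 0" using t G by (intro mult_pos_pos) auto
    ultimately show False by linarith
  qed
  with x(1) show ?thesis by (rule that)
qed

text \<open>The quantifiers over the parameters stand inside the predicate, so one null set of
  observations serves the whole ball. A single number \<open>q\<close> bounds both sizes and
  Lipschitz constants.\<close>

definition el_good :: "('y \<Rightarrow> real^'s \<Rightarrow> real^'r \<Rightarrow> real^'q) \<Rightarrow> ('y \<Rightarrow> real^'r \<Rightarrow> real^'r) \<Rightarrow>
    ((real^'s) \<times> (real^'q) \<times> (real^'r)) set \<Rightarrow> real \<Rightarrow> real \<Rightarrow> 'y \<Rightarrow> bool" where
  "el_good m h B L q y \<longleftrightarrow>
    (\<forall>\<mu> l P. (\<mu>, l, P) \<in> B \<longrightarrow> L \<le> 1 + l \<bullet> m y \<mu> P \<and> norm (m y \<mu> P) \<le> q \<and>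
       norm (psi_EL m y (\<mu>, l, P), h y P) \<le> q) \<and>
    (\<forall>\<mu> l P \<mu>' l' P'. (\<mu>, l, P) \<in> B \<and> (\<mu>', l', P') \<in> B \<longrightarrow>
       norm (m y \<mu> P - m y \<mu>' P') \<le> q * dist (\<mu>, l, P) (\<mu>', l', P') \<and>
       norm ((psi_EL m y (\<mu>, l, P), h y P) - (psi_EL m y (\<mu>', l', P'), h y P')) \<le> q * dist (\<mu>, l, P) (\<mu>', l', P'))"

lemma psi_EL_fst: "fst (psi_EL m y (\<mu>, l, P)) = m y \<mu> P /\<^sub>R (1 + l \<bullet> m y \<mu> P)"
  by (simp add: psi_EL_def)

lemma psi_EL_snd_inner:
  "snd (psi_EL m y (\<mu>, l, P)) \<bullet> e = (l \<bullet> (jacobian (\<lambda>\<mu>'. m y \<mu>' P) (at \<mu>) *v e)) / (1 + l \<bullet> m y \<mu> P)"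
  by (simp add: psi_EL_def dot_lmul_matrix divide_inverse mult.commute)

text \<open>Isolates what the asymptotic argument consumes: one square integrable envelope
  \<open>Q\<close>, a derivative of \<open>Gamma_EL\<close> at a single point, and uniqueness of the
  population multiplier. How these follow from bounds on partial derivatives is settled
  separately.\<close>

locale el_regular = iid_sample M F Y
  for M :: "'w measure" and F :: "'y::topological_space measure" and Y +
  fixes m :: "'y \<Rightarrow> real^'s \<Rightarrow> real^'r \<Rightarrow> real^'q" and h :: "'y \<Rightarrow> real^'r \<Rightarrow> real^'r"
    and \<Theta> :: "(real^'s) set" and \<mu>0 :: "real^'s" and l0 :: "real^'q" and P0 :: "real^'r"
    and \<rho> L :: real and Q :: "'y \<Rightarrow> real" and lam :: "real^'s \<Rightarrow> real^'r \<Rightarrow> real^'q"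
    and D :: "(real^'s) \<times> (real^'q) \<times> (real^'r) \<Rightarrow> ((real^'q) \<times> (real^'s)) \<times> (real^'r)"
  assumes Theta_open: "open \<Theta>"
    and m_meas: "\<And>\<mu> P. \<mu> \<in> \<Theta> \<Longrightarrow> (\<lambda>y. m y \<mu> P) \<in> borel_measurable borel"
    and m_deriv: "\<And>y \<mu> P. \<mu> \<in> \<Theta> \<Longrightarrow> ((\<lambda>\<mu>'. m y \<mu>' P) has_derivative
          (\<lambda>e. jacobian (\<lambda>\<mu>'. m y \<mu>' P) (at \<mu>) *v e)) (at \<mu>)"
    and rho: "\<rho> > 0" and ball_Theta: "cball (\<mu>0, l0, P0) \<rho> \<subseteq> \<Theta> \<times> UNIV \<times> UNIV"
    and psi_meas: "\<And>a. a \<in> cball (\<mu>0, l0, P0) \<rho> \<Longrightarrow> (\<lambda>y. psi_EL m y a) \<in> borel_measurable borel"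
    and h_meas: "\<And>P. (\<lambda>y. h y P) \<in> borel_measurable borel"
    and L: "L > 0"
    and Q_meas: "Q \<in> borel_measurable borel" and Q2: "integrable F (\<lambda>y. (Q y)\<^sup>2)"
    and Q_nonneg: "\<And>y. 0 \<le> Q y"
    and good: "AE y in F. el_good m h (cball (\<mu>0, l0, P0) \<rho>) L (Q y) y"
    and root: "Gamma_EL F m h (\<mu>0, l0, P0) = 0"
    and deriv: "(Gamma_EL F m h has_derivative D) (at (\<mu>0, l0, P0))" and bij: "bij D"
    and lam: "\<And>\<mu> P l. \<mu> \<in> \<Theta> \<Longrightarrow> solves_pop F (\<lambda>y. m y \<mu> P) l \<Longrightarrow> lam \<mu> P = l"
begin

section \<open>Integrability and Lipschitz continuity of the population map on the ball\<close>

abbreviation "\<alpha>0 \<equiv> (\<mu>0, l0, P0)"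
abbreviation "B \<equiv> cball \<alpha>0 \<rho>"
abbreviation "G \<equiv> Gamma_EL F m h"

definition f :: "'y \<Rightarrow> (real^'s) \<times> (real^'q) \<times> (real^'r) \<Rightarrow> ((real^'q) \<times> (real^'s)) \<times> (real^'r)" where
  "f y a = (psi_EL m y a, h y (snd (snd a)))"

definition EQ :: real where "EQ = (\<integral>y. Q y \<partial>F)"

lemma Q1: "integrable F Q"
  by (rule F.square_integrable_imp_integrable[OF _ Q2]) (simp add: measurable_F Q_meas)

lemma EQ_nonneg: "EQ \<ge> 0"
  unfolding EQ_def using Q_nonneg by simp

lemma in_Theta: "(\<mu>, l, P) \<in> B \<Longrightarrow> \<mu> \<in> \<Theta>"
  using ball_Theta by blast

lemma goodD:
  assumes "el_good m h B L (Q y) y" "(\<mu>, l, P) \<in> B"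
  shows "L \<le> 1 + l \<bullet> m y \<mu> P" "norm (m y \<mu> P) \<le> Q y" "norm (f y (\<mu>, l, P)) \<le> Q y"
    "0 < 1 + l \<bullet> m y \<mu> P"
proof -
  show "L \<le> 1 + l \<bullet> m y \<mu> P" "norm (m y \<mu> P) \<le> Q y" "norm (f y (\<mu>, l, P)) \<le> Q y"
    using assms unfolding el_good_def f_def by auto
  with L show "0 < 1 + l \<bullet> m y \<mu> P" by linarith
qed

lemma goodD2:
  assumes "el_good m h B L (Q y) y" "(\<mu>, l, P) \<in> B" "(\<mu>', l', P') \<in> B"
  shows "norm (m y \<mu> P - m y \<mu>' P') \<le> Q y * dist (\<mu>, l, P) (\<mu>', l', P')"
    "norm (f y (\<mu>, l, P) - f y (\<mu>', l', P')) \<le> Q y * dist (\<mu>, l, P) (\<mu>', l', P')"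
  using assms unfolding el_good_def f_def by auto

lemma f_lip: "el_good m h B L (Q y) y \<Longrightarrow> a \<in> B \<Longrightarrow> b \<in> B \<Longrightarrow> norm (f y a - f y b) \<le> Q y * dist a b"
  by (cases a; cases b) (simp only: goodD2)

lemma f_meas: "a \<in> B \<Longrightarrow> (\<lambda>y. f y a) \<in> borel_measurable borel"
  unfolding f_def using psi_meas h_meas by (intro borel_measurable_Pair) auto

lemma f_integrable: "a \<in> B \<Longrightarrow> integrable F (\<lambda>y. f y a)"
proof (rule Bochner_Integration.integrable_bound[OF Q1])
  assume a: "a \<in> B"
  show "AE y in F. norm (f y a) \<le> norm (Q y)"
    using good by eventually_elim (use a Q_nonneg goodD(3) in \<open>cases a; auto\<close>)
qed (auto simp: measurable_F f_meas)

lemma G_eq: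
  assumes "a \<in> B"
  shows "G a = (\<integral>y. f y a \<partial>F)"
proof -
  obtain \<mu> l P where a: "a = (\<mu>, l, P)" by (cases a) auto
  note i = f_integrable[OF assms]
  have "fst (\<integral>y. f y a \<partial>F) = (\<integral>y. psi_EL m y a \<partial>F)"
    using integral_bounded_linear[OF bounded_linear_fst i] by (simp add: f_def)
  moreover have "snd (\<integral>y. f y a \<partial>F) = (\<integral>y. h y P \<partial>F)"
    using integral_bounded_linear[OF bounded_linear_snd i] by (simp add: f_def a)
  ultimately show ?thesis by (simp add: Gamma_EL_def a prod_eq_iff)
qed

lemma G_lip:
  assumes "a \<in> B" "b \<in> B"
  shows "norm (G a - G b) \<le> EQ * dist a b"
proof -
  have "norm (\<integral>y. f y a - f y b \<partial>F) \<le> (\<integral>y. Q y * dist a b \<partial>F)"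
  proof (rule norm_integral_le_AE)
    show "AE y in F. norm (f y a - f y b) \<le> Q y * dist a b"
      using good by eventually_elim (use assms f_lip in auto)
  qed (use f_integrable assms Q1 in auto)
  then show ?thesis using f_integrable assms Q1 by (simp add: G_eq EQ_def)
qed

lemma continuous_on_G: "continuous_on B G"
proof (rule continuous_on_iff[THEN iffD2], intro ballI allI impI)
  fix x e assume x: "x \<in> B" "(e::real) > 0"
  show "\<exists>d>0. \<forall>x'\<in>B. dist x' x < d \<longrightarrow> dist (G x') (G x) < e"
  proof (intro exI conjI ballI impI)
    show "e / (EQ + 1) > 0" using x EQ_nonneg by simp
    fix x' assume x': "x' \<in> B" "dist x' x < e / (EQ + 1)"
    have "dist (G x') (G x) \<le> EQ * dist x' x" using G_lip[OF x'(1) x(1)] by (simp add: dist_norm)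
    also have "\<dots> \<le> (EQ + 1) * dist x' x" by (simp add: algebra_simps)
    also have "\<dots> < e" using x'(2) EQ_nonneg by (simp add: field_simps)
    finally show "dist (G x') (G x) < e" .
  qed
qed

section \<open>The multiplier equation \<open>G1\<close> and the score \<open>G2\<close> for
  \<mu>\<close>

definition G1 :: "(real^'s) \<times> (real^'q) \<times> (real^'r) \<Rightarrow> real^'q" where "G1 a = fst (fst (G a))"
definition G2 :: "(real^'s) \<times> (real^'q) \<times> (real^'r) \<Rightarrow> real^'s" where "G2 a = snd (fst (G a))"

lemma psi1_integrable: "(\<mu>, l, P) \<in> B \<Longrightarrow> integrable F (\<lambda>y. m y \<mu> P /\<^sub>R (1 + l \<bullet> m y \<mu> P))"
  using integrable_fst[OF integrable_fst[OF f_integrable[of "(\<mu>, l, P)"]]] by (simp add: f_def psi_EL_fst)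

lemma psi2_integrable: "a \<in> B \<Longrightarrow> integrable F (\<lambda>y. snd (psi_EL m y a))"
  using integrable_snd[OF integrable_fst[OF f_integrable]] by (simp add: f_def)

lemma G1_eq: "(\<mu>, l, P) \<in> B \<Longrightarrow> G1 (\<mu>, l, P) = (\<integral>y. m y \<mu> P /\<^sub>R (1 + l \<bullet> m y \<mu> P) \<partial>F)"
  using integral_bounded_linear[OF bounded_linear_fst integrable_fst[OF f_integrable[of "(\<mu>, l, P)"]]]
    integral_bounded_linear[OF bounded_linear_fst f_integrable[of "(\<mu>, l, P)"]]
  by (simp add: G1_def G_eq f_def psi_EL_fst)

lemma G2_eq: "a \<in> B \<Longrightarrow> G2 a = (\<integral>y. snd (psi_EL m y a) \<partial>F)"
  using integral_bounded_linear[OF bounded_linear_snd integrable_fst[OF f_integrable]]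
    integral_bounded_linear[OF bounded_linear_fst f_integrable]
  by (simp add: G2_def G_eq f_def)

lemma G1_lip: "a \<in> B \<Longrightarrow> b \<in> B \<Longrightarrow> norm (G1 a - G1 b) \<le> EQ * dist a b"
proof -
  assume ab: "a \<in> B" "b \<in> B"
  have n: "norm (fst z) \<le> norm z" for z :: "'x::real_normed_vector \<times> 'z::real_normed_vector"
    using norm_fst_le[of "fst z" "snd z"] by simp
  have "norm (G1 a - G1 b) = norm (fst (fst (G a - G b)))" by (simp add: G1_def)
  also have "\<dots> \<le> norm (G a - G b)" by (rule order_trans[OF n n])
  also have "\<dots> \<le> EQ * dist a b" by (rule G_lip[OF ab])
  finally show ?thesis .
qed

lemma continuous_on_G1: "continuous_on B G1"
  unfolding G1_def by (intro continuous_on_fst continuous_on_G)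

lemma solves_pop_iff:
  assumes a: "(\<mu>, l, P) \<in> B"
  shows "solves_pop F (\<lambda>y. m y \<mu> P) l \<longleftrightarrow> G1 (\<mu>, l, P) = 0"
proof -
  have "AE y in F. \<not> 1 + l \<bullet> m y \<mu> P \<le> 0"
    using good by eventually_elim (use a goodD(4) in fastforce)
  then show ?thesis unfolding solves_pop_def using psi1_integrable[OF a] G1_eq[OF a] by simp
qed

text \<open>If \<open>d\<close> were nonzero, \<open>l + d\<close> would solve the same multiplier
  equation, since the inner product with \<open>m\<close> is almost surely unchanged;
  \<open>lam\<close> cannot equal both.\<close>

lemma nondegenerate:
  assumes mu: "\<mu> \<in> \<Theta>" and sol: "solves_pop F (\<lambda>y. m y \<mu> P) l" and z: "AE y in F. d \<bullet> m y \<mu> P = 0"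
  shows "d = 0"
proof -
  have [measurable]: "(\<lambda>y. m y \<mu> P) \<in> borel_measurable F" using m_meas[OF mu] by (simp add: measurable_F)
  have eq: "AE y in F. m y \<mu> P /\<^sub>R (1 + (l + d) \<bullet> m y \<mu> P) = m y \<mu> P /\<^sub>R (1 + l \<bullet> m y \<mu> P)"
    using z by eventually_elim (simp add: inner_add_left)
  have "solves_pop F (\<lambda>y. m y \<mu> P) (l + d)"
    unfolding solves_pop_def
  proof (intro conjI)
    show "AE y in F. \<not> 1 + (l + d) \<bullet> m y \<mu> P \<le> 0"
      using sol[unfolded solves_pop_def, THEN conjunct1] z by eventually_elim (simp add: inner_add_left)
    have "integrable F (\<lambda>y. m y \<mu> P /\<^sub>R (1 + (l + d) \<bullet> m y \<mu> P)) =
      integrable F (\<lambda>y. m y \<mu> P /\<^sub>R (1 + l \<bullet> m y \<mu> P))"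
      by (rule integrable_cong_AE[OF _ _ eq]) measurable
    then show "integrable F (\<lambda>y. m y \<mu> P /\<^sub>R (1 + (l + d) \<bullet> m y \<mu> P))"
      using sol by (simp add: solves_pop_def)
    have "(\<integral>y. m y \<mu> P /\<^sub>R (1 + (l + d) \<bullet> m y \<mu> P) \<partial>F) = (\<integral>y. m y \<mu> P /\<^sub>R (1 + l \<bullet> m y \<mu> P) \<partial>F)"
      by (rule integral_cong_AE[OF _ _ eq]) measurable
    then show "(\<integral>y. m y \<mu> P /\<^sub>R (1 + (l + d) \<bullet> m y \<mu> P) \<partial>F) = 0"
      using sol by (simp add: solves_pop_def)
  qed
  then have "lam \<mu> P = l + d" by (rule lam[OF mu])
  moreover have "lam \<mu> P = l" by (rule lam[OF mu sol])
  ultimately show ?thesis by simp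
qed

text \<open>As a function of \<open>l\<close>, \<open>G1\<close> is formally the gradient of the
  concave expected logarithm. The integrand is a square divided by two positive factors, and its
  vanishing almost surely would contradict nondegeneracy.\<close>

lemma G1_monotone:
  assumes a: "(\<mu>, l, P) \<in> B" and a1: "(\<mu>, l1, P) \<in> B" and z: "G1 (\<mu>, l1, P) = 0" and ne: "l \<noteq> l1"
  shows "(l - l1) \<bullet> G1 (\<mu>, l, P) < 0"
proof -
  define x where "x y = m y \<mu> P /\<^sub>R (1 + l1 \<bullet> m y \<mu> P) - m y \<mu> P /\<^sub>R (1 + l \<bullet> m y \<mu> P)" for y
  have xi: "integrable F x" unfolding x_def using psi1_integrable a a1 by simp
  have G: "G1 (\<mu>, l, P) = - (\<integral>y. x y \<partial>F)"
    unfolding x_def using psi1_integrable a a1 z G1_eq by simp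
  have eq: "(l - l1) \<bullet> x y = ((l - l1) \<bullet> m y \<mu> P)\<^sup>2 / ((1 + l1 \<bullet> m y \<mu> P) * (1 + l \<bullet> m y \<mu> P))"
    if "1 + l1 \<bullet> m y \<mu> P > 0" "1 + l \<bullet> m y \<mu> P > 0" for y
    using that by (simp add: x_def inner_diff_right inner_diff_left divide_simps power2_eq_square) (simp add: algebra_simps)
  have nn: "AE y in F. 0 \<le> (l - l1) \<bullet> x y"
    using good
  proof eventually_elim
    case (elim y)
    note p = goodD(4)[OF elim a1] goodD(4)[OF elim a]
    show ?case unfolding eq[OF p] using p by simp
  qed
  have "(\<integral>y. (l - l1) \<bullet> x y \<partial>F) \<noteq> 0"
  proof
    assume "(\<integral>y. (l - l1) \<bullet> x y \<partial>F) = 0"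
    then have "AE y in F. (l - l1) \<bullet> x y = 0"
      using integral_nonneg_eq_0_iff_AE[OF _ nn] xi by simp
    then have "AE y in F. (l - l1) \<bullet> m y \<mu> P = 0"
      using good
    proof eventually_elim
      case (elim y)
      note p = goodD(4)[OF elim(2) a1] goodD(4)[OF elim(2) a]
      show ?case using elim(1) p unfolding eq[OF p] by simp
    qed
    then have "l - l1 = 0"
      using nondegenerate[OF in_Theta[OF a]] solves_pop_iff[OF a1] z by blast
    with ne show False by simp
  qed
  moreover have "(\<integral>y. (l - l1) \<bullet> x y \<partial>F) \<ge> 0" using nn by (rule integral_nonneg_AE)
  moreover have "(\<integral>y. (l - l1) \<bullet> x y \<partial>F) = (l - l1) \<bullet> (\<integral>y. x y \<partial>F)"
    using xi by simp
  ultimately show ?thesis unfolding G by simp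
qed

text \<open>Strict monotonicity makes \<open>G1\<close> point inward on a small sphere of
  multipliers around \<open>l1\<close>. This persists for nearby parameters by compactness, so a
  zero remains inside, and uniqueness identifies it with \<open>lam\<close>. No derivative of
  \<open>G1\<close> in the multiplier is involved.\<close>

lemma lam_continuous:
  assumes a1: "(\<mu>1, l1, P1) \<in> ball \<alpha>0 \<rho>" and z: "G1 (\<mu>1, l1, P1) = 0" and r: "r > 0"
  shows "\<forall>\<^sub>F p in nhds (\<mu>1, P1). norm (lam (fst p) (snd p) - l1) \<le> r \<and>
    (fst p, lam (fst p) (snd p), snd p) \<in> ball \<alpha>0 \<rho> \<and> (fst p, l1, snd p) \<in> ball \<alpha>0 \<rho> \<and>
    G1 (fst p, lam (fst p) (snd p), snd p) = 0"
proof -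
  have "open ((\<lambda>l. (\<mu>1, l, P1)) -` ball \<alpha>0 \<rho>)"
    by (intro open_vimage open_ball continuous_intros)
  then obtain r1 where r1: "r1 > 0" "cball l1 r1 \<subseteq> (\<lambda>l. (\<mu>1, l, P1)) -` ball \<alpha>0 \<rho>"
    using a1 open_contains_cball by (metis vimageI)
  define r2 where "r2 = min r r1"
  have r2: "r2 > 0" "r2 \<le> r" "r2 \<le> r1" using r r1(1) by (auto simp: r2_def)
  have inB: "(\<mu>1, l, P1) \<in> ball \<alpha>0 \<rho>" if "l \<in> cball l1 r2" for l
    using r1(2) r2(3) that by (auto simp: subset_eq)
  \<comment> \<open>Reorders the coordinates so that the multiplier, the variable ranging over a
    compact set, comes first.\<close>
  define T where "T q = (fst (snd q), fst q, snd (snd q))" for q :: "(real^'q) \<times> (real^'s) \<times> (real^'r)"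
  have T: "(T \<longlongrightarrow> (\<mu>1, l, P1)) (nhds l \<times>\<^sub>F nhds (\<mu>1, P1))" for l
  proof -
    have "(T \<longlongrightarrow> T (l, \<mu>1, P1)) (nhds (l, \<mu>1, P1))" unfolding T_def by (intro tendsto_intros filterlim_ident)
    moreover have "T (l, \<mu>1, P1) = (\<mu>1, l, P1)" by (simp add: T_def)
    ultimately show ?thesis unfolding nhds_prod[of l "(\<mu>1, P1)"] by simp
  qed
  have inTB: "\<forall>\<^sub>F q in nhds l \<times>\<^sub>F nhds (\<mu>1, P1). T q \<in> ball \<alpha>0 \<rho>" if "l \<in> cball l1 r2" for l
    by (rule topological_tendstoD[OF T open_ball inB[OF that]])
  have "\<forall>\<^sub>F q in nhds l \<times>\<^sub>F nhds (\<mu>1, P1). T (fst q, snd q) \<in> ball \<alpha>0 \<rho>" if "l \<in> cball l1 r2" for l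
    using inTB[OF that] by simp
  from eventually_compact_uniform[OF compact_cball this]
  have ev1: "\<forall>\<^sub>F p in nhds (\<mu>1, P1). \<forall>l\<in>cball l1 r2. T (l, p) \<in> ball \<alpha>0 \<rho>" by blast
  have contG: "continuous_on (ball \<alpha>0 \<rho>) G1"
    by (rule continuous_on_subset[OF continuous_on_G1 ball_subset_cball])
  have "\<forall>\<^sub>F q in nhds l \<times>\<^sub>F nhds (\<mu>1, P1). (fst q - l1) \<bullet> G1 (T (fst q, snd q)) < 0" if l: "l \<in> sphere l1 r2" for l
  proof -
    have lc: "l \<in> cball l1 r2" using l by simp
    have "isCont G1 (\<mu>1, l, P1)" using continuous_on_interior[OF contG, of "(\<mu>1, l, P1)"] inB[OF lc] by simp
    then have "((\<lambda>q. G1 (T q)) \<longlongrightarrow> G1 (\<mu>1, l, P1)) (nhds l \<times>\<^sub>F nhds (\<mu>1, P1))"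
      by (rule isCont_tendsto_compose[OF _ T])
    then have "((\<lambda>q. (fst q - l1) \<bullet> G1 (T q)) \<longlongrightarrow> (l - l1) \<bullet> G1 (\<mu>1, l, P1)) (nhds l \<times>\<^sub>F nhds (\<mu>1, P1))"
      by (intro tendsto_intros filterlim_fst)
    moreover have "(l - l1) \<bullet> G1 (\<mu>1, l, P1) < 0"
      using inB[OF lc] a1 z l r2(1) by (intro G1_monotone) auto
    ultimately show ?thesis using order_tendstoD(2) by force
  qed
  from eventually_compact_uniform[OF compact_sphere this]
  have ev2: "\<forall>\<^sub>F p in nhds (\<mu>1, P1). \<forall>l\<in>sphere l1 r2. (l - l1) \<bullet> G1 (T (l, p)) < 0" by blast
  from ev1 ev2 show ?thesis
  proof eventually_elim
    case (elim p)
    have "continuous_on (cball l1 r2) (\<lambda>l. G1 (T (l, p)))"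
      by (rule continuous_on_compose2[OF contG]) (use elim(1) in \<open>auto simp: T_def intro!: continuous_intros\<close>)
    then obtain l where l: "l \<in> cball l1 r2" "G1 (T (l, p)) = 0"
      using inward_field_zero[OF r2(1), of l1 "\<lambda>l. G1 (T (l, p))"] elim(2) by blast
    have b: "(fst p, l, snd p) \<in> ball \<alpha>0 \<rho>" using elim(1) l(1) by (auto simp: T_def)
    then have b': "(fst p, l, snd p) \<in> B" by simp
    have "solves_pop F (\<lambda>y. m y (fst p) (snd p)) l"
      unfolding solves_pop_iff[OF b'] using l(2) by (simp add: T_def)
    then have "lam (fst p) (snd p) = l" using lam in_Theta[OF b'] by blast
    moreover have "(fst p, l1, snd p) \<in> ball \<alpha>0 \<rho>" using elim(1) r2(1) by (auto simp: T_def)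
    ultimately show ?case using l b r2(2) by (auto simp: T_def dist_norm norm_minus_commute)
  qed
qed

section \<open>The expected logarithm and its derivative in \<mu>\<close>

lemma ln_integrable:
  assumes a: "(\<mu>, l, P) \<in> B"
  shows "integrable F (\<lambda>y. ln (1 + l \<bullet> m y \<mu> P))"
proof (rule Bochner_Integration.integrable_bound)
  show "integrable F (\<lambda>y. (1 + \<bar>ln L\<bar>) + norm l * Q y)" using Q1 by simp
  have [measurable]: "(\<lambda>y. m y \<mu> P) \<in> borel_measurable F"
    using m_meas[OF in_Theta[OF a]] by (simp add: measurable_F)
  show "(\<lambda>y. ln (1 + l \<bullet> m y \<mu> P)) \<in> borel_measurable F" by measurable
  show "AE y in F. norm (ln (1 + l \<bullet> m y \<mu> P)) \<le> norm ((1 + \<bar>ln L\<bar>) + norm l * Q y)"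
    using good
  proof eventually_elim
    case (elim y)
    let ?s = "1 + l \<bullet> m y \<mu> P"
    have "ln L \<le> ln ?s" using goodD(1)[OF elim a] L by simp
    moreover have "ln ?s \<le> ?s - 1" using goodD(4)[OF elim a] by (rule ln_le_minus_one)
    moreover have "l \<bullet> m y \<mu> P \<le> norm l * norm (m y \<mu> P)" by (rule norm_cauchy_schwarz)
    moreover have "norm l * norm (m y \<mu> P) \<le> norm l * Q y"
      using goodD(2)[OF elim a] by (rule mult_left_mono) simp
    moreover have "norm l * Q y \<ge> 0" using Q_nonneg by simp
    ultimately show ?case by simp
  qed
qed

lemma ln_lip:
  assumes g: "el_good m h B L (Q y) y" and a: "(\<mu>, l, P) \<in> B" and a': "(\<mu>', l, P) \<in> B"
  shows "\<bar>ln (1 + l \<bullet> m y \<mu> P) - ln (1 + l \<bullet> m y \<mu>' P)\<bar> \<le> norm l / L * Q y * norm (\<mu> - \<mu>')"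
proof -
  have "\<bar>ln (1 + l \<bullet> m y \<mu> P) - ln (1 + l \<bullet> m y \<mu>' P)\<bar> \<le>
      \<bar>(1 + l \<bullet> m y \<mu> P) - (1 + l \<bullet> m y \<mu>' P)\<bar> / L"
    using goodD(1)[OF g a] goodD(1)[OF g a'] L by (intro ln_lipschitz)
  also have "\<bar>(1 + l \<bullet> m y \<mu> P) - (1 + l \<bullet> m y \<mu>' P)\<bar> = \<bar>l \<bullet> (m y \<mu> P - m y \<mu>' P)\<bar>"
    by (simp add: inner_diff_right)
  also have "\<dots> \<le> norm l * norm (m y \<mu> P - m y \<mu>' P)" by (rule Cauchy_Schwarz_ineq2)
  also have "norm (m y \<mu> P - m y \<mu>' P) \<le> Q y * norm (\<mu> - \<mu>')"
    using goodD2(1)[OF g a a'] by (simp add: dist_Pair_Pair dist_norm)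
  finally show ?thesis using L by (simp add: divide_right_mono mult_left_mono mult.assoc)
qed

lemma profile_dom_in:
  assumes a: "(\<mu>, lam \<mu> P, P) \<in> B" and z: "G1 (\<mu>, lam \<mu> P, P) = 0"
  shows "\<mu> \<in> profile_dom F m \<Theta> lam P"
  unfolding profile_dom_def using in_Theta[OF a] solves_pop_iff[OF a] z ln_integrable[OF a] by simp

text \<open>The tangent inequality for \<open>ln\<close> at \<open>l1\<close>, integrated: a change
  of multiplier costs at most its inner product with the residual \<open>G1\<close> of the old
  one.\<close>

lemma profile_lower:
  assumes a: "(\<mu>, l, P) \<in> B" and a1: "(\<mu>, l1, P) \<in> B"
  shows "- (\<integral>y. ln (1 + l \<bullet> m y \<mu> P) \<partial>F) \<ge>
    - (\<integral>y. ln (1 + l1 \<bullet> m y \<mu> P) \<partial>F) - (l - l1) \<bullet> G1 (\<mu>, l1, P)"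
proof -
  have "(\<integral>y. ln (1 + l \<bullet> m y \<mu> P) \<partial>F) \<le>
    (\<integral>y. ln (1 + l1 \<bullet> m y \<mu> P) + (l - l1) \<bullet> (m y \<mu> P /\<^sub>R (1 + l1 \<bullet> m y \<mu> P)) \<partial>F)"
  proof (rule integral_mono_AE)
    show "AE y in F. ln (1 + l \<bullet> m y \<mu> P) \<le>
        ln (1 + l1 \<bullet> m y \<mu> P) + (l - l1) \<bullet> (m y \<mu> P /\<^sub>R (1 + l1 \<bullet> m y \<mu> P))"
      using good
    proof eventually_elim
      case (elim y)
      show ?case using ln_le_tangent[OF goodD(4)[OF elim a1] goodD(4)[OF elim a]]
        by (simp add: inner_diff_left divide_inverse mult.commute)
    qed
    show "integrable F (\<lambda>y. ln (1 + l1 \<bullet> m y \<mu> P) + (l - l1) \<bullet> (m y \<mu> P /\<^sub>R (1 + l1 \<bullet> m y \<mu> P)))"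
      by (intro Bochner_Integration.integrable_add integrable_inner_right ln_integrable psi1_integrable a1)
  qed (rule ln_integrable[OF a])
  also have "\<dots> = (\<integral>y. ln (1 + l1 \<bullet> m y \<mu> P) \<partial>F) + (\<integral>y. (l - l1) \<bullet> (m y \<mu> P /\<^sub>R (1 + l1 \<bullet> m y \<mu> P)) \<partial>F)"
    by (intro Bochner_Integration.integral_add integrable_inner_right ln_integrable psi1_integrable a1)
  also have "(\<integral>y. (l - l1) \<bullet> (m y \<mu> P /\<^sub>R (1 + l1 \<bullet> m y \<mu> P)) \<partial>F) = (l - l1) \<bullet> G1 (\<mu>, l1, P)"
    unfolding G1_eq[OF a1] by (intro integral_inner_right psi1_integrable a1)
  finally show ?thesis by simp
qed

text \<open>Dominated convergence, with the Lipschitz bound for the logarithm as majorant of all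
  difference quotients. Positive steps along one sequence are enough for a one-sided optimality
  condition.\<close>

lemma ln_directional_derivative:
  assumes a: "(\<mu>, l, P) \<in> ball \<alpha>0 \<rho>" and t: "t \<longlonglongrightarrow> 0" and t0: "\<And>k. t k > 0"
    and tB: "\<And>k. (\<mu> + t k *\<^sub>R e, l, P) \<in> B"
  shows "(\<lambda>k. ((\<integral>y. ln (1 + l \<bullet> m y (\<mu> + t k *\<^sub>R e) P) \<partial>F) - (\<integral>y. ln (1 + l \<bullet> m y \<mu> P) \<partial>F)) / t k)
    \<longlonglongrightarrow> G2 (\<mu>, l, P) \<bullet> e"
proof -
  have aB: "(\<mu>, l, P) \<in> B" using a by simp
  let ?d = "\<lambda>k y. (ln (1 + l \<bullet> m y (\<mu> + t k *\<^sub>R e) P) - ln (1 + l \<bullet> m y \<mu> P)) / t k"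
  have "(\<lambda>k. \<integral>y. ?d k y \<partial>F) \<longlonglongrightarrow> (\<integral>y. snd (psi_EL m y (\<mu>, l, P)) \<bullet> e \<partial>F)"
  proof (rule integral_dominated_convergence[where w = "\<lambda>y. norm l / L * Q y * norm e"])
    show "(\<lambda>y. snd (psi_EL m y (\<mu>, l, P)) \<bullet> e) \<in> borel_measurable F"
      using psi2_integrable[OF aB] by simp
    show "?d k \<in> borel_measurable F" for k
      using borel_measurable_integrable[OF ln_integrable[OF tB[of k]]]
        borel_measurable_integrable[OF ln_integrable[OF aB]] by simp
    show "integrable F (\<lambda>y. norm l / L * Q y * norm e)" using Q1 by simp
    show "AE y in F. norm (?d k y) \<le> norm l / L * Q y * norm e" for k
      using good
    proof eventually_elim
      case (elim y)
      have "\<bar>ln (1 + l \<bullet> m y (\<mu> + t k *\<^sub>R e) P) - ln (1 + l \<bullet> m y \<mu> P)\<bar> \<le> norm l / L * Q y * (t k * norm e)"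
        using ln_lip[OF elim tB[of k] aB] t0[of k] by simp
      then show ?case using t0[of k] by (simp add: field_simps)
    qed
    show "AE y in F. (\<lambda>k. ?d k y) \<longlonglongrightarrow> snd (psi_EL m y (\<mu>, l, P)) \<bullet> e"
      using good
    proof eventually_elim
      case (elim y)
      define J where "J = jacobian (\<lambda>\<mu>'. m y \<mu>' P) (at \<mu>)"
      have "((\<lambda>\<mu>'. m y \<mu>' P) has_derivative (\<lambda>e. J *v e)) (at (\<mu> + 0 *\<^sub>R e))"
        using m_deriv[OF in_Theta[OF aB]] by (simp add: J_def)
      moreover have "((\<lambda>s. \<mu> + s *\<^sub>R e) has_derivative (\<lambda>s. s *\<^sub>R e)) (at (0::real))"
        by (auto intro!: derivative_eq_intros)
      ultimately have "((\<lambda>s. m y (\<mu> + s *\<^sub>R e) P) has_derivative (\<lambda>s. J *v (s *\<^sub>R e))) (at 0)"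
        by (rule has_derivative_compose[rotated])
      then have "((\<lambda>s. ln (1 + l \<bullet> m y (\<mu> + s *\<^sub>R e) P)) has_derivative
          (\<lambda>s. (l \<bullet> (J *v (s *\<^sub>R e))) * inverse (1 + l \<bullet> m y \<mu> P))) (at 0)"
        using goodD(4)[OF elim aB] by (auto intro!: derivative_eq_intros simp: mult.commute)
      moreover have "(\<lambda>s. (l \<bullet> (J *v (s *\<^sub>R e))) * inverse (1 + l \<bullet> m y \<mu> P)) =
          (*) (snd (psi_EL m y (\<mu>, l, P)) \<bullet> e)"
        by (simp add: psi_EL_snd_inner J_def matrix_vector_mult_scaleR divide_inverse fun_eq_iff)
      ultimately have "((\<lambda>s. ln (1 + l \<bullet> m y (\<mu> + s *\<^sub>R e) P)) has_field_derivative
          snd (psi_EL m y (\<mu>, l, P)) \<bullet> e) (at 0)"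
        by (simp add: has_field_derivative_def)
      then have "(\<lambda>s. (ln (1 + l \<bullet> m y (\<mu> + s *\<^sub>R e) P) - ln (1 + l \<bullet> m y \<mu> P)) / s)
          \<midarrow>0\<rightarrow> snd (psi_EL m y (\<mu>, l, P)) \<bullet> e"
        by (simp add: DERIV_def)
      moreover have "filterlim t (at 0) sequentially"
        using t t0 by (auto simp: filterlim_at intro!: always_eventually less_imp_neq[symmetric])
      ultimately show "(\<lambda>k. ?d k y) \<longlonglongrightarrow> snd (psi_EL m y (\<mu>, l, P)) \<bullet> e"
        by (rule filterlim_compose)
    qed
  qed
  moreover have "(\<integral>y. snd (psi_EL m y (\<mu>, l, P)) \<bullet> e \<partial>F) = G2 (\<mu>, l, P) \<bullet> e"
    using psi2_integrable[OF aB] by (simp add: G2_eq[OF aB])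
  moreover have "(\<integral>y. ?d k y \<partial>F) =
      ((\<integral>y. ln (1 + l \<bullet> m y (\<mu> + t k *\<^sub>R e) P) \<partial>F) - (\<integral>y. ln (1 + l \<bullet> m y \<mu> P) \<partial>F)) / t k" for k
    using ln_integrable[OF tB[of k]] ln_integrable[OF aB] by simp
  ultimately show ?thesis by (simp only:)
qed

text \<open>Envelope theorem: by concavity in the multiplier, freezing it at \<open>lam \<mu>1 P\<close> changes the profile
  by \<open>o(norm (\<mu> - \<mu>1))\<close> only.\<close>

lemma profile_maximiser_critical:
  assumes a: "(\<mu>1, lam \<mu>1 P, P) \<in> ball \<alpha>0 \<rho>" and z: "G1 (\<mu>1, lam \<mu>1 P, P) = 0"
    and max: "\<And>\<mu>. \<mu> \<in> profile_dom F m \<Theta> lam P \<Longrightarrow> profile F m lam P \<mu> \<le> profile F m lam P \<mu>1"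
  shows "G2 (\<mu>1, lam \<mu>1 P, P) = 0"
proof -
  define l1 where "l1 = lam \<mu>1 P"
  \<comment> \<open>For the direction opposite to \<open>G2\<close>, nonnegativity of the
    directional derivative already says that the squared norm of \<open>G2\<close> is at most
    zero.\<close>
  define e where "e = - G2 (\<mu>1, l1, P)"
  have bound: "G2 (\<mu>1, l1, P) \<bullet> e \<ge> - (r * EQ * norm e)" if r: "r > 0" for r
  proof -
    have a1: "(\<mu>1, l1, P) \<in> ball \<alpha>0 \<rho>" and z1: "G1 (\<mu>1, l1, P) = 0" using a z by (auto simp: l1_def)
    define t where "t k = 1 / real (Suc k)" for k
    have t: "t \<longlonglongrightarrow> 0" unfolding t_def by (rule LIMSEQ_Suc[OF lim_inverse_n', unfolded inverse_eq_divide])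
    have t0: "t k > 0" for k by (simp add: t_def)
    have "(\<lambda>k. (\<mu>1 + t k *\<^sub>R e, P)) \<longlonglongrightarrow> (\<mu>1 + 0 *\<^sub>R e, P)" by (intro tendsto_intros t)
    then have lim: "filterlim (\<lambda>k. (\<mu>1 + t k *\<^sub>R e, P)) (nhds (\<mu>1, P)) sequentially" by simp
    define good_k where "good_k k \<longleftrightarrow> (let \<mu> = \<mu>1 + t k *\<^sub>R e; l = lam \<mu> P in
       norm (l - l1) \<le> r \<and> (\<mu>, l, P) \<in> ball \<alpha>0 \<rho> \<and> (\<mu>, l1, P) \<in> ball \<alpha>0 \<rho> \<and> G1 (\<mu>, l, P) = 0)" for k
    have "eventually good_k sequentially"
      using eventually_compose_filterlim[OF lam_continuous[OF a1 z1 r] lim]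
      unfolding good_k_def Let_def by simp
    then obtain K where K: "\<And>k. k \<ge> K \<Longrightarrow> good_k k" by (auto simp: eventually_sequentially)
    define s where "s k = t (k + K)" for k
    have s: "s \<longlonglongrightarrow> 0" unfolding s_def by (rule LIMSEQ_ignore_initial_segment[OF t])
    have s0: "s k > 0" for k by (simp add: s_def t0)
    have sB: "(\<mu>1 + s k *\<^sub>R e, l1, P) \<in> B" for k
      using K[of "k + K"] by (auto simp: good_k_def Let_def s_def)
    have "((\<integral>y. ln (1 + l1 \<bullet> m y (\<mu>1 + s k *\<^sub>R e) P) \<partial>F) - (\<integral>y. ln (1 + l1 \<bullet> m y \<mu>1 P) \<partial>F)) / s k
       \<ge> - (r * EQ * norm e)" for k
    proof -
      define \<mu> where "\<mu> = \<mu>1 + s k *\<^sub>R e"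
      define l where "l = lam \<mu> P"
      have g: "norm (l - l1) \<le> r" "(\<mu>, l, P) \<in> B" "G1 (\<mu>, l, P) = 0"
        using K[of "k + K"] by (auto simp: good_k_def Let_def s_def l_def \<mu>_def)
      have b: "(\<mu>, l1, P) \<in> B" using sB[of k] by (simp add: \<mu>_def)
      have "\<mu> \<in> profile_dom F m \<Theta> lam P" using g by (intro profile_dom_in) (auto simp: l_def)
      from max[OF this]
      have "- (\<integral>y. ln (1 + l \<bullet> m y \<mu> P) \<partial>F) \<le> - (\<integral>y. ln (1 + l1 \<bullet> m y \<mu>1 P) \<partial>F)"
        by (simp add: profile_def l_def l1_def)
      moreover have "- (\<integral>y. ln (1 + l \<bullet> m y \<mu> P) \<partial>F) \<ge>
          - (\<integral>y. ln (1 + l1 \<bullet> m y \<mu> P) \<partial>F) - (l - l1) \<bullet> G1 (\<mu>, l1, P)"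
        by (rule profile_lower[OF g(2) b])
      \<comment> \<open>Both factors are small: the first is at most \<open>r\<close>, and the
        second is of order \<open>s k\<close> because \<open>G1\<close> vanishes at
        \<open>\<mu>1\<close> and is Lipschitz. After division by \<open>s k\<close> the factor
        \<open>r\<close> remains.\<close>
      moreover have "(l - l1) \<bullet> G1 (\<mu>, l1, P) \<le> r * (EQ * (s k * norm e))"
      proof -
        have "norm (G1 (\<mu>, l1, P) - G1 (\<mu>1, l1, P)) \<le> EQ * dist (\<mu>, l1, P) (\<mu>1, l1, P)"
          using a1 by (intro G1_lip b) simp
        then have "norm (G1 (\<mu>, l1, P)) \<le> EQ * (s k * norm e)"
          using s0[of k] by (simp add: z1 dist_Pair_Pair dist_norm \<mu>_def)
        then have "norm (l - l1) * norm (G1 (\<mu>, l1, P)) \<le> r * (EQ * (s k * norm e))"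
          using g(1) r by (intro mult_mono) auto
        then show ?thesis using norm_cauchy_schwarz[of "l - l1" "G1 (\<mu>, l1, P)"] by linarith
      qed
      ultimately have "(\<integral>y. ln (1 + l1 \<bullet> m y \<mu> P) \<partial>F) - (\<integral>y. ln (1 + l1 \<bullet> m y \<mu>1 P) \<partial>F) \<ge>
         - (r * EQ * norm e) * s k"
        by (simp add: algebra_simps)
      then show ?thesis using s0[of k] by (simp add: \<mu>_def field_simps)
    qed
    then show ?thesis
      by (intro tendsto_lowerbound[OF ln_directional_derivative[OF a1 s s0 sB]]) auto
  qed
  have "G2 (\<mu>1, l1, P) \<bullet> e \<ge> 0"
  proof (rule field_le_epsilon)
    fix d :: real assume d: "d > 0"
    define r where "r = d / (EQ * norm e + 1)"
    have c: "EQ * norm e + 1 > 0" using mult_nonneg_nonneg[OF EQ_nonneg norm_ge_zero[of e]] by simp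
    then have r: "r > 0" using d by (simp add: r_def)
    have "r * (EQ * norm e) \<le> r * (EQ * norm e + 1)" using r by (intro mult_left_mono) auto
    also have "\<dots> = d" using c by (simp add: r_def)
    finally show "0 \<le> G2 (\<mu>1, l1, P) \<bullet> e + d" using bound[OF r] by (simp add: mult.assoc)
  qed
  then have "G2 (\<mu>1, l1, P) \<bullet> G2 (\<mu>1, l1, P) = 0"
    unfolding e_def using inner_ge_zero[of "G2 (\<mu>1, l1, P)"] by simp
  then show ?thesis by (simp add: l1_def)
qed

end

section \<open>Linearisation at the root\<close>

lemma norm_fst_le': "norm (fst z) \<le> norm z" for z :: "'x::real_normed_vector \<times> 'z::real_normed_vector"
  using norm_fst_le[of "fst z" "snd z"] by simp

lemma norm_snd_le': "norm (snd z) \<le> norm z" for z :: "'x::real_normed_vector \<times> 'z::real_normed_vector"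
  using norm_snd_le[of "snd z" "fst z"] by simp

context el_regular
begin

section \<open>Block structure of the derivative at the root\<close>

lemma linear_D: "linear D"
  by (rule bounded_linear.linear[OF has_derivative_bounded_linear[OF deriv]])

lemma inj_D: "inj D" and surj_D: "surj D"
  using bij by (simp_all add: bij_def)

text \<open>A bound for the operator norm of the inverse of \<open>D\<close>.\<close>

definition b :: real where "b = (SOME b. b > 0 \<and> (\<forall>x. norm x \<le> b * norm (D x)))"

lemma b_pos: "b > 0" and b: "norm x \<le> b * norm (D x)"
proof -
  obtain c where c: "c > 0" "\<And>x. c * norm x \<le> norm (D x)"
    using linear_inj_bounded_below_pos[OF linear_D inj_D] by blast
  have "\<exists>b>0. \<forall>x. norm x \<le> b * norm (D x)"
    using c by (intro exI[of _ "1/c"]) (auto simp: field_simps)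
  from someI_ex[OF this] show "b > 0" "norm x \<le> b * norm (D x)" unfolding b_def by blast+
qed

lemma b_le: "norm (D x) \<le> c \<Longrightarrow> norm x \<le> b * c"
  by (rule order_trans[OF b mult_left_mono]) (use b_pos in auto)

lemma G_alt: "\<epsilon> > 0 \<Longrightarrow> \<exists>d>0. \<forall>a. norm (a - \<alpha>0) < d \<longrightarrow> norm (G a - D (a - \<alpha>0)) \<le> \<epsilon> * norm (a - \<alpha>0)"
  using deriv unfolding has_derivative_at_alt root by auto

lemma snd_G: "snd (G (\<mu>, l, P)) = (\<integral>y. h y P \<partial>F)"
  by (simp add: Gamma_EL_def)

text \<open>The second component of \<open>G\<close> is constant along lines on which
  \<open>P\<close> is fixed, so its derivative sees the \<open>P\<close>-direction only:
  \<open>D\<close> is block triangular.\<close>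

lemma snd_D: "snd (D a) = snd (D (0, 0, snd (snd a)))"
proof -
  obtain \<mu> l P where a: "a = (\<mu>, l, P)" by (cases a) auto
  let ?v = "(\<mu>, l, 0)"
  have "((\<lambda>t::real. \<alpha>0 + t *\<^sub>R ?v) has_derivative (\<lambda>t. t *\<^sub>R ?v)) (at 0)"
    by (auto intro!: derivative_eq_intros)
  moreover have "(G has_derivative D) (at (\<alpha>0 + 0 *\<^sub>R ?v))" using deriv by (simp add: zero_prod_def[symmetric])
  ultimately have "((\<lambda>t. G (\<alpha>0 + t *\<^sub>R ?v)) has_derivative (\<lambda>t. D (t *\<^sub>R ?v))) (at 0)"
    by (rule has_derivative_compose)
  then have "((\<lambda>t. snd (G (\<alpha>0 + t *\<^sub>R ?v))) has_derivative (\<lambda>t. snd (D (t *\<^sub>R ?v)))) (at 0)"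
    by (rule has_derivative_snd)
  moreover have "(\<lambda>t::real. snd (G (\<alpha>0 + t *\<^sub>R ?v))) = (\<lambda>t. \<integral>y. h y P0 \<partial>F)"
    by (simp add: snd_G fun_eq_iff)
  ultimately have "(\<lambda>t. snd (D (t *\<^sub>R ?v))) = (\<lambda>t. 0)"
    using has_derivative_unique[OF _ has_derivative_const] by fastforce
  from fun_cong[OF this, of 1] have "snd (D ?v) = 0" by simp
  moreover have "D a = D ?v + D (0, 0, P)" by (simp add: a linear_add[OF linear_D, symmetric])
  ultimately show ?thesis by (simp add: a)
qed

text \<open>Surjectivity of a block triangular map passes to its last diagonal block, and a
  surjective endomorphism of a finite-dimensional space is injective.\<close>

lemma D_block_injective:
  assumes "snd (D (0, 0, x)) = 0"
  shows "x = 0"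
proof -
  define C where "C x = snd (D (0, 0, x))" for x
  have "linear (\<lambda>x. D (0, 0, x))"
    by (rule linear_compose[OF _ linear_D, unfolded o_def]) (auto intro!: linearI)
  then have C: "linear C" unfolding C_def by (rule linear_compose[OF _ linear_snd, unfolded o_def])
  have "surj C"
  proof (rule surjI)
    fix z show "C (snd (snd (inv D (0, z)))) = z"
      unfolding C_def snd_D[symmetric] by (simp add: surj_f_inv_f[OF surj_D])
  qed
  then have "inj C" using linear_surjective_imp_injective[OF C] by blast
  moreover have "C x = C 0" using assms linear_0[OF C] by (simp add: C_def)
  ultimately show ?thesis by (simp add: inj_eq)
qed

text \<open>The derivative predicted by implicit differentiation: the \<mu>-component of the
  displacement that keeps the linearised \<psi>-part at zero while \<open>P\<close> moves by
  \<open>x\<close>.\<close>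

definition T :: "real^'r \<Rightarrow> real^'s" where "T x = fst (inv D (0, snd (D (0, 0, x))))"

text \<open>Subtracting the displacement that defines \<open>T\<close> leaves a vector on which
  \<open>D\<close> has only the \<psi>-part of \<open>D a\<close>. The \<mu>-component thus follows
  \<open>T\<close> up to the \<psi>-part, whatever the size of the
  \<open>P\<close>-displacement.\<close>

lemma T_error: "norm (fst a - T (snd (snd a))) \<le> b * norm (fst (D a))"
proof -
  define c where "c = inv D (0, snd (D (0, 0, snd (snd a))))"
  have "D c = (0, snd (D (0, 0, snd (snd a))))" unfolding c_def by (rule surj_f_inv_f[OF surj_D])
  also have "\<dots> = (0, snd (D a))" by (subst snd_D[of a]) (rule refl)
  finally have "D (a - c) = (fst (D a), 0)"
    by (simp add: linear_diff[OF linear_D] prod_eq_iff)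
  then have "norm (a - c) \<le> b * norm (fst (D a))" using b[of "a - c"] by simp
  then show ?thesis using norm_fst_le'[of "a - c"] by (simp add: T_def c_def)
qed

lemma linear_inv_D: "linear (inv D)"
proof (rule linearI)
  fix x y c
  show "inv D (x + y) = inv D x + inv D y"
    by (rule injD[OF inj_D]) (simp add: linear_add[OF linear_D] surj_f_inv_f[OF surj_D])
  show "inv D (c *\<^sub>R x) = c *\<^sub>R inv D x"
    by (rule injD[OF inj_D]) (simp add: linear_scale[OF linear_D] surj_f_inv_f[OF surj_D])
qed

lemma linear_T: "linear T"
proof -
  have lin: "linear (\<lambda>x. D (0, 0, x))"
    by (rule linear_compose[OF _ linear_D, unfolded o_def]) (auto intro!: linearI)
  show ?thesis unfolding T_def
    by (rule linear_compose[OF linear_compose[OF _ linear_inv_D] linear_fst, unfolded o_def])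
       (rule linear_compose[OF linear_compose[OF lin linear_snd], unfolded o_def], auto intro!: linearI)
qed

text \<open>Continuity of \<open>mu\<close> at \<open>P0\<close>, and that of the multiplier, bring
  the point \<open>(mu P, lam (mu P) P, P)\<close> close to \<alpha>0. The envelope theorem makes it
  a root of the \<psi>-part, and linearising \<open>G\<close> there leaves only an error of smaller
  order for \<open>T_error\<close>.\<close>

lemma mu_has_derivative:
  assumes dom: "\<And>P. mu P \<in> profile_dom F m \<Theta> lam P"
    and max: "\<And>P \<mu>. \<mu> \<in> profile_dom F m \<Theta> lam P \<Longrightarrow> profile F m lam P \<mu> \<le> profile F m lam P (mu P)"
    and mu0: "mu P0 = \<mu>0" and cont: "isCont mu P0"
  shows "(mu has_derivative T) (at P0)"
  unfolding has_derivative_at_alt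
proof (intro conjI allI impI)
  show "bounded_linear T" using linear_T by (rule linear_conv_bounded_linear[THEN iffD1])
  fix \<epsilon> :: real assume eps: "\<epsilon> > 0"
  \<comment> \<open>The constant in the a priori bound
    \<open>norm (a - \<alpha>0) \<le> K * norm (P - P0)\<close>, which comes before the sharp
    estimate.\<close>
  define K where "K = 2 * b * (EQ + 1)"
  have K: "K > 0" using b_pos EQ_nonneg by (simp add: K_def)
  \<comment> \<open>The first bound lets the linearisation error be absorbed into the left side of
    the a priori estimate; the second turns the final error into
    \<open>\<epsilon> * norm (P - P0)\<close>.\<close>
  define \<delta> where "\<delta> = min (1 / (4 * b)) (\<epsilon> / (b * K))"
  have delta: "\<delta> > 0" using b_pos K eps by (simp add: \<delta>_def)
  have d1: "b * (2 * \<delta>) \<le> 1/2"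
  proof -
    have "\<delta> \<le> 1 / (4 * b)" by (simp add: \<delta>_def)
    then show ?thesis using b_pos by (simp add: field_simps)
  qed
  have d2: "b * \<delta> * K \<le> \<epsilon>"
  proof -
    have "\<delta> \<le> \<epsilon> / (b * K)" by (simp add: \<delta>_def)
    then show ?thesis using b_pos K by (simp add: field_simps)
  qed
  obtain d where d: "d > 0" "\<And>a. norm (a - \<alpha>0) < d \<Longrightarrow> norm (G a - D (a - \<alpha>0)) \<le> \<delta> * norm (a - \<alpha>0)"
    using G_alt[OF delta] by blast
  have z0: "G1 (\<mu>0, l0, P0) = 0" by (simp add: G1_def root)
  have c0: "\<alpha>0 \<in> ball \<alpha>0 \<rho>" using rho by simp
  have lim: "filterlim (\<lambda>P. (mu P, P)) (nhds (\<mu>0, P0)) (nhds P0)"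
    unfolding mu0[symmetric] using cont
    by (intro tendsto_Pair filterlim_ident) (simp add: continuous_at tendsto_at_iff_tendsto_nhds)
  have ev1: "\<forall>\<^sub>F P in nhds P0. norm (lam (mu P) P - l0) \<le> d/4 \<and> (mu P, lam (mu P) P, P) \<in> ball \<alpha>0 \<rho> \<and>
     (mu P, l0, P) \<in> ball \<alpha>0 \<rho> \<and> G1 (mu P, lam (mu P) P, P) = 0"
    using eventually_compose_filterlim[OF lam_continuous[OF c0 z0, of "d/4"] lim] d(1) by simp
  have ev2: "\<forall>\<^sub>F P in nhds P0. dist (mu P, P) (\<mu>0, P0) < d/4"
    using tendstoD[OF lim, of "d/4"] d(1) by simp
  have ev3: "\<forall>\<^sub>F P in nhds P0. (\<mu>0, l0, P) \<in> ball \<alpha>0 \<rho>"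
    using rho by (auto simp: eventually_nhds_metric dist_Pair_Pair dist_commute intro!: exI[of _ \<rho>])
  from ev1 ev2 ev3 have "\<forall>\<^sub>F P in nhds P0. norm (mu P - mu P0 - T (P - P0)) \<le> \<epsilon> * norm (P - P0)"
  proof eventually_elim
    case (elim P)
    define a where "a = (mu P, lam (mu P) P, P)"
    define x where "x = norm (a - \<alpha>0)"
    have aB: "a \<in> B" using elim by (simp add: a_def)
    have G2: "G2 a = 0" unfolding a_def using elim by (intro profile_maximiser_critical max) auto
    have fG: "fst (G a) = 0" using elim G2 by (simp add: G1_def G2_def a_def prod_eq_iff)
    have "x \<le> norm (mu P - \<mu>0) + norm (lam (mu P) P - l0) + norm (P - P0)"
      unfolding x_def a_def using norm_Pair_le[of "mu P - \<mu>0" "(lam (mu P) P - l0, P - P0)"]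
        norm_Pair_le[of "lam (mu P) P - l0" "P - P0"] by simp
    moreover have "norm (mu P - \<mu>0) \<le> dist (mu P, P) (\<mu>0, P0)" "norm (P - P0) \<le> dist (mu P, P) (\<mu>0, P0)"
      using norm_fst_le[of "mu P - \<mu>0" "P - P0"] norm_snd_le[of "P - P0" "mu P - \<mu>0"] by (auto simp: dist_norm)
    ultimately have "x < d" using elim d(1) by linarith
    then have e: "norm (G a - D (a - \<alpha>0)) \<le> \<delta> * x" using d(2)[of a] by (simp add: x_def)
    have "norm (fst (G a - D (a - \<alpha>0))) \<le> \<delta> * x" by (rule order_trans[OF norm_fst_le' e])
    then have f: "norm (fst (D (a - \<alpha>0))) \<le> \<delta> * x" by (simp add: fG)
    \<comment> \<open>The \<open>h\<close>-block depends on \<open>P\<close> alone, so it may be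
      compared at \<open>(\<mu>0, l0, P)\<close>, where the distance to \<alpha>0 is just
      \<open>norm (P - P0)\<close>.\<close>
    have "norm (snd (G a)) = norm (snd (G (\<mu>0, l0, P) - G \<alpha>0))" by (simp add: a_def snd_G root)
    also have "\<dots> \<le> norm (G (\<mu>0, l0, P) - G \<alpha>0)" by (rule norm_snd_le')
    also have "\<dots> \<le> EQ * dist (\<mu>0, l0, P) \<alpha>0" using elim rho by (intro G_lip) auto
    finally have s: "norm (G a) \<le> EQ * norm (P - P0)"
      using fG by (simp add: norm_prod_def dist_Pair_Pair dist_norm)
    have "norm (D (a - \<alpha>0)) \<le> norm (G a) + norm (G a - D (a - \<alpha>0))"
      using norm_triangle_ineq4[of "G a" "G a - D (a - \<alpha>0)"] by simp
    also have "\<dots> \<le> EQ * norm (P - P0) + \<delta> * x" using s e by linarith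
    finally have "x \<le> b * (EQ * norm (P - P0) + \<delta> * x)"
      unfolding x_def by (rule b_le)
    also have "\<dots> = b * EQ * norm (P - P0) + (b * (2 * \<delta>)) * x / 2" by (simp add: algebra_simps)
    also have "\<dots> \<le> b * EQ * norm (P - P0) + 1/2 * x / 2"
      using mult_right_mono[OF d1, of x] by (simp add: x_def)
    finally have "x \<le> 2 * (b * EQ * norm (P - P0))"
      using norm_ge_zero[of "a - \<alpha>0"] unfolding x_def by linarith
    then have "x \<le> 2 * b * EQ * norm (P - P0)" by simp
    also have "\<dots> \<le> K * norm (P - P0)" using b_pos unfolding K_def by (intro mult_right_mono mult_left_mono) auto
    finally have xK: "x \<le> K * norm (P - P0)" .
    have "norm (mu P - \<mu>0 - T (P - P0)) \<le> b * norm (fst (D (a - \<alpha>0)))"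
      using T_error[of "a - \<alpha>0"] by (simp add: a_def)
    also have "\<dots> \<le> b * (\<delta> * (K * norm (P - P0)))"
      using b_pos delta by (intro mult_left_mono order_trans[OF f] xK) auto
    also have "\<dots> = (b * \<delta> * K) * norm (P - P0)" by simp
    also have "\<dots> \<le> \<epsilon> * norm (P - P0)" using d2 by (intro mult_right_mono) auto
    finally show ?case by (simp add: mu0)
  qed
  then show "\<exists>d>0. \<forall>y. norm (y - P0) < d \<longrightarrow> norm (mu y - mu P0 - T (y - P0)) \<le> \<epsilon> * norm (y - P0)"
    unfolding eventually_nhds_metric by (simp add: dist_norm)
qed

text \<open>The errors are first relative to \<open>norm (a - \<alpha>0)\<close>;
  \<open>4 * b * \<epsilon> \<le> 1\<close> allows them to be absorbed, which yields the rate
  \<open>s\<close>. Inserting this rate back turns the relative error into one of size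
  \<open>\<epsilon> * s\<close>. \<open>Gn\<close> is an arbitrary function here, so the argument is
  deterministic.\<close>

lemma root_expansion:
  assumes lin: "\<And>a. a \<in> cball \<alpha>0 R \<Longrightarrow> norm (G a - D (a - \<alpha>0)) \<le> \<epsilon> * norm (a - \<alpha>0)"
    and mod: "\<And>a. a \<in> cball \<alpha>0 R \<Longrightarrow> norm (Gn a - Gn \<alpha>0 - G a) \<le> \<epsilon> * max (dist a \<alpha>0) s"
    and Gn0: "norm (Gn \<alpha>0) \<le> K * s" and a: "a \<in> cball \<alpha>0 R" and Gna: "norm (Gn a) \<le> K * s"
    and eps: "\<epsilon> > 0" "4 * b * \<epsilon> \<le> 1" "\<epsilon> \<le> 1" and s: "s > 0"
  shows "norm (a - \<alpha>0) \<le> 2 * b * (2 * K + 1) * s"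
    and "norm (D (a - \<alpha>0) + Gn \<alpha>0 - Gn a) \<le> \<epsilon> * (2 * (2 * b * (2 * K + 1)) + 1) * s"
proof -
  define x where "x = norm (a - \<alpha>0)"
  have x0: "x \<ge> 0" by (simp add: x_def)
  have "\<epsilon> * max x s \<le> \<epsilon> * (x + s)" using eps(1) s x0 by (intro mult_left_mono) auto
  then have m: "norm (Gn a - Gn \<alpha>0 - G a) \<le> \<epsilon> * (x + s)" using mod[OF a] by (simp add: dist_norm x_def)
  have "D (a - \<alpha>0) + Gn \<alpha>0 - Gn a = - ((Gn a - Gn \<alpha>0 - G a) + (G a - D (a - \<alpha>0)))" by simp
  also have "norm \<dots> \<le> norm (Gn a - Gn \<alpha>0 - G a) + norm (G a - D (a - \<alpha>0))"
    unfolding norm_minus_cancel by (rule norm_triangle_ineq)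
  also have "\<dots> \<le> \<epsilon> * (x + s) + \<epsilon> * x" using m lin[OF a] by (simp add: x_def)
  finally have e: "norm (D (a - \<alpha>0) + Gn \<alpha>0 - Gn a) \<le> \<epsilon> * (2 * x + s)" by (simp add: algebra_simps)
  have "norm (D (a - \<alpha>0)) \<le> norm (D (a - \<alpha>0) + Gn \<alpha>0 - Gn a) + norm (Gn \<alpha>0) + norm (Gn a)"
    using norm_triangle_ineq4[of "D (a - \<alpha>0) + Gn \<alpha>0 - Gn a" "Gn \<alpha>0 - Gn a"]
      norm_triangle_ineq4[of "Gn \<alpha>0" "Gn a"] by simp
  also have "\<dots> \<le> \<epsilon> * (2 * x + s) + 2 * (K * s)" using e Gn0 Gna by linarith
  finally have "x \<le> b * (\<epsilon> * (2 * x + s) + 2 * (K * s))"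
    unfolding x_def by (rule b_le)
  also have "\<dots> = (4 * b * \<epsilon>) * x / 2 + b * (\<epsilon> * s) + 2 * b * K * s" by (simp add: algebra_simps)
  also have "\<dots> \<le> 1 * x / 2 + b * (1 * s) + 2 * b * K * s"
    using eps s x0 b_pos by (intro add_mono mult_right_mono mult_left_mono divide_right_mono) auto
  finally show xb: "norm (a - \<alpha>0) \<le> 2 * b * (2 * K + 1) * s" unfolding x_def[symmetric] by (simp add: algebra_simps)
  have "\<epsilon> * (2 * x + s) \<le> \<epsilon> * (2 * (2 * b * (2 * K + 1) * s) + s)"
    using xb eps unfolding x_def[symmetric] by (intro mult_left_mono add_mono) auto
  with e show "norm (D (a - \<alpha>0) + Gn \<alpha>0 - Gn a) \<le> \<epsilon> * (2 * (2 * b * (2 * K + 1)) + 1) * s"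
    by (simp add: algebra_simps)
qed

text \<open>Both expansions contain \<open>Gn \<alpha>0\<close>, and the \<psi>-part of
  \<open>Gn\<close> vanishes at both points. The \<psi>-part of \<open>D (a - c)\<close> is
  therefore a difference of two remainders, and \<open>T_error\<close> converts this into the
  claim.\<close>

lemma root_difference:
  assumes lin: "\<And>a. a \<in> cball \<alpha>0 R \<Longrightarrow> norm (G a - D (a - \<alpha>0)) \<le> \<epsilon> * norm (a - \<alpha>0)"
    and mod: "\<And>a. a \<in> cball \<alpha>0 R \<Longrightarrow> norm (Gn a - Gn \<alpha>0 - G a) \<le> \<epsilon> * max (dist a \<alpha>0) s"
    and Gn0: "norm (Gn \<alpha>0) \<le> K * s"
    and a: "a \<in> cball \<alpha>0 R" "fst (Gn a) = 0" "norm (snd (Gn a)) \<le> K * s"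
    and c: "c \<in> cball \<alpha>0 R" "fst (Gn c) = 0" "snd (Gn c) = snd (Gn \<alpha>0)"
    and eps: "\<epsilon> > 0" "4 * b * \<epsilon> \<le> 1" "\<epsilon> \<le> 1" and s: "s > 0"
  shows "norm (fst a - fst c - T (snd (snd a) - snd (snd c))) \<le>
    \<epsilon> * (b * (2 * (2 * (2 * b * (2 * K + 1)) + 1))) * s"
proof -
  define k where "k = 2 * (2 * b * (2 * K + 1)) + 1"
  have na: "norm (Gn a) \<le> K * s" using a by (simp add: norm_prod_def)
  have "norm (snd (Gn c)) \<le> K * s" unfolding c(3) by (rule order_trans[OF norm_snd_le' Gn0])
  then have nc: "norm (Gn c) \<le> K * s" using c by (simp add: norm_prod_def)
  have ea: "norm (D (a - \<alpha>0) + Gn \<alpha>0 - Gn a) \<le> \<epsilon> * k * s"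
    unfolding k_def by (rule root_expansion(2)[OF lin mod Gn0 a(1) na eps s])
  have ec: "norm (D (c - \<alpha>0) + Gn \<alpha>0 - Gn c) \<le> \<epsilon> * k * s"
    unfolding k_def by (rule root_expansion(2)[OF lin mod Gn0 c(1) nc eps s])
  have "fst (D (a - c)) = fst (D (a - \<alpha>0) + Gn \<alpha>0 - Gn a) - fst (D (c - \<alpha>0) + Gn \<alpha>0 - Gn c)"
    using a(2) c(2) by (simp add: linear_diff[OF linear_D])
  also have "norm \<dots> \<le> \<epsilon> * k * s + \<epsilon> * k * s"
    by (rule order_trans[OF norm_triangle_ineq4 add_mono[OF order_trans[OF norm_fst_le' ea] order_trans[OF norm_fst_le' ec]]])
  finally have "norm (fst (D (a - c))) \<le> 2 * (\<epsilon> * k * s)" by simp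
  then have "b * norm (fst (D (a - c))) \<le> b * (2 * (\<epsilon> * k * s))" using b_pos by (intro mult_left_mono) auto
  with T_error[of "a - c"] have "norm (fst a - fst c - T (snd (snd a) - snd (snd c))) \<le> b * (2 * (\<epsilon> * k * s))" by simp
  then show ?thesis unfolding k_def by (simp add: algebra_simps)
qed

text \<open>Brouwer's theorem for a Newton map with the fixed inverse of \<open>D\<close>. The last
  block of \<open>S\<close> is not the empirical \<open>h\<close>-equation but a linear condition
  whose only zero is the prescribed \<open>P\<close>, so the root has exactly this last component.
  Four errors of size \<open>\<epsilon> * r\<close> arise, from the modulus, the linearisation,
  \<open>Gn \<alpha>0\<close> and the shift of \<open>P\<close>; this is the factor in
  \<open>4 * b * \<epsilon> \<le> 1\<close>.\<close>

lemma root_exists: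
  assumes r: "r > 0" and cont: "continuous_on (cball \<alpha>0 r) Gn"
    and lin: "\<And>a. a \<in> cball \<alpha>0 r \<Longrightarrow> norm (G a - D (a - \<alpha>0)) \<le> \<epsilon> * norm (a - \<alpha>0)"
    and mod: "\<And>a. a \<in> cball \<alpha>0 r \<Longrightarrow> norm (Gn a - Gn \<alpha>0 - G a) \<le> \<epsilon> * max (dist a \<alpha>0) s"
    and Gn0: "norm (Gn \<alpha>0) \<le> \<epsilon> * r" and P: "norm (D (0, 0, P - P0)) \<le> \<epsilon> * r"
    and eps: "\<epsilon> > 0" "4 * b * \<epsilon> \<le> 1" and s: "s \<le> r"
  obtains \<mu> l where "(\<mu>, l, P) \<in> cball \<alpha>0 r" "fst (Gn (\<mu>, l, P)) = 0"
proof -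
  define S where "S a = (fst (Gn a), snd (D (0, 0, snd (snd a) - P)))" for a
  define \<Phi> where "\<Phi> a = a - inv D (S a)" for a
  have "continuous_on (cball \<alpha>0 r) (\<lambda>a. D (0, 0, snd (snd a) - P))"
    by (rule continuous_on_compose2[OF linear_continuous_on[OF linear_D[THEN linear_conv_bounded_linear[THEN iffD1]], of UNIV]])
       (auto intro!: continuous_intros)
  then have "continuous_on (cball \<alpha>0 r) S" unfolding S_def by (intro continuous_intros cont)
  then have "continuous_on (cball \<alpha>0 r) \<Phi>" unfolding \<Phi>_def
    by (intro continuous_on_diff continuous_on_id
        continuous_on_compose2[OF linear_continuous_on[OF linear_inv_D[THEN linear_conv_bounded_linear[THEN iffD1]], of UNIV]]) auto
  moreover have "\<Phi> \<in> cball \<alpha>0 r \<rightarrow> cball \<alpha>0 r"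
  proof
    fix a assume a: "a \<in> cball \<alpha>0 r"
    have x: "norm (a - \<alpha>0) \<le> r" using a by (simp add: dist_norm norm_minus_commute)
    have "\<epsilon> * max (dist a \<alpha>0) s \<le> \<epsilon> * r" "\<epsilon> * norm (a - \<alpha>0) \<le> \<epsilon> * r"
      using x s eps by (auto intro!: mult_left_mono simp: dist_norm)
    then have 1: "norm (Gn a - Gn \<alpha>0 - G a) \<le> \<epsilon> * r" "norm (G a - D (a - \<alpha>0)) \<le> \<epsilon> * r"
      using mod[OF a] lin[OF a] by linarith+
    have "D (a - \<alpha>0) - Gn a = - ((Gn a - Gn \<alpha>0 - G a) + (G a - D (a - \<alpha>0)) + Gn \<alpha>0)" by simp
    also have "norm \<dots> \<le> \<epsilon> * r + \<epsilon> * r + \<epsilon> * r"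
      unfolding norm_minus_cancel using 1 Gn0 by (intro norm_triangle_mono)
    finally have 2: "norm (fst (D (a - \<alpha>0) - Gn a)) \<le> 3 * (\<epsilon> * r)" by (intro order_trans[OF norm_fst_le']) simp
    have eq: "D (0, 0, snd (snd a) - P0) - D (0, 0, snd (snd a) - P) = D (0, 0, P - P0)"
      by (simp add: linear_diff[OF linear_D, symmetric])
    have 3: "snd (D (a - \<alpha>0)) - snd (D (0, 0, snd (snd a) - P)) = snd (D (0, 0, P - P0))"
      using arg_cong[of _ _ snd, OF eq] snd_D[of "a - \<alpha>0"] by simp
    have "D (a - \<alpha>0) - S a = (fst (D (a - \<alpha>0) - Gn a), snd (D (0, 0, P - P0)))"
      using 3 by (simp add: S_def prod_eq_iff)
    also have "norm \<dots> \<le> 3 * (\<epsilon> * r) + \<epsilon> * r"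
      by (rule order_trans[OF norm_Pair_le add_mono[OF 2 order_trans[OF norm_snd_le' P]]])
    finally have 4: "norm (D (a - \<alpha>0) - S a) \<le> 4 * (\<epsilon> * r)" by simp
    have "D (\<Phi> a - \<alpha>0) = D (a - \<alpha>0) - S a"
      unfolding \<Phi>_def by (simp add: linear_diff[OF linear_D] surj_f_inv_f[OF surj_D])
    then have "norm (\<Phi> a - \<alpha>0) \<le> b * norm (D (a - \<alpha>0) - S a)" using b[of "\<Phi> a - \<alpha>0"] by simp
    also have "\<dots> \<le> b * (4 * (\<epsilon> * r))" using 4 b_pos by (intro mult_left_mono) auto
    also have "\<dots> = (4 * b * \<epsilon>) * r" by simp
    also have "\<dots> \<le> 1 * r" using eps r by (intro mult_right_mono) auto
    finally show "\<Phi> a \<in> cball \<alpha>0 r" by (simp add: dist_norm norm_minus_commute)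
  qed
  ultimately obtain a where a: "a \<in> cball \<alpha>0 r" "\<Phi> a = a" by (rule brouwer_ball[OF r])
  then have "inv D (S a) = 0" by (simp add: \<Phi>_def)
  then have "D (inv D (S a)) = 0" by (simp add: linear_0[OF linear_D])
  then have S0: "S a = 0" by (simp add: surj_f_inv_f[OF surj_D])
  have S1: "fst (Gn a) = 0" using arg_cong[of _ _ fst, OF S0] by (simp add: S_def)
  have "snd (D (0, 0, snd (snd a) - P)) = 0" using arg_cong[of _ _ snd, OF S0] by (simp add: S_def)
  then have "snd (snd a) - P = 0" by (rule D_block_injective)
  then have "a = (fst a, fst (snd a), P)" by (simp add: prod_eq_iff)
  with a(1) S1 show ?thesis using that by metis
qed

end

section \<open>Roots of the empirical equations\<close>

context prob_space
begin

lemma likely_Ball: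
  assumes "finite I" "\<And>i. i \<in> I \<Longrightarrow> likely M (P i)"
  shows "likely M (\<lambda>n \<omega>. \<forall>i\<in>I. P i n \<omega>)"
  using assms
proof (induction I rule: finite_induct)
  case empty
  show ?case by (rule likely_AE) simp
next
  case (insert x I)
  then have "likely M (\<lambda>n \<omega>. P x n \<omega> \<and> (\<forall>i\<in>I. P i n \<omega>))" by (intro likely_conj) auto
  then show ?case by (rule likely_mono') simp
qed

end

context iid_sample
begin

text \<open>The expected absolute inner product is continuous and positive on the unit sphere, hence
  bounded below there. A finite net and the weak law carry the bound to the sample, and homogeneity
  extends it to all \<open>d\<close>. Absolute values instead of squares keep the requirement at
  first moments.\<close>

lemma likely_nondegenerate:
  fixes g :: "'y \<Rightarrow> 'q::euclidean_space"
  assumes g: "integrable F g" and nondeg: "\<And>d. (AE y in F. d \<bullet> g y = 0) \<Longrightarrow> d = 0"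
  obtains \<kappa> where "\<kappa> > 0"
    "likely M (\<lambda>n \<omega>. \<forall>d. \<kappa> * norm d \<le> emean n (\<lambda>i. \<bar>d \<bullet> g (Y i \<omega>)\<bar>))"
proof -
  define E where "E = (\<integral>y. norm (g y) \<partial>F)"
  have E: "E \<ge> 0" by (simp add: E_def)
  define \<phi> where "\<phi> d = (\<integral>y. \<bar>d \<bullet> g y\<bar> \<partial>F)" for d
  have gi: "integrable F (\<lambda>y. \<bar>d \<bullet> g y\<bar>)" for d using g by simp
  have diff: "\<bar>\<bar>d \<bullet> z\<bar> - \<bar>t \<bullet> z\<bar>\<bar> \<le> norm z * norm (d - t)" for d t z :: 'q
  proof -
    have "\<bar>\<bar>d \<bullet> z\<bar> - \<bar>t \<bullet> z\<bar>\<bar> \<le> \<bar>d \<bullet> z - t \<bullet> z\<bar>" by (rule abs_triangle_ineq3)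
    also have "\<dots> = \<bar>(d - t) \<bullet> z\<bar>" by (simp add: inner_diff_left)
    also have "\<dots> \<le> norm (d - t) * norm z" by (rule Cauchy_Schwarz_ineq2)
    finally show ?thesis by (simp add: mult.commute)
  qed
  have "\<bar>\<phi> d - \<phi> t\<bar> \<le> E * norm (d - t)" for d t
  proof -
    have "norm (\<integral>y. \<bar>d \<bullet> g y\<bar> - \<bar>t \<bullet> g y\<bar> \<partial>F) \<le> (\<integral>y. norm (g y) * norm (d - t) \<partial>F)"
      using g gi diff by (intro norm_integral_le_AE) (auto intro!: Bochner_Integration.integrable_diff)
    then show ?thesis using gi g by (simp add: \<phi>_def E_def)
  qed
  then have "E-lipschitz_on UNIV \<phi>" using E by (intro lipschitz_onI) (auto simp: dist_norm)
  then have "continuous_on UNIV \<phi>" by (rule lipschitz_on_continuous_on)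
  then have "continuous_on (sphere 0 1) \<phi>" by (rule continuous_on_subset) simp
  moreover have "sphere (0::'q) 1 \<noteq> {}" by simp
  ultimately obtain d0 where d0: "d0 \<in> sphere 0 1" "\<And>d. d \<in> sphere 0 1 \<Longrightarrow> \<phi> d0 \<le> \<phi> d"
    using continuous_attains_inf[OF compact_sphere] by blast
  define c where "c = \<phi> d0"
  have "c \<noteq> 0"
  proof
    assume "c = 0"
    then have "AE y in F. \<bar>d0 \<bullet> g y\<bar> = 0"
      unfolding c_def \<phi>_def using integral_nonneg_eq_0_iff_AE[OF gi[of d0]] by simp
    then have "d0 = 0" by (intro nondeg) simp
    with d0(1) show False by simp
  qed
  moreover have "c \<ge> 0" unfolding c_def \<phi>_def by simp
  ultimately have c: "c > 0" by simp
  \<comment> \<open>A quarter of the minimum \<open>c\<close> is lost between a direction and its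
    net point and a quarter in the weak law at the net; half of it is left.\<close>
  define \<eta> where "\<eta> = c / (4 * (E + 1))"
  have eta: "\<eta> > 0" "(E + 1) * \<eta> = c/4" using c E by (auto simp: \<eta>_def field_simps)
  have cov: "sphere (0::'q) 1 \<subseteq> (\<Union>t\<in>sphere 0 1. ball t \<eta>)" using centre_in_ball eta(1) by blast
  obtain S where S: "S \<subseteq> sphere (0::'q) 1" "finite S" "sphere (0::'q) 1 \<subseteq> (\<Union>t\<in>S. ball t \<eta>)"
    by (rule compactE_image[OF compact_sphere open_ball cov]) (rule that)
  have ev1: "likely M (\<lambda>n \<omega>. \<forall>t\<in>S. norm (emean n (\<lambda>i. \<bar>t \<bullet> g (Y i \<omega>)\<bar>) - \<phi> t) \<le> c/4)"
    unfolding \<phi>_def using S(2) c gi by (intro likely_Ball weak_law) auto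
  have ev2: "likely M (\<lambda>n \<omega>. norm (emean n (\<lambda>i. norm (g (Y i \<omega>))) - E) \<le> 1)"
    unfolding E_def using g by (intro weak_law) auto
  show thesis
  proof (rule that[of "c/2"])
    from likely_conj[OF ev1 ev2]
    show "likely M (\<lambda>n \<omega>. \<forall>d. c/2 * norm d \<le> emean n (\<lambda>i. \<bar>d \<bullet> g (Y i \<omega>)\<bar>))"
    proof (rule likely_mono', intro allI)
      fix n \<omega> and d :: 'q
      assume w: "(\<forall>t\<in>S. norm (emean n (\<lambda>i. \<bar>t \<bullet> g (Y i \<omega>)\<bar>) - \<phi> t) \<le> c/4) \<and>
        norm (emean n (\<lambda>i. norm (g (Y i \<omega>))) - E) \<le> 1"
      have unit: "c/2 \<le> emean n (\<lambda>i. \<bar>e \<bullet> g (Y i \<omega>)\<bar>)" if e: "norm e = 1" for e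
      proof -
        have "e \<in> sphere 0 1" using e by simp
        then obtain t where t: "t \<in> S" "e \<in> ball t \<eta>" using S(3) by blast
        have "norm (emean n (\<lambda>i. \<bar>e \<bullet> g (Y i \<omega>)\<bar>) - emean n (\<lambda>i. \<bar>t \<bullet> g (Y i \<omega>)\<bar>)) \<le>
            emean n (\<lambda>i. norm (g (Y i \<omega>))) * norm (e - t)"
          by (rule norm_emean_diff_le) (use diff in simp)
        also have "\<dots> \<le> (E + 1) * \<eta>"
          using w t(2) E by (intro mult_mono) (auto simp: dist_norm norm_minus_commute)
        finally have "norm (emean n (\<lambda>i. \<bar>e \<bullet> g (Y i \<omega>)\<bar>) - emean n (\<lambda>i. \<bar>t \<bullet> g (Y i \<omega>)\<bar>)) \<le> c/4"
          by (simp add: eta(2))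
        moreover have "norm (emean n (\<lambda>i. \<bar>t \<bullet> g (Y i \<omega>)\<bar>) - \<phi> t) \<le> c/4" using w t(1) by blast
        moreover have "\<phi> t \<ge> c" unfolding c_def using t(1) S(1) d0(2) by blast
        ultimately show ?thesis unfolding real_norm_def by linarith
      qed
      show "c/2 * norm d \<le> emean n (\<lambda>i. \<bar>d \<bullet> g (Y i \<omega>)\<bar>)"
      proof (cases "d = 0")
        case False
        define e where "e = d /\<^sub>R norm d"
        have d: "d = norm d *\<^sub>R e" using False by (simp add: e_def)
        have "emean n (\<lambda>i. \<bar>d \<bullet> g (Y i \<omega>)\<bar>) = emean n (\<lambda>i. norm d * \<bar>e \<bullet> g (Y i \<omega>)\<bar>)"
          by (subst d) (simp add: abs_mult)
        also have "\<dots> = norm d * emean n (\<lambda>i. \<bar>e \<bullet> g (Y i \<omega>)\<bar>)" by (rule emean_mult)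
        also have "\<dots> \<ge> norm d * (c/2)"
          using unit[of e] False by (intro mult_left_mono) (auto simp: e_def)
        finally show ?thesis by (simp add: mult.commute)
      qed (simp add: emean_def)
    qed
  qed (use c in simp)
qed

end

context el_regular
begin

section \<open>The empirical estimating map and its roots\<close>

definition Gn :: "nat \<Rightarrow> 'w \<Rightarrow> (real^'s) \<times> (real^'q) \<times> (real^'r) \<Rightarrow> ((real^'q) \<times> (real^'s)) \<times> (real^'r)" where
  "Gn n \<omega> a = emean n (\<lambda>i. f (Y i \<omega>) a)"

lemma fst_fst_Gn: "fst (fst (Gn n \<omega> a)) = emean n (\<lambda>i. fst (psi_EL m (Y i \<omega>) a))"
  by (simp add: Gn_def emean_def f_def fst_sum)

lemma snd_fst_Gn: "snd (fst (Gn n \<omega> a)) = emean n (\<lambda>i. snd (psi_EL m (Y i \<omega>) a))"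
  by (simp add: Gn_def emean_def f_def fst_sum snd_sum)

lemma snd_Gn: "snd (Gn n \<omega> a) = emean n (\<lambda>i. h (Y i \<omega>) (snd (snd a)))"
  by (simp add: Gn_def emean_def f_def snd_sum)

lemma alpha0_in: "\<alpha>0 \<in> B" using rho by simp

lemma likely_modulus:
  assumes "\<epsilon> > 0"
  shows "likely M (\<lambda>n \<omega>. \<forall>a\<in>B. norm (Gn n \<omega> a - Gn n \<omega> \<alpha>0 - G a) \<le> \<epsilon> * max (dist a \<alpha>0) (1 / sqrt (real n)))"
proof -
  have "AE y in F. \<forall>a\<in>B. \<forall>c\<in>B. norm (f y a - f y c) \<le> Q y * dist a c"
    using good by eventually_elim (use f_lip in blast)
  from modulus[OF f_meas f_integrable[OF alpha0_in] this Q_meas Q2 assms rho]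
  show ?thesis
  proof (rule likely_mono')
    fix n \<omega>
    assume *: "\<forall>a\<in>B. norm (increment f \<alpha>0 n \<omega> a) \<le> \<epsilon> * max (dist a \<alpha>0) (1 / sqrt (real n))"
    show "\<forall>a\<in>B. norm (Gn n \<omega> a - Gn n \<omega> \<alpha>0 - G a) \<le> \<epsilon> * max (dist a \<alpha>0) (1 / sqrt (real n))"
    proof
      fix a assume a: "a \<in> B"
      have "(\<integral>y. f y a \<partial>F) - (\<integral>y. f y \<alpha>0 \<partial>F) = G a"
        using G_eq[OF a] G_eq[OF alpha0_in] root by simp
      with bspec[OF * a] show "norm (Gn n \<omega> a - Gn n \<omega> \<alpha>0 - G a) \<le> \<epsilon> * max (dist a \<alpha>0) (1 / sqrt (real n))"
        by (simp add: Gn_def increment_def)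
    qed
  qed
qed

text \<open>Chebyshev's inequality at tolerance \<open>K / sqrt n\<close> fails with probability at
  most \<open>C / K\<^sup>2\<close>, and \<open>K = 1 + C / \<eta>\<close> makes this at most
  \<open>\<eta>\<close>. The lower bound one on \<open>K\<close> lets it dominate later tolerances
  as well.\<close>

lemma Gn_tight:
  assumes eta: "\<eta> > 0"
  obtains K where "K \<ge> 1" "\<And>n. n \<ge> 1 \<Longrightarrow> prob_ge M (1 - \<eta>) (\<lambda>\<omega>. norm (Gn n \<omega> \<alpha>0) \<le> K * (1 / sqrt (real n)))"
proof -
  define C where "C = real (DIM(((real^'q) \<times> (real^'s)) \<times> (real^'r)))^3 * (\<integral>y. (norm (f y \<alpha>0))\<^sup>2 \<partial>F)"
  have C: "C \<ge> 0" unfolding C_def by simp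
  define K where "K = 1 + C / \<eta>"
  have K: "K \<ge> 1" using C eta by (simp add: K_def)
  have f2: "integrable F (\<lambda>y. (norm (f y \<alpha>0))\<^sup>2)"
  proof (rule Bochner_Integration.integrable_bound[OF Q2])
    show "AE y in F. norm ((norm (f y \<alpha>0))\<^sup>2) \<le> norm ((Q y)\<^sup>2)"
      using good by eventually_elim (use goodD(3) alpha0_in in \<open>auto intro!: power_mono\<close>)
  qed (use f_meas[OF alpha0_in] in \<open>simp add: measurable_F\<close>)
  show thesis
  proof (rule that[OF K])
    fix n :: nat assume n: "n \<ge> 1"
    have "prob_ge M (1 - C / (real n * (K * (1 / sqrt (real n)))\<^sup>2))
        (\<lambda>\<omega>. norm (emean n (\<lambda>i. f (Y i \<omega>) \<alpha>0) - (\<integral>y. f y \<alpha>0 \<partial>F)) \<le> K * (1 / sqrt (real n)))"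
      unfolding C_def using K n by (intro chebyshev f_meas alpha0_in f2) auto
    then show "prob_ge M (1 - \<eta>) (\<lambda>\<omega>. norm (Gn n \<omega> \<alpha>0) \<le> K * (1 / sqrt (real n)))"
    proof (rule prob_ge_mono)
      fix \<omega> assume "norm (emean n (\<lambda>i. f (Y i \<omega>) \<alpha>0) - (\<integral>y. f y \<alpha>0 \<partial>F)) \<le> K * (1 / sqrt (real n))"
      then show "norm (Gn n \<omega> \<alpha>0) \<le> K * (1 / sqrt (real n))"
        using G_eq[OF alpha0_in] root by (simp add: Gn_def)
    next
      have "C \<le> \<eta> * K" using eta by (simp add: K_def field_simps)
      also have "\<dots> \<le> \<eta> * K\<^sup>2" using K eta by (intro mult_left_mono) (auto simp: power2_eq_square)
      finally have "C / K\<^sup>2 \<le> \<eta>" using K by (simp add: field_simps)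
      moreover have "real n * (K * (1 / sqrt (real n)))\<^sup>2 = K\<^sup>2" using n by (simp add: power_divide)
      ultimately show "1 - \<eta> \<le> 1 - C / (real n * (K * (1 / sqrt (real n)))\<^sup>2)" by simp
    qed
  qed
qed

lemma likely_Gn0: "\<epsilon> > 0 \<Longrightarrow> likely M (\<lambda>n \<omega>. norm (Gn n \<omega> \<alpha>0) \<le> \<epsilon>)"
  using weak_law[OF f_integrable[OF alpha0_in], of \<epsilon>] G_eq[OF alpha0_in] root by (simp add: Gn_def)

lemma likely_good: "likely M (\<lambda>n \<omega>. \<forall>i. el_good m h B L (Q (Y i \<omega>)) (Y i \<omega>))"
  by (rule likely_AE) (use AE_Y[OF good] in simp)

lemma likely_Q: "likely M (\<lambda>n \<omega>. emean n (\<lambda>i. Q (Y i \<omega>)) \<le> EQ + 1)"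
  by (rule likely_mono'[OF weak_law[OF Q1, of 1]]) (auto simp: EQ_def)

lemma root_solves_emp:
  assumes "\<forall>i. el_good m h B L (Q (Y i \<omega>)) (Y i \<omega>)" "(\<mu>, l, P) \<in> B" "fst (Gn n \<omega> (\<mu>, l, P)) = 0"
  shows "solves_emp n (\<lambda>i. m (Y i \<omega>) \<mu> P) l"
  using goodD(4)[OF _ assms(2)] assms(1) fst_fst_Gn[of n \<omega> "(\<mu>, l, P)"] assms(3)
  by (simp add: solves_emp_def psi_EL_fst emean_def)

text \<open>The \<psi>-equations are the stationarity conditions for \<mu> and the multiplier.
  Nondegeneracy at the root is inherited from \<alpha>0: a direction orthogonal to all observations
  there would have mean absolute inner product below \<open>\<kappa> * norm d\<close> at \<alpha>0,
  by the Lipschitz bound and \<open>close\<close>.\<close>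

lemma root_log_critical:
  assumes n: "n \<ge> 1" and gd: "\<forall>i. el_good m h B L (Q (Y i \<omega>)) (Y i \<omega>)"
    and a: "(\<mu>, l, P) \<in> B" and z: "fst (Gn n \<omega> (\<mu>, l, P)) = 0"
    and nondeg: "\<forall>d. \<kappa> * norm d \<le> emean n (\<lambda>i. \<bar>d \<bullet> fst (psi_EL m (Y i \<omega>) \<alpha>0)\<bar>)"
    and Qm: "emean n (\<lambda>i. Q (Y i \<omega>)) \<le> EQ + 1"
    and close: "dist (\<mu>, l, P) \<alpha>0 * (EQ + 1) < \<kappa>"
  shows "log_critical \<Theta> (\<lambda>\<mu>. emp_lik n (\<lambda>i. m (Y i \<omega>) \<mu> P)) \<mu>"
proof (rule log_critical_profile[OF n in_Theta[OF a] m_deriv[OF in_Theta[OF a]] root_solves_emp[OF gd a z]])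
  fix e
  have "(\<Sum>i<n. (l \<bullet> (jacobian (\<lambda>\<mu>'. m (Y i \<omega>) \<mu>' P) (at \<mu>) *v e)) / (1 + l \<bullet> m (Y i \<omega>) \<mu> P)) =
      (\<Sum>i<n. snd (psi_EL m (Y i \<omega>) (\<mu>, l, P))) \<bullet> e"
    by (simp add: inner_sum_left psi_EL_snd_inner)
  also have "(\<Sum>i<n. snd (psi_EL m (Y i \<omega>) (\<mu>, l, P))) = 0"
    using snd_fst_Gn[of n \<omega> "(\<mu>, l, P)"] z n by (simp add: emean_def)
  finally show "(\<Sum>i<n. (l \<bullet> (jacobian (\<lambda>\<mu>'. m (Y i \<omega>) \<mu>' P) (at \<mu>) *v e)) / (1 + l \<bullet> m (Y i \<omega>) \<mu> P)) = 0"
    by simp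
next
  fix d :: "real^'q" assume d: "d \<noteq> 0"
  show "\<exists>i<n. d \<bullet> m (Y i \<omega>) \<mu> P \<noteq> 0"
  proof (rule ccontr)
    assume "\<not> ?thesis"
    then have dz: "d \<bullet> fst (psi_EL m (Y i \<omega>) (\<mu>, l, P)) = 0" if "i < n" for i
      using that by (simp add: psi_EL_fst)
    have "norm (emean n (\<lambda>i. \<bar>d \<bullet> fst (psi_EL m (Y i \<omega>) \<alpha>0)\<bar>) - emean n (\<lambda>i. 0)) \<le>
        emean n (\<lambda>i. Q (Y i \<omega>)) * (norm d * dist (\<mu>, l, P) \<alpha>0)"
    proof (rule norm_emean_diff_le)
      fix i assume i: "i < n"
      let ?x = "fst (psi_EL m (Y i \<omega>) \<alpha>0)" and ?z = "fst (psi_EL m (Y i \<omega>) (\<mu>, l, P))"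
      have "norm (?x - ?z) = norm (fst (fst (f (Y i \<omega>) \<alpha>0 - f (Y i \<omega>) (\<mu>, l, P))))" by (simp add: f_def)
      also have "\<dots> \<le> norm (f (Y i \<omega>) \<alpha>0 - f (Y i \<omega>) (\<mu>, l, P))"
        by (rule order_trans[OF norm_fst_le' norm_fst_le'])
      also have "\<dots> \<le> Q (Y i \<omega>) * dist \<alpha>0 (\<mu>, l, P)" using gd by (intro f_lip alpha0_in a) auto
      finally have "norm (?x - ?z) \<le> Q (Y i \<omega>) * dist \<alpha>0 (\<mu>, l, P)" .
      then have "norm d * norm (?x - ?z) \<le> norm d * (Q (Y i \<omega>) * dist \<alpha>0 (\<mu>, l, P))"
        by (rule mult_left_mono) simp
      moreover have "\<bar>d \<bullet> ?x\<bar> \<le> norm d * norm (?x - ?z)"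
        using Cauchy_Schwarz_ineq2[of d "?x - ?z"] dz[OF i] by (simp add: inner_diff_right)
      ultimately show "norm (\<bar>d \<bullet> ?x\<bar> - 0) \<le> Q (Y i \<omega>) * (norm d * dist (\<mu>, l, P) \<alpha>0)"
        by (simp add: dist_commute mult_ac)
    qed
    also have "\<dots> \<le> (EQ + 1) * (norm d * dist (\<mu>, l, P) \<alpha>0)" using Qm by (intro mult_right_mono) auto
    also have "\<dots> = (dist (\<mu>, l, P) \<alpha>0 * (EQ + 1)) * norm d" by simp
    also have "\<dots> < \<kappa> * norm d" using close d by (intro mult_strict_right_mono) auto
    finally have "emean n (\<lambda>i. \<bar>d \<bullet> fst (psi_EL m (Y i \<omega>) \<alpha>0)\<bar>) < \<kappa> * norm d"
      by (simp add: emean_const[OF n])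
    with nondeg show False by (simp add: not_le[symmetric])
  qed
qed

lemma continuous_on_Gn:
  assumes gd: "\<forall>i. el_good m h B L (Q (Y i \<omega>)) (Y i \<omega>)"
  shows "continuous_on B (Gn n \<omega>)"
proof -
  have "continuous_on B (f (Y i \<omega>))" for i
  proof (rule lipschitz_on_continuous_on)
    show "(Q (Y i \<omega>))-lipschitz_on B (f (Y i \<omega>))"
      using f_lip[of "Y i \<omega>"] gd Q_nonneg by (intro lipschitz_onI) (auto simp: dist_norm)
  qed
  then show ?thesis unfolding Gn_def emean_def by (intro continuous_intros)
qed

text \<open>The sequence \<open>Pn\<close> is arbitrary apart from consistency, so that the
  estimated parameter and the constant \<open>P0\<close> are covered together.\<close>

lemma likely_root:
  assumes P: "\<And>\<delta>. \<delta> > 0 \<Longrightarrow> likely M (\<lambda>n \<omega>. norm (Pn n \<omega> - P0) \<le> \<delta>)" and r: "0 < r"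
  shows "likely M (\<lambda>n \<omega>. \<exists>\<mu> l. (\<mu>, l, Pn n \<omega>) \<in> cball \<alpha>0 r \<and> fst (Gn n \<omega> (\<mu>, l, Pn n \<omega>)) = 0)"
proof -
  define \<epsilon> where "\<epsilon> = 1 / (4 * b)"
  have eps: "\<epsilon> > 0" "4 * b * \<epsilon> \<le> 1" using b_pos by (auto simp: \<epsilon>_def)
  obtain d where d: "d > 0" "\<And>a. norm (a - \<alpha>0) < d \<Longrightarrow> norm (G a - D (a - \<alpha>0)) \<le> \<epsilon> * norm (a - \<alpha>0)"
    using G_alt[OF eps(1)] by blast
  define r' where "r' = min (min r \<rho>) (d/2)"
  have r': "r' > 0" "r' \<le> r" "r' \<le> \<rho>" "r' < d" using r rho d(1) by (auto simp: r'_def)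
  obtain K where K: "K > 0" "\<And>x. norm (D x) \<le> norm x * K"
    using bounded_linear.pos_bounded[OF has_derivative_bounded_linear[OF deriv]] by blast
  define \<delta> where "\<delta> = \<epsilon> * r' / K"
  have delta: "\<delta> > 0" using eps r' K by (simp add: \<delta>_def)
  have er: "\<epsilon> * r' > 0" using eps r' by simp
  have "(\<lambda>n. 1 / sqrt (real n)) \<longlonglongrightarrow> 0" by real_asymp
  then have "\<forall>\<^sub>F n in sequentially. 1 / sqrt (real n) < r'" using r'(1) by (rule order_tendstoD)
  from likely_conj[OF likely_conj[OF likely_modulus[OF eps(1)] likely_Gn0[OF er]]
      likely_conj[OF likely_good likely_conj[OF P[OF delta] likely_eventually[OF this]]]]
  show ?thesis
  proof (rule likely_mono', elim conjE)
    fix n \<omega>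
    assume mod: "\<forall>a\<in>B. norm (Gn n \<omega> a - Gn n \<omega> \<alpha>0 - G a) \<le> \<epsilon> * max (dist a \<alpha>0) (1 / sqrt (real n))"
      and g0: "norm (Gn n \<omega> \<alpha>0) \<le> \<epsilon> * r'" and gd: "\<forall>i. el_good m h B L (Q (Y i \<omega>)) (Y i \<omega>)"
      and Pd: "norm (Pn n \<omega> - P0) \<le> \<delta>" and s: "1 / sqrt (real n) < r'"
    have sub: "cball \<alpha>0 r' \<subseteq> B" using r'(3) by (rule subset_cball)
    have "norm (D (0, 0, Pn n \<omega> - P0)) \<le> norm (Pn n \<omega> - P0) * K" using K(2)[of "(0, 0, Pn n \<omega> - P0)"] by simp
    also have "\<dots> \<le> \<delta> * K" using Pd K(1) by (intro mult_right_mono) auto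
    also have "\<dots> = \<epsilon> * r'" using K by (simp add: \<delta>_def)
    finally have DP: "norm (D (0, 0, Pn n \<omega> - P0)) \<le> \<epsilon> * r'" .
    have lin: "norm (G a - D (a - \<alpha>0)) \<le> \<epsilon> * norm (a - \<alpha>0)" if "a \<in> cball \<alpha>0 r'" for a
      using that r'(4) by (intro d(2)) (auto simp: dist_norm norm_minus_commute)
    obtain \<mu> l where "(\<mu>, l, Pn n \<omega>) \<in> cball \<alpha>0 r'" "fst (Gn n \<omega> (\<mu>, l, Pn n \<omega>)) = 0"
    proof (rule root_exists[OF r'(1) continuous_on_subset[OF continuous_on_Gn[OF gd, of n] sub] lin _ g0 DP eps less_imp_le[OF s]])
      show "norm (Gn n \<omega> a - Gn n \<omega> \<alpha>0 - G a) \<le> \<epsilon> * max (dist a \<alpha>0) (1 / sqrt (real n))"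
        if "a \<in> cball \<alpha>0 r'" for a using mod sub that by blast
    qed
    then show "\<exists>\<mu> l. (\<mu>, l, Pn n \<omega>) \<in> cball \<alpha>0 r \<and> fst (Gn n \<omega> (\<mu>, l, Pn n \<omega>)) = 0"
      using r'(2) by (intro exI[of _ \<mu>] exI[of _ l]) auto
  qed
qed

lemma root_solves_pop: "solves_pop F (\<lambda>y. m y \<mu>0 P0) l0"
  using solves_pop_iff[OF alpha0_in] root by (simp add: G1_def)

lemma likely_estimator_root:
  assumes P: "\<And>\<delta>. \<delta> > 0 \<Longrightarrow> likely M (\<lambda>n \<omega>. norm (Pn n \<omega> - P0) \<le> \<delta>)" and r: "0 < r"
    and crit: "likely M (\<lambda>n \<omega>. unique_log_critical \<Theta> (\<lambda>\<mu>. emp_lik n (\<lambda>i. m (Y i \<omega>) \<mu> (Pn n \<omega>))) (\<mu>n n \<omega>))"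
  shows "likely M (\<lambda>n \<omega>. \<exists>l. (\<mu>n n \<omega>, l, Pn n \<omega>) \<in> cball \<alpha>0 r \<and> fst (Gn n \<omega> (\<mu>n n \<omega>, l, Pn n \<omega>)) = 0)"
proof -
  have gi: "integrable F (\<lambda>y. fst (psi_EL m y \<alpha>0))"
    using psi1_integrable[OF alpha0_in] by (simp add: psi_EL_fst)
  have nd: "d = 0" if z: "AE y in F. d \<bullet> fst (psi_EL m y \<alpha>0) = 0" for d
  proof (rule nondegenerate[OF in_Theta[OF alpha0_in] root_solves_pop])
    from z good show "AE y in F. d \<bullet> m y \<mu>0 P0 = 0"
    proof eventually_elim
      case (elim y)
      then show ?case using goodD(4)[OF elim(2) alpha0_in] by (simp add: psi_EL_fst)
    qed
  qed
  obtain \<kappa> where kappa: "\<kappa> > 0"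
    "likely M (\<lambda>n \<omega>. \<forall>d. \<kappa> * norm d \<le> emean n (\<lambda>i. \<bar>d \<bullet> fst (psi_EL m (Y i \<omega>) \<alpha>0)\<bar>))"
    by (rule likely_nondegenerate[OF gi nd]) (assumption | rule that)+
  \<comment> \<open>The last bound gives \<open>r' * (EQ + 1) < \<kappa>\<close>, the closeness
    under which a root is a critical point.\<close>
  define r' where "r' = min (min r \<rho>) (\<kappa> / (2 * (EQ + 1)))"
  have r': "r' > 0" "r' \<le> r" "r' \<le> \<rho>" using r rho kappa(1) EQ_nonneg by (auto simp: r'_def)
  have "r' \<le> \<kappa> / (2 * (EQ + 1))" by (simp add: r'_def)
  then have "r' * (EQ + 1) \<le> \<kappa> / 2" using EQ_nonneg by (simp add: field_simps)
  then have rk: "r' * (EQ + 1) < \<kappa>" using kappa(1) by simp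
  have ex: "likely M (\<lambda>n \<omega>. \<exists>\<mu> l. (\<mu>, l, Pn n \<omega>) \<in> cball \<alpha>0 r' \<and> fst (Gn n \<omega> (\<mu>, l, Pn n \<omega>)) = 0)"
    using r'(1) by (intro likely_root P)
  from likely_conj[OF likely_conj[OF ex kappa(2)]
     likely_conj[OF likely_conj[OF likely_good likely_Q] likely_conj[OF crit likely_eventually[OF eventually_ge_at_top[of 1]]]]]
  show ?thesis
  proof (rule likely_mono', elim conjE exE)
    fix n \<omega> \<mu> l
    assume a: "(\<mu>, l, Pn n \<omega>) \<in> cball \<alpha>0 r'" and z: "fst (Gn n \<omega> (\<mu>, l, Pn n \<omega>)) = 0"
      and nd: "\<forall>d. \<kappa> * norm d \<le> emean n (\<lambda>i. \<bar>d \<bullet> fst (psi_EL m (Y i \<omega>) \<alpha>0)\<bar>)"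
      and gd: "\<forall>i. el_good m h B L (Q (Y i \<omega>)) (Y i \<omega>)" and Qm: "emean n (\<lambda>i. Q (Y i \<omega>)) \<le> EQ + 1"
      and cr: "unique_log_critical \<Theta> (\<lambda>\<mu>. emp_lik n (\<lambda>i. m (Y i \<omega>) \<mu> (Pn n \<omega>))) (\<mu>n n \<omega>)" and n: "1 \<le> n"
    have aB: "(\<mu>, l, Pn n \<omega>) \<in> B" using a r'(3) by auto
    have "dist (\<mu>, l, Pn n \<omega>) \<alpha>0 * (EQ + 1) \<le> r' * (EQ + 1)"
      using a EQ_nonneg by (intro mult_right_mono) (auto simp: dist_commute)
    then have "log_critical \<Theta> (\<lambda>\<mu>. emp_lik n (\<lambda>i. m (Y i \<omega>) \<mu> (Pn n \<omega>))) \<mu>"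
      using rk by (intro root_log_critical[OF n gd aB z nd Qm]) linarith
    then have "\<mu> = \<mu>n n \<omega>" using cr unfolding unique_log_critical_def by blast
    then show "\<exists>l. (\<mu>n n \<omega>, l, Pn n \<omega>) \<in> cball \<alpha>0 r \<and> fst (Gn n \<omega> (\<mu>n n \<omega>, l, Pn n \<omega>)) = 0"
      using a z r'(2) by (intro exI[of _ l]) auto
  qed
qed

end

section \<open>Identification and expansion of the estimator\<close>

context el_regular
begin

text \<open>The estimator at \<open>P0\<close> maximises the empirical likelihood globally and converges to \<open>\<mu>0\<close>;
  comparing with the value at another point of the profile domain shows that \<open>\<mu>0\<close> maximises the
  population profile, although nothing is assumed about the profile away from \<open>\<mu>0\<close>.\<close>

lemma profile_le_root:
  assumes dom: "\<mu>1 \<in> profile_dom F m \<Theta> lam P0"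
    and mel: "likely M (\<lambda>n \<omega>. is_MEL \<Theta> (\<lambda>\<mu>. emp_lik n (\<lambda>i. m (Y i \<omega>) \<mu> P0)) (\<mu>n n \<omega>))"
    and crit: "likely M (\<lambda>n \<omega>. unique_log_critical \<Theta> (\<lambda>\<mu>. emp_lik n (\<lambda>i. m (Y i \<omega>) \<mu> P0)) (\<mu>n n \<omega>))"
  shows "profile F m lam P0 \<mu>1 \<le> profile F m lam P0 \<mu>0"
proof (rule field_le_epsilon)
  fix e :: real assume e: "e > 0"
  define \<epsilon> where "\<epsilon> = e / 4"
  have eps: "\<epsilon> > 0" using e by (simp add: \<epsilon>_def)
  define l1 where "l1 = lam \<mu>1 P0"
  define g where "g y = m y \<mu>1 P0 /\<^sub>R (1 + l1 \<bullet> m y \<mu>1 P0)" for y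
  have mu1: "\<mu>1 \<in> \<Theta>" and sol: "solves_pop F (\<lambda>y. m y \<mu>1 P0) l1"
    and lni: "integrable F (\<lambda>y. ln (1 + l1 \<bullet> m y \<mu>1 P0))"
    using dom by (auto simp: profile_dom_def l1_def)
  have gi: "integrable F g" and g0: "(\<integral>y. g y \<partial>F) = 0" and gpos: "AE y in F. \<not> 1 + l1 \<bullet> m y \<mu>1 P0 \<le> 0"
    using sol unfolding solves_pop_def g_def by auto
  have nd: "d = 0" if z: "AE y in F. d \<bullet> g y = 0" for d
  proof (rule nondegenerate[OF mu1 sol])
    from z gpos show "AE y in F. d \<bullet> m y \<mu>1 P0 = 0"
      by eventually_elim (simp add: g_def)
  qed
  obtain \<kappa> where kappa: "\<kappa> > 0"
    "likely M (\<lambda>n \<omega>. \<forall>d. \<kappa> * norm d \<le> emean n (\<lambda>i. \<bar>d \<bullet> g (Y i \<omega>)\<bar>))"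
    by (rule likely_nondegenerate[OF gi nd]) (assumption | rule that)+
  \<comment> \<open>The first bound is the smallness demanded for a positive empirical likelihood;
    the second makes the penalty \<open>4 / \<kappa>\<close> times the empirical mean at most
    \<open>\<epsilon>\<close>.\<close>
  define \<delta> where "\<delta> = min (\<kappa>/16) (\<epsilon> * \<kappa> / 4)"
  have delta: "\<delta> > 0" using kappa(1) eps by (simp add: \<delta>_def)
  \<comment> \<open>A likely bound for the Lipschitz constant in \<mu> of the mean logarithm when
    the multiplier is frozen at \<open>l0\<close>.\<close>
  define c where "c = norm l0 / L * (EQ + 1)"
  have c: "c \<ge> 0" unfolding c_def using L EQ_nonneg by simp
  define r where "r = min \<rho> (\<epsilon> / (c + 1))"
  have r: "r > 0" "r \<le> \<rho>" using rho eps c by (auto simp: r_def)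
  have "r \<le> \<epsilon> / (c + 1)" by (simp add: r_def)
  then have "r * (c + 1) \<le> \<epsilon>" using c by (simp add: field_simps)
  moreover have "r * c \<le> r * (c + 1)" using r by (intro mult_left_mono) auto
  ultimately have rc: "c * r \<le> \<epsilon>" by (simp add: mult.commute)
  have rt: "likely M (\<lambda>n \<omega>. \<exists>l. (\<mu>n n \<omega>, l, P0) \<in> cball \<alpha>0 r \<and> fst (Gn n \<omega> (\<mu>n n \<omega>, l, P0)) = 0)"
    by (intro likely_estimator_root[where Pn = "\<lambda>_ _. P0"] r(1) crit) (simp add: likely_AE)
  have E2: "likely M (\<lambda>n \<omega>. norm (emean n (\<lambda>i. g (Y i \<omega>))) \<le> \<delta>)"
    using weak_law[OF gi delta] g0 by simp
  have E3: "likely M (\<lambda>n \<omega>. norm (emean n (\<lambda>i. ln (1 + l1 \<bullet> m (Y i \<omega>) \<mu>1 P0)) - (\<integral>y. ln (1 + l1 \<bullet> m y \<mu>1 P0) \<partial>F)) \<le> \<epsilon>)"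
    by (rule weak_law[OF lni eps])
  have E4: "likely M (\<lambda>n \<omega>. \<forall>i. \<not> 1 + l1 \<bullet> m (Y i \<omega>) \<mu>1 P0 \<le> 0)"
    by (rule likely_AE) (use AE_Y[OF gpos] in simp)
  have E9: "likely M (\<lambda>n \<omega>. norm (emean n (\<lambda>i. ln (1 + l0 \<bullet> m (Y i \<omega>) \<mu>0 P0)) - (\<integral>y. ln (1 + l0 \<bullet> m y \<mu>0 P0) \<partial>F)) \<le> \<epsilon>)"
    by (rule weak_law[OF ln_integrable[OF alpha0_in] eps])
  have n1: "likely M (\<lambda>n \<omega>. 1 \<le> n)" by (rule likely_eventually[OF eventually_ge_at_top])
  \<comment> \<open>The profile values to be compared are numbers, so one sample point with all
    these properties decides the inequality up to \<open>4 * \<epsilon>\<close>.\<close>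
  from likely_nonempty[OF likely_conj[OF likely_conj[OF likely_conj[OF kappa(2) E2] likely_conj[OF E3 E4]]
     likely_conj[OF likely_conj[OF E9 mel] likely_conj[OF likely_conj[OF rt likely_good] likely_conj[OF likely_Q n1]]]]]
  obtain n \<omega> where w1: "\<forall>d. \<kappa> * norm d \<le> emean n (\<lambda>i. \<bar>d \<bullet> g (Y i \<omega>)\<bar>)"
    and w2: "norm (emean n (\<lambda>i. g (Y i \<omega>))) \<le> \<delta>"
    and w3: "norm (emean n (\<lambda>i. ln (1 + l1 \<bullet> m (Y i \<omega>) \<mu>1 P0)) - (\<integral>y. ln (1 + l1 \<bullet> m y \<mu>1 P0) \<partial>F)) \<le> \<epsilon>"
    and w4: "\<forall>i. \<not> 1 + l1 \<bullet> m (Y i \<omega>) \<mu>1 P0 \<le> 0"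
    and w5: "norm (emean n (\<lambda>i. ln (1 + l0 \<bullet> m (Y i \<omega>) \<mu>0 P0)) - (\<integral>y. ln (1 + l0 \<bullet> m y \<mu>0 P0) \<partial>F)) \<le> \<epsilon>"
    and w6: "is_MEL \<Theta> (\<lambda>\<mu>. emp_lik n (\<lambda>i. m (Y i \<omega>) \<mu> P0)) (\<mu>n n \<omega>)"
    and w7: "\<exists>l. (\<mu>n n \<omega>, l, P0) \<in> cball \<alpha>0 r \<and> fst (Gn n \<omega> (\<mu>n n \<omega>, l, P0)) = 0"
    and w8: "\<forall>i. el_good m h B L (Q (Y i \<omega>)) (Y i \<omega>)"
    and w9: "emean n (\<lambda>i. Q (Y i \<omega>)) \<le> EQ + 1" and n: "1 \<le> n"
    unfolding eventually_sequentially by blast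
  define v where "v i = m (Y i \<omega>) \<mu>1 P0" for i
  define \<mu> where "\<mu> = \<mu>n n \<omega>"
  have low: "emp_lik n v > 0"
    "ln (emp_lik n v) \<ge> - real n * ln (real n) - real n * (emean n (\<lambda>i. ln (1 + l1 \<bullet> v i))
       + 4 / \<kappa> * norm (emean n (\<lambda>i. v i /\<^sub>R (1 + l1 \<bullet> v i))))"
  proof -
    have pos: "\<And>i. i < n \<Longrightarrow> 1 + l1 \<bullet> v i > 0" using w4 by (simp add: v_def not_le)
    have small: "norm (emean n (\<lambda>i. v i /\<^sub>R (1 + l1 \<bullet> v i))) \<le> \<kappa>/16"
      using w2 by (simp add: g_def v_def \<delta>_def)
    have nondeg: "\<And>d. emean n (\<lambda>i. \<bar>d \<bullet> (v i /\<^sub>R (1 + l1 \<bullet> v i))\<bar>) \<ge> \<kappa> * norm d"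
      using w1 unfolding g_def v_def by blast
    show "emp_lik n v > 0"
      by (rule emp_lik_lower(1)[OF n pos kappa(1) nondeg small])
    show "ln (emp_lik n v) \<ge> - real n * ln (real n) - real n * (emean n (\<lambda>i. ln (1 + l1 \<bullet> v i))
       + 4 / \<kappa> * norm (emean n (\<lambda>i. v i /\<^sub>R (1 + l1 \<bullet> v i))))"
      by (rule emp_lik_lower(2)[OF n pos kappa(1) nondeg small])
  qed
  have "4 / \<kappa> * norm (emean n (\<lambda>i. v i /\<^sub>R (1 + l1 \<bullet> v i))) \<le> 4 / \<kappa> * (\<epsilon> * \<kappa> / 4)"
    using w2 kappa(1) by (intro mult_left_mono) (auto simp: g_def v_def \<delta>_def)
  also have "\<dots> = \<epsilon>" using kappa(1) by simp
  finally have "emean n (\<lambda>i. ln (1 + l1 \<bullet> v i)) + 4 / \<kappa> * norm (emean n (\<lambda>i. v i /\<^sub>R (1 + l1 \<bullet> v i)))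
      \<le> - profile F m lam P0 \<mu>1 + 2 * \<epsilon>"
    using w3 unfolding real_norm_def v_def profile_def l1_def by linarith
  from mult_left_mono[OF this, of "real n"] low(2)
  have A: "ln (emp_lik n v) \<ge> - real n * ln (real n) - real n * (- profile F m lam P0 \<mu>1 + 2 * \<epsilon>)" by simp
  obtain l where l: "(\<mu>, l, P0) \<in> cball \<alpha>0 r" using w7 by (auto simp: \<mu>_def)
  have dmu: "norm (\<mu> - \<mu>0) \<le> r"
    using l norm_fst_le[of "\<mu>0 - \<mu>" "(l0 - l, 0::real^'r)"] by (auto simp: dist_norm norm_minus_commute)
  have muB: "(\<mu>, l0, P0) \<in> B"
    using dmu r(2) by (auto simp: dist_Pair_Pair dist_norm norm_minus_commute)
  have pos: "\<And>i. i < n \<Longrightarrow> 1 + l0 \<bullet> m (Y i \<omega>) \<mu> P0 > 0"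
    using goodD(4)[OF _ muB] w8 by blast
  have le: "emp_lik n v \<le> emp_lik n (\<lambda>i. m (Y i \<omega>) \<mu> P0)"
    using w6 mu1 unfolding is_MEL_def v_def \<mu>_def by blast
  with low(1) have pos2: "emp_lik n (\<lambda>i. m (Y i \<omega>) \<mu> P0) > 0" by linarith
  have "ln (emp_lik n v) \<le> ln (emp_lik n (\<lambda>i. m (Y i \<omega>) \<mu> P0))" using le low(1) by simp
  \<comment> \<open>Weak duality holds for every admissible multiplier, so \<open>l0\<close> can
    stand in for the multiplier of the sample, and only the displacement of \<mu> has to be
    estimated.\<close>
  also have "\<dots> \<le> - real n * ln (real n) - (\<Sum>i<n. ln (1 + l0 \<bullet> m (Y i \<omega>) \<mu> P0))"
    using ln_emp_lik_le[of n l0 "\<lambda>i. m (Y i \<omega>) \<mu> P0"] n pos pos2 by blast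
  also have "(\<Sum>i<n. ln (1 + l0 \<bullet> m (Y i \<omega>) \<mu> P0)) = real n * emean n (\<lambda>i. ln (1 + l0 \<bullet> m (Y i \<omega>) \<mu> P0))"
    using n by (simp add: emean_def)
  finally have U: "ln (emp_lik n v) \<le> - real n * ln (real n) - real n * emean n (\<lambda>i. ln (1 + l0 \<bullet> m (Y i \<omega>) \<mu> P0))" .
  have "norm (emean n (\<lambda>i. ln (1 + l0 \<bullet> m (Y i \<omega>) \<mu> P0)) - emean n (\<lambda>i. ln (1 + l0 \<bullet> m (Y i \<omega>) \<mu>0 P0)))
      \<le> emean n (\<lambda>i. Q (Y i \<omega>)) * (norm l0 / L * norm (\<mu> - \<mu>0))"
  proof (rule norm_emean_diff_le)
    fix i
    show "norm (ln (1 + l0 \<bullet> m (Y i \<omega>) \<mu> P0) - ln (1 + l0 \<bullet> m (Y i \<omega>) \<mu>0 P0)) \<le>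
        Q (Y i \<omega>) * (norm l0 / L * norm (\<mu> - \<mu>0))"
      using ln_lip[OF _ muB alpha0_in, of "Y i \<omega>"] w8 by (simp add: mult_ac)
  qed
  also have "\<dots> \<le> (EQ + 1) * (norm l0 / L * r)"
    using w9 dmu L EQ_nonneg by (intro mult_mono mult_left_mono) auto
  also have "\<dots> = c * r" by (simp add: c_def)
  also have "\<dots> \<le> \<epsilon>" by (rule rc)
  finally have "emean n (\<lambda>i. ln (1 + l0 \<bullet> m (Y i \<omega>) \<mu> P0)) \<ge> (\<integral>y. ln (1 + l0 \<bullet> m y \<mu>0 P0) \<partial>F) - 2 * \<epsilon>"
    using w5 unfolding real_norm_def by linarith
  moreover have "lam \<mu>0 P0 = l0" by (rule lam[OF in_Theta[OF alpha0_in] root_solves_pop])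
  ultimately have "emean n (\<lambda>i. ln (1 + l0 \<bullet> m (Y i \<omega>) \<mu> P0)) \<ge> - profile F m lam P0 \<mu>0 - 2 * \<epsilon>"
    by (simp add: profile_def)
  from mult_left_mono[OF this, of "real n"] U A
  have "real n * (- profile F m lam P0 \<mu>0 - 2 * \<epsilon>) \<le> real n * (- profile F m lam P0 \<mu>1 + 2 * \<epsilon>)" by simp
  then have "- profile F m lam P0 \<mu>0 - 2 * \<epsilon> \<le> - profile F m lam P0 \<mu>1 + 2 * \<epsilon>" using n by simp
  then show "profile F m lam P0 \<mu>1 \<le> profile F m lam P0 \<mu>0 + e" by (simp add: \<epsilon>_def)
qed

lemma estimator_consistent:
  assumes P: "\<And>\<delta>. \<delta> > 0 \<Longrightarrow> likely M (\<lambda>n \<omega>. norm (Pn n \<omega> - P0) \<le> \<delta>)"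
    and crit: "likely M (\<lambda>n \<omega>. unique_log_critical \<Theta> (\<lambda>\<mu>. emp_lik n (\<lambda>i. m (Y i \<omega>) \<mu> (Pn n \<omega>))) (\<mu>n n \<omega>))"
    and r: "r > 0"
  shows "likely M (\<lambda>n \<omega>. norm (\<mu>n n \<omega> - \<mu>0) \<le> r)"
proof -
  have "likely M (\<lambda>n \<omega>. \<exists>l. (\<mu>n n \<omega>, l, Pn n \<omega>) \<in> cball \<alpha>0 r \<and> fst (Gn n \<omega> (\<mu>n n \<omega>, l, Pn n \<omega>)) = 0)"
    by (intro likely_estimator_root P r crit)
  then show ?thesis
  proof (rule likely_mono', elim exE conjE)
    fix n \<omega> l assume "(\<mu>n n \<omega>, l, Pn n \<omega>) \<in> cball \<alpha>0 r"
    then show "norm (\<mu>n n \<omega> - \<mu>0) \<le> r"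
      using norm_fst_le[of "\<mu>0 - \<mu>n n \<omega>" "(l0 - l, P0 - Pn n \<omega>)"] by (auto simp: dist_norm norm_minus_commute)
  qed
qed

lemma estimator_expansion:
  assumes P: "\<And>\<delta>. \<delta> > 0 \<Longrightarrow> likely M (\<lambda>n \<omega>. norm (Pn n \<omega> - P0) \<le> \<delta>)"
    and crit: "likely M (\<lambda>n \<omega>. unique_log_critical \<Theta> (\<lambda>\<mu>. emp_lik n (\<lambda>i. m (Y i \<omega>) \<mu> (Pn n \<omega>))) (\<mu>n n \<omega>))"
    and crit0: "likely M (\<lambda>n \<omega>. unique_log_critical \<Theta> (\<lambda>\<mu>. emp_lik n (\<lambda>i. m (Y i \<omega>) \<mu> P0)) (\<nu>n n \<omega>))"
    and heq: "\<And>\<delta>. \<delta> > 0 \<Longrightarrow> likely M (\<lambda>n \<omega>. norm (emean n (\<lambda>i. h (Y i \<omega>) (Pn n \<omega>))) \<le> \<delta> * (1 / sqrt (real n)))"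
    and e: "e > 0" and eta: "\<eta> > 0"
  shows "\<forall>\<^sub>F n in sequentially. prob_ge M (1 - \<eta>)
    (\<lambda>\<omega>. norm (\<mu>n n \<omega> - (\<nu>n n \<omega> + T (Pn n \<omega> - P0))) \<le> e * (1 / sqrt (real n)))"
proof -
  \<comment> \<open>The tightness constant depends on \<open>\<eta>\<close> and enters
    \<open>C\<close>, so \<open>\<epsilon>\<close> can only be chosen after both.\<close>
  obtain K where K: "K \<ge> 1"
    "\<And>n. n \<ge> 1 \<Longrightarrow> prob_ge M (1 - \<eta>/2) (\<lambda>\<omega>. norm (Gn n \<omega> \<alpha>0) \<le> K * (1 / sqrt (real n)))"
    by (rule Gn_tight[OF half_gt_zero[OF eta]]) (rule that)
  define C where "C = b * (2 * (2 * (2 * b * (2 * K + 1)) + 1))"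
  have "2 * b * (2 * K + 1) \<ge> 0" using b_pos K(1) by simp
  then have C: "C > 0" unfolding C_def using b_pos by (intro mult_pos_pos) auto
  \<comment> \<open>The bounds serve, in turn, the comparison with \<open>K\<close>, the absorption
    of relative errors in the root expansion, and the final error \<open>e\<close>.\<close>
  define \<epsilon> where "\<epsilon> = min (min 1 (1 / (4 * b))) (e / C)"
  have eps: "\<epsilon> > 0" "\<epsilon> \<le> 1" using b_pos C e by (auto simp: \<epsilon>_def)
  have eps4: "4 * b * \<epsilon> \<le> 1"
  proof -
    have "\<epsilon> \<le> 1 / (4 * b)" by (simp add: \<epsilon>_def)
    then show ?thesis using b_pos by (simp add: field_simps)
  qed
  have epsC: "\<epsilon> * C \<le> e"
  proof -
    have "\<epsilon> \<le> e / C" by (simp add: \<epsilon>_def)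
    then show ?thesis using C by (simp add: field_simps)
  qed
  obtain d where d: "d > 0" "\<And>a. norm (a - \<alpha>0) < d \<Longrightarrow> norm (G a - D (a - \<alpha>0)) \<le> \<epsilon> * norm (a - \<alpha>0)"
    using G_alt[OF eps(1)] by blast
  define R where "R = min \<rho> (d/2)"
  have R: "R > 0" "R \<le> \<rho>" "R < d" using rho d(1) by (auto simp: R_def)
  have lin: "norm (G a - D (a - \<alpha>0)) \<le> \<epsilon> * norm (a - \<alpha>0)" if "a \<in> cball \<alpha>0 R" for a
    using that R(3) by (intro d(2)) (auto simp: dist_norm norm_minus_commute)
  have sub: "cball \<alpha>0 R \<subseteq> B" using R(2) by (rule subset_cball)
  have r1: "likely M (\<lambda>n \<omega>. \<exists>l. (\<mu>n n \<omega>, l, Pn n \<omega>) \<in> cball \<alpha>0 R \<and> fst (Gn n \<omega> (\<mu>n n \<omega>, l, Pn n \<omega>)) = 0)"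
    by (intro likely_estimator_root P R(1) crit)
  have r2: "likely M (\<lambda>n \<omega>. \<exists>l. (\<nu>n n \<omega>, l, P0) \<in> cball \<alpha>0 R \<and> fst (Gn n \<omega> (\<nu>n n \<omega>, l, P0)) = 0)"
    by (intro likely_estimator_root[where Pn = "\<lambda>_ _. P0"] R(1) crit0) (simp add: likely_AE)
  from likely_conj[OF likely_conj[OF r1 r2] likely_conj[OF likely_modulus[OF eps(1)] heq[OF eps(1)]]] eta
  have "\<forall>\<^sub>F n in sequentially. prob_ge M (1 - \<eta>/2) (\<lambda>\<omega>.
     ((\<exists>l. (\<mu>n n \<omega>, l, Pn n \<omega>) \<in> cball \<alpha>0 R \<and> fst (Gn n \<omega> (\<mu>n n \<omega>, l, Pn n \<omega>)) = 0) \<and>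
      (\<exists>l. (\<nu>n n \<omega>, l, P0) \<in> cball \<alpha>0 R \<and> fst (Gn n \<omega> (\<nu>n n \<omega>, l, P0)) = 0)) \<and>
     (\<forall>a\<in>B. norm (Gn n \<omega> a - Gn n \<omega> \<alpha>0 - G a) \<le> \<epsilon> * max (dist a \<alpha>0) (1 / sqrt (real n))) \<and>
     norm (emean n (\<lambda>i. h (Y i \<omega>) (Pn n \<omega>))) \<le> \<epsilon> * (1 / sqrt (real n)))"
    unfolding likely_def by (meson half_gt_zero)
  then show ?thesis using eventually_ge_at_top[of 1]
  proof eventually_elim
    case (elim n)
    have s: "1 / sqrt (real n) > 0" using elim(2) by simp
    from prob_ge_conj[OF elim(1) K(2)[OF elim(2)]]
    show ?case
    proof (rule prob_ge_mono, elim conjE exE)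
      fix \<omega> l l'
      assume a: "(\<mu>n n \<omega>, l, Pn n \<omega>) \<in> cball \<alpha>0 R" "fst (Gn n \<omega> (\<mu>n n \<omega>, l, Pn n \<omega>)) = 0"
        and c: "(\<nu>n n \<omega>, l', P0) \<in> cball \<alpha>0 R" "fst (Gn n \<omega> (\<nu>n n \<omega>, l', P0)) = 0"
        and md: "\<forall>a\<in>B. norm (Gn n \<omega> a - Gn n \<omega> \<alpha>0 - G a) \<le> \<epsilon> * max (dist a \<alpha>0) (1 / sqrt (real n))"
        and hh: "norm (emean n (\<lambda>i. h (Y i \<omega>) (Pn n \<omega>))) \<le> \<epsilon> * (1 / sqrt (real n))"
        and g0: "norm (Gn n \<omega> \<alpha>0) \<le> K * (1 / sqrt (real n))"
      have md': "norm (Gn n \<omega> a - Gn n \<omega> \<alpha>0 - G a) \<le> \<epsilon> * max (dist a \<alpha>0) (1 / sqrt (real n))"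
        if "a \<in> cball \<alpha>0 R" for a using md sub that by blast
      have "\<epsilon> * (1 / sqrt (real n)) \<le> K * (1 / sqrt (real n))"
        using s eps K(1) by (intro mult_right_mono) auto
      then have sa: "norm (snd (Gn n \<omega> (\<mu>n n \<omega>, l, Pn n \<omega>))) \<le> K * (1 / sqrt (real n))"
        unfolding snd_Gn using hh by simp
      have sc: "snd (Gn n \<omega> (\<nu>n n \<omega>, l', P0)) = snd (Gn n \<omega> \<alpha>0)" by (simp add: snd_Gn)
      have "norm (\<mu>n n \<omega> - (\<nu>n n \<omega> + T (Pn n \<omega> - P0))) \<le> \<epsilon> * C * (1 / sqrt (real n))"
        using root_difference[OF lin md' g0 a sa c sc eps(1) eps4 eps(2) s]
        by (simp add: C_def diff_diff_eq)
      also have "\<dots> \<le> e * (1 / sqrt (real n))" using epsC s by (intro mult_right_mono) auto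
      finally show "norm (\<mu>n n \<omega> - (\<nu>n n \<omega> + T (Pn n \<omega> - P0))) \<le> e * (1 / sqrt (real n))" .
    qed simp
  qed
qed

end

section \<open>Regularity from bounded partial derivatives\<close>

lemma has_partial_line:
  assumes "has_partial f e (x + t *\<^sub>R e)"
  shows "((\<lambda>s. f (x + s *\<^sub>R e)) has_vector_derivative partial f e (x + t *\<^sub>R e)) (at t)"
proof -
  let ?g = "\<lambda>s::real. f (x + t *\<^sub>R e + s *\<^sub>R e)"
  have "(?g has_vector_derivative partial f e (x + t *\<^sub>R e)) (at 0)"
    using assms unfolding has_partial_def partial_def by (simp add: vector_derivative_works)
  then have "(?g has_vector_derivative partial f e (x + t *\<^sub>R e)) (at (t - t))" by simp
  moreover have "((\<lambda>s. s - t) has_real_derivative 1) (at t)" by (auto intro!: derivative_eq_intros)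
  ultimately have "(?g \<circ> (\<lambda>s. s - t) has_vector_derivative (1 *\<^sub>R partial f e (x + t *\<^sub>R e))) (at t)"
    by (intro vector_diff_chain_at) (auto simp: has_real_derivative_iff_has_vector_derivative)
  moreover have "?g \<circ> (\<lambda>s. s - t) = (\<lambda>s. f (x + s *\<^sub>R e))"
    by (simp add: fun_eq_iff algebra_simps)
  ultimately show ?thesis by simp
qed

text \<open>Existence and boundedness of partial derivatives need not give differentiability, so the
  mean value inequality is applied along one coordinate at a time. The corners of this path can
  leave the ball of radius \<open>\<rho>\<close>: each is within \<open>\<rho>\<close> plus the sum
  of the coordinate steps, at most \<open>2 * \<rho>\<close> times the dimension, which explains the
  larger radius \<open>R\<close>.\<close>

lemma partials_lipschitz:
  fixes f :: "'a::euclidean_space \<Rightarrow> 'b::real_normed_vector"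
  assumes part: "\<And>z e. z \<in> ball x0 R \<Longrightarrow> e \<in> Basis \<Longrightarrow> has_partial f e z \<and> norm (partial f e z) \<le> K"
    and R: "(1 + 2 * real (DIM('a))) * \<rho> < R" and x: "x \<in> cball x0 \<rho>" and y: "y \<in> cball x0 \<rho>"
  shows "norm (f x - f y) \<le> K * real (DIM('a)) * dist x y"
proof -
  define c where "c e = (y - x) \<bullet> e" for e
  define Z where "Z S = x + (\<Sum>e\<in>S. c e *\<^sub>R e)" for S
  have rho: "\<rho> \<ge> 0" using x by (auto intro: order_trans[OF zero_le_dist])
  have dxy: "norm (y - x) \<le> 2 * \<rho>"
    using x y norm_triangle_ineq4[of "y - x0" "x - x0"] by (simp add: dist_norm norm_minus_commute)
  have csum: "(\<Sum>e\<in>S. \<bar>c e\<bar>) \<le> real (DIM('a)) * norm (y - x)" if "S \<subseteq> Basis" for S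
  proof -
    have "(\<Sum>e\<in>S. \<bar>c e\<bar>) \<le> (\<Sum>e\<in>(Basis::'a set). \<bar>c e\<bar>)"
      using that by (intro sum_mono2) auto
    also have "\<dots> \<le> (\<Sum>e\<in>(Basis::'a set). norm (y - x))"
      by (intro sum_mono) (auto simp: c_def intro: Basis_le_norm)
    finally show ?thesis by simp
  qed
  have "(1 + 2 * real (DIM('a))) * \<rho> \<ge> 0" using rho by simp
  then have R0: "R > 0" using R by linarith
  have K: "K \<ge> 0"
  proof -
    obtain e :: 'a where "e \<in> Basis" using nonempty_Basis by blast
    then have "norm (partial f e x0) \<le> K" using part[of x0 e] R0 by simp
    then show ?thesis using norm_ge_zero order_trans by blast
  qed
  have key: "norm (f (Z S) - f x) \<le> K * (\<Sum>e\<in>S. \<bar>c e\<bar>)" if "finite S" "S \<subseteq> Basis" for S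
    using that
  proof (induction S rule: finite_induct)
    case empty
    then show ?case by (simp add: Z_def)
  next
    case (insert e S)
    have e: "e \<in> Basis" and S: "S \<subseteq> Basis" using insert by auto
    have Zi: "Z (insert e S) = Z S + c e *\<^sub>R e" using insert by (simp add: Z_def algebra_simps)
    have inb: "Z S + t *\<^sub>R e \<in> ball x0 R" if t: "\<bar>t\<bar> \<le> \<bar>c e\<bar>" for t
    proof -
      have "norm (Z S + t *\<^sub>R e - x0) \<le> norm (x - x0) + norm ((\<Sum>e\<in>S. c e *\<^sub>R e) + t *\<^sub>R e)"
        using norm_triangle_ineq[of "x - x0" "(\<Sum>e\<in>S. c e *\<^sub>R e) + t *\<^sub>R e"] by (simp add: Z_def algebra_simps)
      also have "norm ((\<Sum>e\<in>S. c e *\<^sub>R e) + t *\<^sub>R e) \<le> norm (\<Sum>e\<in>S. c e *\<^sub>R e) + norm (t *\<^sub>R e)"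
        by (rule norm_triangle_ineq)
      also have "norm (\<Sum>e\<in>S. c e *\<^sub>R e) \<le> (\<Sum>e\<in>S. \<bar>c e\<bar>)"
        by (rule order_trans[OF norm_sum sum_mono]) (use S in auto)
      also have "norm (t *\<^sub>R e) \<le> \<bar>c e\<bar>" using t e by simp
      also have "(\<Sum>e\<in>S. \<bar>c e\<bar>) + \<bar>c e\<bar> = (\<Sum>e\<in>insert e S. \<bar>c e\<bar>)" using insert by simp
      also have "\<dots> \<le> real (DIM('a)) * norm (y - x)" using e S by (intro csum) auto
      also have "\<dots> \<le> real (DIM('a)) * (2 * \<rho>)" using dxy by (intro mult_left_mono) auto
      also have "norm (x - x0) \<le> \<rho>" using x by (simp add: dist_norm norm_minus_commute)
      finally have "norm (Z S + t *\<^sub>R e - x0) < R" using R by (simp add: algebra_simps)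
      then show ?thesis by (simp add: dist_norm norm_minus_commute)
    qed
    have "norm (f (Z S + c e *\<^sub>R e) - f (Z S + 0 *\<^sub>R e)) \<le> K * norm (c e - 0)"
    proof (rule differentiable_bound[where S = "closed_segment 0 (c e)" and f' = "\<lambda>t s. s *\<^sub>R partial f e (Z S + t *\<^sub>R e)"])
      fix t assume "t \<in> closed_segment 0 (c e)"
      then have "\<bar>t\<bar> \<le> \<bar>c e\<bar>" by (auto simp: closed_segment_eq_real_ivl split: if_splits)
      from part[OF inb[OF this] e]
      have "((\<lambda>t. f (Z S + t *\<^sub>R e)) has_vector_derivative partial f e (Z S + t *\<^sub>R e)) (at t within closed_segment 0 (c e))"
        and n: "norm (partial f e (Z S + t *\<^sub>R e)) \<le> K"
        by (auto intro: has_vector_derivative_at_within has_partial_line)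
      then show "((\<lambda>t. f (Z S + t *\<^sub>R e)) has_derivative (\<lambda>s. s *\<^sub>R partial f e (Z S + t *\<^sub>R e))) (at t within closed_segment 0 (c e))"
        by (simp add: has_vector_derivative_def)
      show "onorm (\<lambda>s. s *\<^sub>R partial f e (Z S + t *\<^sub>R e)) \<le> K"
        by (rule onorm_le) (use n in \<open>simp add: mult.commute[of K] mult_left_mono\<close>)
    qed auto
    then have "norm (f (Z (insert e S)) - f (Z S)) \<le> K * \<bar>c e\<bar>" by (simp add: Zi)
    then have "norm (f (Z (insert e S)) - f x) \<le> K * \<bar>c e\<bar> + K * (\<Sum>e\<in>S. \<bar>c e\<bar>)"
      using norm_triangle_ineq[of "f (Z (insert e S)) - f (Z S)" "f (Z S) - f x"] insert.IH[OF S] by simp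
    then show ?case using insert by (simp add: algebra_simps)
  qed
  have "Z Basis = y" by (simp add: Z_def c_def euclidean_representation)
  then have "norm (f x - f y) \<le> K * (\<Sum>e\<in>Basis. \<bar>c e\<bar>)" using key[of Basis] by (simp add: norm_minus_commute)
  also have "\<dots> \<le> K * (real (DIM('a)) * norm (y - x))" using K csum[of Basis] by (intro mult_left_mono) auto
  finally show ?thesis by (simp add: dist_norm norm_minus_commute mult.assoc)
qed

section \<open>Lipschitz bounds for the quotients that make up \<psi>\<close>

lemma norm_quotient_diff:
  fixes u u' :: "'a::real_normed_vector"
  assumes L: "L > 0" "L \<le> s" "L \<le> s'"
  shows "norm (u /\<^sub>R s - u' /\<^sub>R s') \<le> norm (u - u') / L + norm u' * \<bar>s - s'\<bar> / L\<^sup>2"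
proof -
  have s: "s > 0" "s' > 0" using L by auto
  have "(s' - s) / (s * s') = inverse s - inverse s'" using s by (simp add: field_simps)
  then have "u /\<^sub>R s - u' /\<^sub>R s' = (u - u') /\<^sub>R s + ((s' - s) / (s * s')) *\<^sub>R u'"
    by (simp add: scaleR_diff_right scaleR_diff_left)
  also have "norm \<dots> \<le> norm ((u - u') /\<^sub>R s) + norm (((s' - s) / (s * s')) *\<^sub>R u')"
    by (rule norm_triangle_ineq)
  also have "norm ((u - u') /\<^sub>R s) \<le> norm (u - u') / L"
  proof -
    have "norm ((u - u') /\<^sub>R s) = norm (u - u') / s"
      using s unfolding norm_scaleR by (simp add: divide_inverse mult.commute)
    also have "\<dots> \<le> norm (u - u') / L" using L by (intro frac_le) auto
    finally show ?thesis .
  qed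
  also have "norm (((s' - s) / (s * s')) *\<^sub>R u') = norm u' * \<bar>s - s'\<bar> / (s * s')"
    using s by (simp add: abs_mult abs_minus_commute)
  also have "\<dots> \<le> norm u' * \<bar>s - s'\<bar> / L\<^sup>2"
    using L s unfolding power2_eq_square by (intro divide_left_mono mult_mono) auto
  finally show ?thesis by simp
qed

lemma has_derivative_partial:
  assumes "(f has_derivative f') (at x)"
  shows "has_partial f e x" "partial f e x = f' e"
proof -
  have "((\<lambda>t::real. x + t *\<^sub>R e) has_derivative (\<lambda>t. t *\<^sub>R e)) (at 0)"
    by (auto intro!: derivative_eq_intros)
  moreover have "(f has_derivative f') (at (x + 0 *\<^sub>R e))" using assms by simp
  ultimately have "((\<lambda>t. f (x + t *\<^sub>R e)) has_derivative (\<lambda>t. f' (t *\<^sub>R e))) (at 0)"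
    by (rule has_derivative_compose)
  moreover have "(\<lambda>t. f' (t *\<^sub>R e)) = (\<lambda>t. t *\<^sub>R f' e)"
    using linear_scale[OF has_derivative_linear[OF assms]] by simp
  ultimately have *: "((\<lambda>t. f (x + t *\<^sub>R e)) has_vector_derivative f' e) (at 0)"
    by (simp add: has_vector_derivative_def)
  show "has_partial f e x" unfolding has_partial_def using * by (rule differentiableI_vector)
  show "partial f e x = f' e" unfolding partial_def using * by (rule vector_derivative_at)
qed

lemma jacobian_slice:
  fixes g :: "real^'s \<Rightarrow> real^'r \<Rightarrow> real^'q"
  assumes "(\<lambda>(\<mu>, P). g \<mu> P) differentiable (at (\<mu>, P))"
  shows "((\<lambda>\<mu>'. g \<mu>' P) has_derivative (\<lambda>e. jacobian (\<lambda>\<mu>'. g \<mu>' P) (at \<mu>) *v e)) (at \<mu>)"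
    and "jacobian (\<lambda>\<mu>'. g \<mu>' P) (at \<mu>) *v e = partial (\<lambda>(\<mu>, P). g \<mu> P) (e, 0) (\<mu>, P)"
proof -
  obtain f' where f': "((\<lambda>(\<mu>, P). g \<mu> P) has_derivative f') (at (\<mu>, P))"
    using assms by (auto simp: differentiable_def)
  have "((\<lambda>\<mu>'. (\<mu>', P)) has_derivative (\<lambda>e. (e, 0))) (at \<mu>)"
    by (intro has_derivative_Pair has_derivative_ident has_derivative_const)
  from has_derivative_compose[OF this f']
  have *: "((\<lambda>\<mu>'. g \<mu>' P) has_derivative (\<lambda>e. f' (e, 0))) (at \<mu>)" by simp
  then show d: "((\<lambda>\<mu>'. g \<mu>' P) has_derivative (\<lambda>e. jacobian (\<lambda>\<mu>'. g \<mu>' P) (at \<mu>) *v e)) (at \<mu>)"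
    unfolding jacobian_works[symmetric] by (auto simp: differentiable_def)
  from has_derivative_unique[OF d *]
  show "jacobian (\<lambda>\<mu>'. g \<mu>' P) (at \<mu>) *v e = partial (\<lambda>(\<mu>, P). g \<mu> P) (e, 0) (\<mu>, P)"
    using has_derivative_partial(2)[OF f'] by (simp add: fun_eq_iff)
qed

lemma vector_matrix_component:
  fixes l :: "real^'q" and A :: "real^'s^'q"
  shows "(l v* A) $ j = l \<bullet> (A *v axis j 1)"
  by (simp add: dot_lmul_matrix[symmetric] inner_axis)

text \<open>The constant collects the coefficients of \<open>p0^2\<close>, \<open>p0 p1\<close>, \<open>p1^2\<close>, \<open>p2\<close>, ... in the Lipschitz
  bounds; it depends on the multiplier through a bound \<open>\<Lambda>\<close> only.\<close>

lemma el_goodI: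
  fixes m :: "'y \<Rightarrow> real^'s \<Rightarrow> real^'r \<Rightarrow> real^'q" and h :: "'y \<Rightarrow> real^'r \<Rightarrow> real^'r"
  defines "d \<equiv> real (DIM((real^'s) \<times> (real^'r)))"
  defines "dr \<equiv> real (DIM(real^'r))"
  assumes rho: "\<rho> > 0" and R: "(1 + 2 * d) * \<rho> < R" "(1 + 2 * dr) * \<rho> < R"
    and diff: "\<And>\<mu> l P. (\<mu>, l, P) \<in> ball (\<mu>0, l0, P0) R \<Longrightarrow> (\<lambda>(\<mu>, P). m y \<mu> P) differentiable (at (\<mu>, P))"
    and p0: "\<And>\<mu> l P. (\<mu>, l, P) \<in> ball (\<mu>0, l0, P0) R \<Longrightarrow> norm (m y \<mu> P) \<le> p0"
    and p1: "\<And>\<mu> l P e. (\<mu>, l, P) \<in> ball (\<mu>0, l0, P0) R \<Longrightarrow> e \<in> Basis \<Longrightarrow>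
        norm (partial (\<lambda>(\<mu>, P). m y \<mu> P) e (\<mu>, P)) \<le> p1"
    and p2: "\<And>\<mu> l P e c. (\<mu>, l, P) \<in> ball (\<mu>0, l0, P0) R \<Longrightarrow> e \<in> Basis \<Longrightarrow> c \<in> Basis \<Longrightarrow>
        has_partial (partial (\<lambda>(\<mu>, P). m y \<mu> P) e) c (\<mu>, P) \<and>
        norm (partial (partial (\<lambda>(\<mu>, P). m y \<mu> P) e) c (\<mu>, P)) \<le> p2"
    and q1: "\<And>\<mu> l P. (\<mu>, l, P) \<in> ball (\<mu>0, l0, P0) R \<Longrightarrow> norm (h y P) \<le> q1"
    and q2: "\<And>\<mu> l P e. (\<mu>, l, P) \<in> ball (\<mu>0, l0, P0) R \<Longrightarrow> e \<in> Basis \<Longrightarrow>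
        has_partial (h y) e P \<and> norm (partial (h y) e P) \<le> q2"
    and L: "L > 0" and pos: "\<And>\<mu> l P. (\<mu>, l, P) \<in> cball (\<mu>0, l0, P0) \<rho> \<Longrightarrow> L \<le> 1 + l \<bullet> m y \<mu> P"
    and \<Lambda>: "\<Lambda> = norm l0 + \<rho>" and k: "k = 1 + \<Lambda> * d"
    and C: "C = (1/L + d/L + k/L\<^sup>2) + real CARD('s) * (\<Lambda>/L + k/L + \<Lambda>*k/L\<^sup>2) + (1 + dr) + d + 1"
  shows "el_good m h (cball (\<mu>0, l0, P0) \<rho>) L (C * (1 + p0\<^sup>2 + p1\<^sup>2 + p2 + q1 + q2)) y"
proof -
  let ?B = "cball (\<mu>0, l0, P0) \<rho>"
  let ?mm = "\<lambda>(\<mu>, P). m y \<mu> P"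
  define W where "W = 1 + p0\<^sup>2 + p1\<^sup>2 + p2 + q1 + q2"
  have d0: "d \<ge> 0" "dr \<ge> 0" by (auto simp: d_def dr_def)
  have "\<rho> \<le> (1 + 2 * d) * \<rho>" using rho d0 by (simp add: algebra_simps)
  then have rR: "\<rho> < R" using R by simp
  have sub: "?B \<subseteq> ball (\<mu>0, l0, P0) R" using rR by auto
  have c0: "(\<mu>0, l0, P0) \<in> ball (\<mu>0, l0, P0) R" using rR rho by simp
  obtain e0 :: "(real^'s) \<times> (real^'r)" where e0: "e0 \<in> Basis" using nonempty_Basis by blast
  obtain e1 :: "real^'r" where e1: "e1 \<in> Basis" using nonempty_Basis by blast
  have nn: "p0 \<ge> 0" "p1 \<ge> 0" "p2 \<ge> 0" "q1 \<ge> 0" "q2 \<ge> 0"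
    using order_trans[OF norm_ge_zero p0[OF c0]] order_trans[OF norm_ge_zero p1[OF c0 e0]]
      order_trans[OF norm_ge_zero conjunct2[OF p2[OF c0 e0 e0]]] order_trans[OF norm_ge_zero q1[OF c0]]
      order_trans[OF norm_ge_zero conjunct2[OF q2[OF c0 e1]]] by auto
  have sq: "x \<le> 1 + x\<^sup>2" for x :: real
  proof -
    have "2 * x \<le> x\<^sup>2 + 1" using sum_squares_bound[of x 1] by simp
    then show ?thesis using zero_le_power2[of x] by linarith
  qed
  have "p0 * p1 \<le> p0\<^sup>2 + p1\<^sup>2"
    using sum_squares_bound[of p0 p1] mult_nonneg_nonneg[OF nn(1,2)] by linarith
  \<comment> \<open>Every monomial in the envelopes that arises from differentiating the quotients
    is dominated by the single sum \<open>W\<close>, the mixed product by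
    \<open>2 * x * y \<le> x\<^sup>2 + y\<^sup>2\<close>.\<close>
  then have Ws: "p0 \<le> W" "p1 \<le> W" "p0 * p0 \<le> W" "p0 * p1 \<le> W" "p1 * p1 \<le> W" "p2 \<le> W" "q1 \<le> W" "q2 \<le> W" "0 \<le> W"
    using nn sq[of p0] sq[of p1] zero_le_power2[of p0] zero_le_power2[of p1]
    unfolding W_def power2_eq_square[symmetric] by linarith+
  have Lam: "\<Lambda> \<ge> 0" using rho by (simp add: \<Lambda>)
  have k0: "k \<ge> 0" using Lam d0 by (simp add: k)
  \<comment> \<open>The bounds are stated for triples, whereas \<open>m\<close> depends on two
    components; freezing the multiplier at \<open>l0\<close> keeps such a triple in the
    ball.\<close>
  have comp: "(fst x, l0, snd x) \<in> ball (\<mu>0, l0, P0) R" if "x \<in> ball (\<mu>0, P0) R" for x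
    using that by (cases x) (auto simp: dist_Pair_Pair)
  have pB: "(\<mu>, P) \<in> cball (\<mu>0, P0) \<rho>" if "(\<mu>, l, P) \<in> ?B" for \<mu> l P
  proof -
    have "dist (\<mu>0, P0) (\<mu>, P) \<le> dist (\<mu>0, l0, P0) (\<mu>, l, P)"
      unfolding dist_Pair_Pair by (intro real_sqrt_le_mono) simp
    then show ?thesis using that by simp
  qed
  have dp: "dist (\<mu>, P) (\<mu>', P') \<le> dist (\<mu>, l, P) (\<mu>', l', P')" for \<mu> \<mu>' :: "real^'s" and l l' :: "real^'q" and P P' :: "real^'r"
    unfolding dist_Pair_Pair by (intro real_sqrt_le_mono) simp
  have m_lip: "norm (?mm x - ?mm x') \<le> p1 * d * dist x x'" if "x \<in> cball (\<mu>0, P0) \<rho>" "x' \<in> cball (\<mu>0, P0) \<rho>" for x x'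
    unfolding d_def
  proof (rule partials_lipschitz[OF _ R(1)[unfolded d_def] that])
    fix z e assume z: "z \<in> ball (\<mu>0, P0) R" "e \<in> (Basis :: ((real^'s) \<times> (real^'r)) set)"
    show "has_partial ?mm e z \<and> norm (partial ?mm e z) \<le> p1"
      using diff[OF comp[OF z(1)]] p1[OF comp[OF z(1)] z(2)] has_derivative_partial(1)[of ?mm _ z e]
      by (auto simp: differentiable_def)
  qed
  have m1_lip: "norm (partial ?mm e x - partial ?mm e x') \<le> p2 * d * dist x x'"
    if e: "e \<in> Basis" and x: "x \<in> cball (\<mu>0, P0) \<rho>" "x' \<in> cball (\<mu>0, P0) \<rho>" for e x x'
    unfolding d_def
  proof (rule partials_lipschitz[OF _ R(1)[unfolded d_def] x])
    fix z c assume z: "z \<in> ball (\<mu>0, P0) R" "c \<in> (Basis :: ((real^'s) \<times> (real^'r)) set)"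
    show "has_partial (partial ?mm e) c z \<and> norm (partial (partial ?mm e) c z) \<le> p2"
      using p2[OF comp[OF z(1)] e z(2)] by simp
  qed
  have h_lip: "norm (h y P - h y P') \<le> q2 * dr * dist P P'" if "P \<in> cball P0 \<rho>" "P' \<in> cball P0 \<rho>" for P P'
    unfolding dr_def
  proof (rule partials_lipschitz[OF _ R(2)[unfolded dr_def] that])
    fix z e assume z: "z \<in> ball P0 R" "e \<in> (Basis :: (real^'r) set)"
    have "(\<mu>0, l0, z) \<in> ball (\<mu>0, l0, P0) R" using z by (simp add: dist_Pair_Pair)
    from q2[OF this z(2)] show "has_partial (h y) e z \<and> norm (partial (h y) e z) \<le> q2" .
  qed
  define J where "J \<mu> P = jacobian (\<lambda>\<mu>'. m y \<mu>' P) (at \<mu>)" for \<mu> P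
  define \<phi> where "\<phi> j \<mu> P = partial ?mm (axis j 1, 0) (\<mu>, P)" for j \<mu> P
  have axis_B: "(axis j 1 :: real^'s, 0 :: real^'r) \<in> Basis" for j
    by (auto simp: Basis_prod_def axis_in_Basis_iff)
  have J\<phi>: "(l v* J \<mu> P) $ j = l \<bullet> \<phi> j \<mu> P" if "(\<mu>, l, P) \<in> ?B" for \<mu> l P j
    using jacobian_slice(2)[OF diff[OF subsetD[OF sub that]], of "axis j 1"]
    by (simp add: vector_matrix_component J_def \<phi>_def)
  have l_bd: "norm l \<le> \<Lambda>" if "(\<mu>, l, P) \<in> ?B" for \<mu> l P
  proof -
    have "norm (l0 - l) \<le> dist (\<mu>0, l0, P0) (\<mu>, l, P)"
      using order_trans[OF norm_fst_le[of "l0 - l" "P0 - P"] norm_snd_le[of "(l0 - l, P0 - P)" "\<mu>0 - \<mu>"]] by (simp add: dist_norm)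
    then show ?thesis using that norm_triangle_ineq4[of l0 "l0 - l"] by (simp add: \<Lambda>)
  qed
  have psi: "psi_EL m y (\<mu>, l, P) = (m y \<mu> P /\<^sub>R (1 + l \<bullet> m y \<mu> P), (l v* J \<mu> P) /\<^sub>R (1 + l \<bullet> m y \<mu> P))" for \<mu> l P
    by (simp add: psi_EL_def J_def)
  have m_bd: "norm (m y \<mu> P) \<le> p0" if "(\<mu>, l, P) \<in> ?B" for \<mu> l P using p0[OF subsetD[OF sub that]] .
  have \<phi>_bd: "norm (\<phi> j \<mu> P) \<le> p1" if "(\<mu>, l, P) \<in> ?B" for j \<mu> l P
    unfolding \<phi>_def using p1[OF subsetD[OF sub that] axis_B] .
  have lJ_bd: "norm (l v* J \<mu> P) \<le> real CARD('s) * (\<Lambda> * p1)" if a: "(\<mu>, l, P) \<in> ?B" for \<mu> l P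
  proof -
    have "norm (l v* J \<mu> P) \<le> (\<Sum>j\<in>UNIV. \<bar>(l v* J \<mu> P) $ j\<bar>)" by (rule norm_le_l1_cart)
    also have "\<dots> \<le> (\<Sum>j\<in>(UNIV::'s set). \<Lambda> * p1)"
    proof (rule sum_mono)
      fix j
      have "\<bar>(l v* J \<mu> P) $ j\<bar> \<le> norm l * norm (\<phi> j \<mu> P)"
        unfolding J\<phi>[OF a] by (rule Cauchy_Schwarz_ineq2)
      also have "\<dots> \<le> \<Lambda> * p1" using l_bd[OF a] \<phi>_bd[OF a] Lam by (intro mult_mono) auto
      finally show "\<bar>(l v* J \<mu> P) $ j\<bar> \<le> \<Lambda> * p1" .
    qed
    finally show ?thesis by simp
  qed
  have inner_lip: "\<bar>l \<bullet> u - l' \<bullet> u'\<bar> \<le> \<delta> * p + \<Lambda> * w"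
    if "norm (l - l') \<le> \<delta>" "norm u \<le> p" "norm l' \<le> \<Lambda>" "norm (u - u') \<le> w" for l l' u u' :: "real^'q" and \<delta> p w
  proof -
    have "l \<bullet> u - l' \<bullet> u' = (l - l') \<bullet> u + l' \<bullet> (u - u')" by (simp add: inner_diff_left inner_diff_right)
    also have "\<bar>\<dots>\<bar> \<le> norm (l - l') * norm u + norm l' * norm (u - u')"
      by (rule order_trans[OF abs_triangle_ineq add_mono[OF Cauchy_Schwarz_ineq2 Cauchy_Schwarz_ineq2]])
    also have "\<dots> \<le> \<delta> * p + \<Lambda> * w"
      using that Lam order_trans[OF norm_ge_zero that(1)] by (intro add_mono mult_mono) auto
    finally show ?thesis .
  qed
  have L2: "L\<^sup>2 > 0" using L by simp
  have part1: "L \<le> 1 + l \<bullet> m y \<mu> P \<and> norm (m y \<mu> P) \<le> C * W \<and> norm (psi_EL m y (\<mu>, l, P), h y P) \<le> C * W"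
    if a: "(\<mu>, l, P) \<in> ?B" for \<mu> l P
  proof (intro conjI)
    let ?s = "1 + l \<bullet> m y \<mu> P"
    show s: "L \<le> ?s" by (rule pos[OF a])
    have quot: "norm (u /\<^sub>R ?s) \<le> K / L" if "norm u \<le> K" for u :: "'x::real_normed_vector" and K
    proof -
      have "norm (u /\<^sub>R ?s) = norm u / ?s" using s L by (simp add: divide_inverse mult.commute)
      also have "\<dots> \<le> K / L" using that s L by (intro frac_le) (auto intro: order_trans[OF norm_ge_zero])
      finally show ?thesis .
    qed
    have "1 * W \<le> C * W" using L L2 Lam k0 d0 Ws(9) unfolding C by (intro mult_right_mono) auto
    then show "norm (m y \<mu> P) \<le> C * W" using m_bd[OF a] Ws(1) by linarith
    have "norm (psi_EL m y (\<mu>, l, P), h y P) \<le> norm (m y \<mu> P /\<^sub>R ?s) + norm ((l v* J \<mu> P) /\<^sub>R ?s) + norm (h y P)"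
      unfolding psi by (intro order_trans[OF norm_Pair_le] add_mono norm_Pair_le order_refl)
    also have "\<dots> \<le> p0 / L + (real CARD('s) * (\<Lambda> * p1)) / L + q1"
      using m_bd[OF a] lJ_bd[OF a] q1[OF subsetD[OF sub a]] by (intro add_mono quot)
    also have "\<dots> \<le> W / L + (real CARD('s) * (\<Lambda> * W)) / L + W"
      using Ws L Lam by (intro add_mono divide_right_mono mult_left_mono) auto
    also have "\<dots> = (1/L + real CARD('s) * (\<Lambda>/L) + 1) * W" by (simp add: algebra_simps)
    also have "\<dots> \<le> C * W"
    proof (rule mult_right_mono[OF _ Ws(9)])
      have "real CARD('s) * (\<Lambda>/L) \<le> real CARD('s) * (\<Lambda>/L + k/L + \<Lambda>*k/L\<^sup>2)"
        using L Lam k0 by (intro mult_left_mono) auto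
      moreover have "d / L \<ge> 0" "k / L\<^sup>2 \<ge> 0" using L d0 k0 by auto
      ultimately show "1/L + real CARD('s) * (\<Lambda>/L) + 1 \<le> C" unfolding C using d0 by linarith
    qed
    finally show "norm (psi_EL m y (\<mu>, l, P), h y P) \<le> C * W" .
  qed
  have part2: "norm (m y \<mu> P - m y \<mu>' P') \<le> C * W * dist (\<mu>, l, P) (\<mu>', l', P') \<and>
       norm ((psi_EL m y (\<mu>, l, P), h y P) - (psi_EL m y (\<mu>', l', P'), h y P')) \<le> C * W * dist (\<mu>, l, P) (\<mu>', l', P')"
    if a: "(\<mu>, l, P) \<in> ?B" and a': "(\<mu>', l', P') \<in> ?B" for \<mu> l P \<mu>' l' P'
  proof -
    define \<delta> where "\<delta> = dist (\<mu>, l, P) (\<mu>', l', P')"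
    have de: "\<delta> \<ge> 0" by (simp add: \<delta>_def)
    let ?s = "1 + l \<bullet> m y \<mu> P" and ?s' = "1 + l' \<bullet> m y \<mu>' P'"
    have dl: "norm (l - l') \<le> \<delta>"
      using order_trans[OF norm_fst_le[of "l - l'" "P - P'"] norm_snd_le[of "(l - l', P - P')" "\<mu> - \<mu>'"]]
      by (simp add: dist_norm \<delta>_def)
    have dP: "dist P P' \<le> \<delta>"
      using order_trans[OF norm_snd_le[of "P - P'" "l - l'"] norm_snd_le[of "(l - l', P - P')" "\<mu> - \<mu>'"]]
      by (simp add: dist_norm \<delta>_def)
    have PB: "P \<in> cball P0 \<rho>" "P' \<in> cball P0 \<rho>"
      using order_trans[OF norm_snd_le[of "P0 - P" "\<mu>0 - \<mu>"]] pB[OF a]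
        order_trans[OF norm_snd_le[of "P0 - P'" "\<mu>0 - \<mu>'"]] pB[OF a'] by (auto simp: dist_norm)
    have dm: "norm (m y \<mu> P - m y \<mu>' P') \<le> p1 * d * \<delta>"
      using order_trans[OF m_lip[OF pB[OF a] pB[OF a']] mult_left_mono[OF dp[of \<mu> P \<mu>' P' l l']]] nn d0
      by (simp add: \<delta>_def)
    have d\<phi>: "norm (\<phi> j \<mu> P - \<phi> j \<mu>' P') \<le> p2 * d * \<delta>" for j
      using order_trans[OF m1_lip[OF axis_B[of j] pB[OF a] pB[OF a']] mult_left_mono[OF dp[of \<mu> P \<mu>' P' l l']]] nn d0
      by (simp add: \<delta>_def \<phi>_def)
    have dh: "norm (h y P - h y P') \<le> q2 * dr * \<delta>"
      using order_trans[OF h_lip[OF PB] mult_left_mono[OF dP]] nn d0 by simp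
    have ds: "\<bar>?s - ?s'\<bar> \<le> \<delta> * p0 + \<Lambda> * (p1 * d * \<delta>)"
      using inner_lip[OF dl m_bd[OF a] l_bd[OF a'] dm] by simp
    have dlJ: "norm (l v* J \<mu> P - l' v* J \<mu>' P') \<le> real CARD('s) * (\<delta> * p1 + \<Lambda> * (p2 * d * \<delta>))"
    proof -
      have "norm (l v* J \<mu> P - l' v* J \<mu>' P') \<le> (\<Sum>j\<in>UNIV. \<bar>(l v* J \<mu> P - l' v* J \<mu>' P') $ j\<bar>)" by (rule norm_le_l1_cart)
      also have "\<dots> \<le> (\<Sum>j\<in>(UNIV::'s set). \<delta> * p1 + \<Lambda> * (p2 * d * \<delta>))"
      proof (rule sum_mono)
        fix j
        show "\<bar>(l v* J \<mu> P - l' v* J \<mu>' P') $ j\<bar> \<le> \<delta> * p1 + \<Lambda> * (p2 * d * \<delta>)"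
          using inner_lip[OF dl \<phi>_bd[OF a, of j] l_bd[OF a'] d\<phi>] by (simp add: J\<phi>[OF a] J\<phi>[OF a'])
      qed
      finally show ?thesis by simp
    qed
    have Wd: "p1 * d * \<delta> \<le> d * (W * \<delta>)" "\<delta> * p1 + \<Lambda> * (p2 * d * \<delta>) \<le> k * (W * \<delta>)"
      "p0 * (\<delta> * p0 + \<Lambda> * (p1 * d * \<delta>)) \<le> k * (W * \<delta>)" "p1 * (\<delta> * p0 + \<Lambda> * (p1 * d * \<delta>)) \<le> k * (W * \<delta>)"
      "q2 * dr * \<delta> \<le> dr * (W * \<delta>)"
    proof -
      have x: "x * \<delta> \<le> W * \<delta>" if "x \<le> W" for x using that de by (rule mult_right_mono)
      have Ld: "\<Lambda> * d \<ge> 0" using Lam d0 by simp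
      show "p1 * d * \<delta> \<le> d * (W * \<delta>)" using mult_left_mono[OF x[OF Ws(2)] d0(1)] by (simp add: mult_ac)
      show "q2 * dr * \<delta> \<le> dr * (W * \<delta>)" using mult_left_mono[OF x[OF Ws(8)] d0(2)] by (simp add: mult_ac)
      show "\<delta> * p1 + \<Lambda> * (p2 * d * \<delta>) \<le> k * (W * \<delta>)"
        using add_mono[OF x[OF Ws(2)] mult_left_mono[OF x[OF Ws(6)] Ld]] unfolding k by (simp add: algebra_simps)
      show "p0 * (\<delta> * p0 + \<Lambda> * (p1 * d * \<delta>)) \<le> k * (W * \<delta>)"
        using add_mono[OF x[OF Ws(3)] mult_left_mono[OF x[OF Ws(4)] Ld]] unfolding k by (simp add: algebra_simps)
      show "p1 * (\<delta> * p0 + \<Lambda> * (p1 * d * \<delta>)) \<le> k * (W * \<delta>)"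
        using add_mono[OF x[OF Ws(4)] mult_left_mono[OF x[OF Ws(5)] Ld]] unfolding k by (simp add: algebra_simps)
    qed
    have Wde: "W * \<delta> \<ge> 0" using Ws(9) de by simp
    have e1: "norm (m y \<mu> P /\<^sub>R ?s - m y \<mu>' P' /\<^sub>R ?s') \<le> (d/L + k/L\<^sup>2) * (W * \<delta>)"
    proof -
      have "norm (m y \<mu>' P') * \<bar>?s - ?s'\<bar> \<le> p0 * (\<delta> * p0 + \<Lambda> * (p1 * d * \<delta>))"
        using m_bd[OF a'] ds nn by (intro mult_mono) auto
      also note Wd(3)
      finally have "norm (m y \<mu>' P') * \<bar>?s - ?s'\<bar> / L\<^sup>2 \<le> k * (W * \<delta>) / L\<^sup>2" using L2 by (intro divide_right_mono) auto
      moreover have "norm (m y \<mu> P - m y \<mu>' P') / L \<le> d * (W * \<delta>) / L"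
        using order_trans[OF dm Wd(1)] L by (intro divide_right_mono) auto
      ultimately show ?thesis
        using norm_quotient_diff[OF L pos[OF a] pos[OF a'], of "m y \<mu> P" "m y \<mu>' P'"] by (simp add: algebra_simps)
    qed
    have e2: "norm ((l v* J \<mu> P) /\<^sub>R ?s - (l' v* J \<mu>' P') /\<^sub>R ?s') \<le> real CARD('s) * (k/L + \<Lambda>*k/L\<^sup>2) * (W * \<delta>)"
    proof -
      have "norm (l' v* J \<mu>' P') * \<bar>?s - ?s'\<bar> \<le> real CARD('s) * (\<Lambda> * p1) * (\<delta> * p0 + \<Lambda> * (p1 * d * \<delta>))"
        using lJ_bd[OF a'] ds nn Lam by (intro mult_mono) auto
      also have "\<dots> = real CARD('s) * \<Lambda> * (p1 * (\<delta> * p0 + \<Lambda> * (p1 * d * \<delta>)))" by simp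
      also have "\<dots> \<le> real CARD('s) * \<Lambda> * (k * (W * \<delta>))" using Wd(4) Lam by (intro mult_left_mono) auto
      finally have "norm (l' v* J \<mu>' P') * \<bar>?s - ?s'\<bar> / L\<^sup>2 \<le> real CARD('s) * \<Lambda> * (k * (W * \<delta>)) / L\<^sup>2"
        using L2 by (intro divide_right_mono) auto
      moreover have "norm (l v* J \<mu> P - l' v* J \<mu>' P') / L \<le> real CARD('s) * (k * (W * \<delta>)) / L"
        using order_trans[OF dlJ mult_left_mono[OF Wd(2)]] L by (intro divide_right_mono) auto
      ultimately show ?thesis
        using norm_quotient_diff[OF L pos[OF a] pos[OF a'], of "l v* J \<mu> P" "l' v* J \<mu>' P'"] by (simp add: algebra_simps)
    qed
    have "norm ((psi_EL m y (\<mu>, l, P), h y P) - (psi_EL m y (\<mu>', l', P'), h y P')) \<le>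
       norm (m y \<mu> P /\<^sub>R ?s - m y \<mu>' P' /\<^sub>R ?s') + norm ((l v* J \<mu> P) /\<^sub>R ?s - (l' v* J \<mu>' P') /\<^sub>R ?s') + norm (h y P - h y P')"
      unfolding psi diff_Pair by (intro order_trans[OF norm_Pair_le] add_mono norm_Pair_le order_refl)
    also have "\<dots> \<le> (d/L + k/L\<^sup>2) * (W * \<delta>) + real CARD('s) * (k/L + \<Lambda>*k/L\<^sup>2) * (W * \<delta>) + dr * (W * \<delta>)"
      using e1 e2 order_trans[OF dh Wd(5)] by (intro add_mono)
    also have "\<dots> = ((d/L + k/L\<^sup>2) + real CARD('s) * (k/L + \<Lambda>*k/L\<^sup>2) + dr) * (W * \<delta>)" by (simp only: distrib_right)
    also have "\<dots> \<le> C * (W * \<delta>)"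
    proof (rule mult_right_mono[OF _ Wde])
      have "real CARD('s) * (k/L + \<Lambda>*k/L\<^sup>2) \<le> real CARD('s) * (\<Lambda>/L + k/L + \<Lambda>*k/L\<^sup>2)"
        using L Lam by (intro mult_left_mono) auto
      moreover have "1 / L \<ge> 0" using L by simp
      ultimately show "(d/L + k/L\<^sup>2) + real CARD('s) * (k/L + \<Lambda>*k/L\<^sup>2) + dr \<le> C" unfolding C using d0 by linarith
    qed
    finally have f: "norm ((psi_EL m y (\<mu>, l, P), h y P) - (psi_EL m y (\<mu>', l', P'), h y P')) \<le> C * (W * \<delta>)" .
    have "d * (W * \<delta>) \<le> C * (W * \<delta>)"
      using L L2 Lam k0 d0 unfolding C by (intro mult_right_mono Wde) auto
    then have "norm (m y \<mu> P - m y \<mu>' P') \<le> C * (W * \<delta>)" using order_trans[OF dm Wd(1)] by linarith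
    with f show ?thesis by (simp add: \<delta>_def mult.assoc)
  qed
  show ?thesis unfolding el_good_def W_def[symmetric] using part1 part2 by blast
qed

text \<open>The exceptional null set in the hypothesis varies with the parameter. A countable dense
  set of parameters collects countably many of them into one, and continuity extends the bound to
  all parameters, at the price of a weak inequality.\<close>

lemma AE_bound_open:
  fixes g :: "'y \<Rightarrow> 'a::second_countable_topology \<Rightarrow> real"
  assumes N: "open N" and cont: "\<And>y. continuous_on N (g y)"
    and ae: "\<And>a. a \<in> N \<Longrightarrow> AE y in F. L < g y a"
  shows "AE y in F. \<forall>a\<in>N. L \<le> g y a"
proof -
  obtain S :: "'a set" where S: "countable S" "\<And>X. open X \<Longrightarrow> X \<noteq> {} \<Longrightarrow> \<exists>d\<in>S. d \<in> X"
    using countable_dense_exists by blast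
  have "AE y in F. \<forall>a\<in>S \<inter> N. L < g y a"
    using S(1) ae by (subst AE_ball_countable) (auto intro: countable_subset)
  then show ?thesis
  proof eventually_elim
    case (elim y)
    show ?case
    proof (rule ccontr)
      assume "\<not> ?case"
      then have "N \<inter> g y -` {..<L} \<noteq> {}" by (auto simp: not_le)
      moreover have "open (N \<inter> g y -` {..<L})"
        using continuous_on_open_vimage[OF N] cont by (metis Int_commute open_lessThan)
      ultimately obtain a where a: "a \<in> S" "a \<in> N" "g y a < L" using S(2) by blast
      with elim have "L < g y a" by blast
      with a(3) show False by linarith
    qed
  qed
qed

text \<open>The envelopes are known only through integrability of their powers; measurability is
  recovered by taking square roots of nonnegative functions.\<close>

lemma measurable_of_square:
  fixes p :: "'y \<Rightarrow> real"
  assumes "(\<lambda>y. (p y)\<^sup>2) \<in> borel_measurable F" "\<And>y. 0 \<le> p y"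
  shows "p \<in> borel_measurable F"
proof -
  have "(\<lambda>y. sqrt ((p y)\<^sup>2)) \<in> borel_measurable F" using assms(1) by measurable
  then show ?thesis using assms(2) by simp
qed

text \<open>A directional derivative is a pointwise limit of difference quotients along one sequence
  of steps, all of which stay in the open set where the sections are measurable.\<close>

lemma measurable_directional:
  fixes g :: "'y \<Rightarrow> 'a::real_normed_vector \<Rightarrow> real"
  assumes \<Theta>: "open \<Theta>" "x \<in> \<Theta>" and meas: "\<And>x. x \<in> \<Theta> \<Longrightarrow> (\<lambda>y. g y x) \<in> borel_measurable F"
    and der: "\<And>y. (g y has_derivative g' y) (at x)"
  shows "(\<lambda>y. g' y e) \<in> borel_measurable F"
proof -
  have op: "open ((\<lambda>t::real. x + t *\<^sub>R e) -` \<Theta>)" by (intro open_vimage \<Theta>(1) continuous_intros)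
  have "0 \<in> (\<lambda>t::real. x + t *\<^sub>R e) -` \<Theta>" using \<Theta>(2) by simp
  then obtain d where d: "d > 0" "ball 0 d \<subseteq> (\<lambda>t::real. x + t *\<^sub>R e) -` \<Theta>"
    using op open_contains_ball by blast
  \<comment> \<open>The shift by two keeps every step, the one at \<open>k = 0\<close> included,
    strictly below \<open>d\<close>.\<close>
  define t where "t k = d / real (k + 2)" for k
  have t: "t k > 0" "t k < d" for k
    using d(1) divide_strict_left_mono[of 1 "real (k + 2)" d] by (auto simp: t_def)
  have t0: "t \<longlonglongrightarrow> 0" unfolding t_def by real_asymp
  have lim: "(\<lambda>k. (g y (x + t k *\<^sub>R e) - g y x) / t k) \<longlonglongrightarrow> g' y e" for y
  proof -
    have "((\<lambda>s::real. x + s *\<^sub>R e) has_derivative (\<lambda>s. s *\<^sub>R e)) (at 0)"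
      by (auto intro!: derivative_eq_intros)
    moreover have "(g y has_derivative g' y) (at (x + 0 *\<^sub>R e))" using der by simp
    ultimately have "((\<lambda>s. g y (x + s *\<^sub>R e)) has_derivative (\<lambda>s. g' y (s *\<^sub>R e))) (at 0)"
      by (rule has_derivative_compose)
    moreover have "(\<lambda>s. g' y (s *\<^sub>R e)) = (*) (g' y e)"
      using linear_scale[OF has_derivative_linear[OF der]] by (simp add: fun_eq_iff)
    ultimately have "((\<lambda>s. g y (x + s *\<^sub>R e)) has_field_derivative g' y e) (at 0)"
      by (simp add: has_field_derivative_def)
    then have "(\<lambda>s. (g y (x + s *\<^sub>R e) - g y x) / s) \<midarrow>0\<rightarrow> g' y e"
      by (simp add: DERIV_def)
    moreover have "filterlim t (at 0) sequentially"
      using t0 t(1) by (auto simp: filterlim_at intro!: always_eventually less_imp_neq[symmetric])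
    ultimately show ?thesis by (rule filterlim_compose)
  qed
  show ?thesis
  proof (rule borel_measurable_LIMSEQ_metric[OF _ lim])
    fix k
    have "x + t k *\<^sub>R e \<in> \<Theta>" using d(2) t[of k] by (auto simp: subset_eq)
    from meas[OF this] meas[OF \<Theta>(2)]
    show "(\<lambda>y. (g y (x + t k *\<^sub>R e) - g y x) / t k) \<in> borel_measurable F" by measurable
  qed
qed

text \<open>Consistency of \<open>Phat\<close> and continuity of \<open>mu\<close> at
  \<open>P0\<close> bring the estimated parameters and \<open>(mu P, lam (mu P) P, P)\<close> into a
  ball around \<alpha>0, where all bounds are local. The strict maximum at \<open>P0\<close> turns
  maximality of the first component of the root into equality with \<open>mu P0\<close>. Properties
  of the estimators are required with probability tending to one, as at a given sample size the
  empirical likelihood may vanish everywhere.\<close>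

theorem theorem2:
  fixes M :: "'w measure"
    and F :: "(real^'d) measure"
    and Y :: "nat \<Rightarrow> 'w \<Rightarrow> real^'d"
    and \<Theta> :: "(real^'s) set"
    and m :: "real^'d \<Rightarrow> real^'s \<Rightarrow> real^'r \<Rightarrow> real^'q"
    and h :: "real^'d \<Rightarrow> real^'r \<Rightarrow> real^'r"
    and Phat :: "nat \<Rightarrow> 'w \<Rightarrow> real^'r"
    and muhat :: "nat \<Rightarrow> real^'r \<Rightarrow> 'w \<Rightarrow> real^'s"
    and EL :: "nat \<Rightarrow> 'w \<Rightarrow> real^'r \<Rightarrow> real^'s \<Rightarrow> real"
    and \<alpha>0 :: "(real^'s) \<times> (real^'q) \<times> (real^'r)"
    and N :: "((real^'s) \<times> (real^'q) \<times> (real^'r)) set"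
    and L :: real
    and p0 p1 p2 q1 q2 :: "real^'d \<Rightarrow> real"
    and lam :: "real^'s \<Rightarrow> real^'r \<Rightarrow> real^'q"
    and mu :: "real^'r \<Rightarrow> real^'s"
    and P0 :: "real^'r"
  defines "EL \<equiv> (\<lambda>n \<omega> P \<mu>. emp_lik n (\<lambda>i. m (Y i \<omega>) \<mu> P))"
  assumes prob: "prob_space M"
    and indep: "prob_space.indep_vars M (\<lambda>_. borel) Y UNIV"
    and ident: "\<And>i. distr M borel (Y i) = F"
    and open_Theta: "open \<Theta>"
    and m_meas: "\<And>\<mu> P. \<mu> \<in> \<Theta> \<Longrightarrow> (\<lambda>y. m y \<mu> P) \<in> borel_measurable borel"
    and m_C1: "\<And>y. C1_on (\<lambda>(\<mu>, P). m y \<mu> P) (\<Theta> \<times> UNIV)"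
    and h_meas: "(\<lambda>(y, P). h y P) \<in> borel_measurable borel"
    and Phat_meas: "\<And>n. Phat n \<in> borel_measurable M"
    and Phat_eq: "o_pr M (\<lambda>n. 1 / sqrt (real n))
                    (\<lambda>n \<omega>. (\<Sum>i<n. h (Y i \<omega>) (Phat n \<omega>)) /\<^sub>R real n)"
    and Phat_consistent: "conv_in_prob M Phat P0"
    and muhat_meas: "\<And>n. (\<lambda>\<omega>. muhat n (Phat n \<omega>) \<omega>) \<in> borel_measurable M"
    and muhat0_meas: "\<And>n. muhat n P0 \<in> borel_measurable M"
    and muhat: "whp M (\<lambda>n \<omega>. is_MEL \<Theta> (EL n \<omega> (Phat n \<omega>)) (muhat n (Phat n \<omega>) \<omega>) \<and>
                  unique_log_critical \<Theta> (EL n \<omega> (Phat n \<omega>)) (muhat n (Phat n \<omega>) \<omega>))"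
    and lamhat: "whp M (\<lambda>n \<omega>. \<exists>!l. solves_emp n
                  (\<lambda>i. m (Y i \<omega>) (muhat n (Phat n \<omega>) \<omega>) (Phat n \<omega>)) l)"
    and muhat0: "whp M (\<lambda>n \<omega>. is_MEL \<Theta> (EL n \<omega> P0) (muhat n P0 \<omega>) \<and>
                  unique_log_critical \<Theta> (EL n \<omega> P0) (muhat n P0 \<omega>))"
    and Gamma_unique_root: "\<And>\<alpha>. Gamma_root F m h \<Theta> \<alpha> \<longleftrightarrow> \<alpha> = \<alpha>0"
    and open_N: "open N" "\<alpha>0 \<in> N" "N \<subseteq> \<Theta> \<times> UNIV \<times> UNIV"
    and cond1: "C1_on (Gamma_EL F m h) N" "bij (frechet_derivative (Gamma_EL F m h) (at \<alpha>0))"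
    and cond2: "L > 0" "\<And>\<mu> l P. (\<mu>, l, P) \<in> N \<Longrightarrow> AE y in F. 1 + l \<bullet> m y \<mu> P > L"
    and cond3_m: "\<And>\<mu> l P y. (\<mu>, l, P) \<in> N \<Longrightarrow> norm (m y \<mu> P) \<le> p0 y"
    and cond3_m1: "\<And>\<mu> l P y b. (\<mu>, l, P) \<in> N \<Longrightarrow> b \<in> Basis \<Longrightarrow>
                     norm (partial (\<lambda>(\<mu>, P). m y \<mu> P) b (\<mu>, P)) \<le> p1 y"
    and cond3_m2: "\<And>\<mu> l P y b c. (\<mu>, l, P) \<in> N \<Longrightarrow> b \<in> Basis \<Longrightarrow> c \<in> Basis \<Longrightarrow>
                     has_partial (partial (\<lambda>(\<mu>, P). m y \<mu> P) b) c (\<mu>, P) \<and>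
                     norm (partial (partial (\<lambda>(\<mu>, P). m y \<mu> P) b) c (\<mu>, P)) \<le> p2 y"
    and cond3_p: "integrable F (\<lambda>y. p0 y ^ 4)" "integrable F (\<lambda>y. p1 y ^ 4)"
                 "integrable F (\<lambda>y. p2 y ^ 2)"
    and cond4_h: "\<And>\<mu> l P y. (\<mu>, l, P) \<in> N \<Longrightarrow> norm (h y P) \<le> q1 y"
    and cond4_h1: "\<And>\<mu> l P y b. (\<mu>, l, P) \<in> N \<Longrightarrow> b \<in> Basis \<Longrightarrow>
                     has_partial (h y) b P \<and> norm (partial (h y) b P) \<le> q2 y"
    and cond4_q: "integrable F (\<lambda>y. q1 y ^ 2)" "integrable F (\<lambda>y. q2 y ^ 2)"
    and lam: "\<And>\<mu> P l. \<mu> \<in> \<Theta> \<Longrightarrow> solves_pop F (\<lambda>y. m y \<mu> P) l \<Longrightarrow> lam \<mu> P = l"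
    and P0: "\<And>P. (integrable F (\<lambda>y. h y P) \<and> (\<integral>y. h y P \<partial>F) = 0) \<longleftrightarrow> P = P0"
    and mu: "\<And>P. mu P \<in> profile_dom F m \<Theta> lam P \<and>
               (\<forall>\<mu>\<in>profile_dom F m \<Theta> lam P. profile F m lam P \<mu> \<le> profile F m lam P (mu P))"
    and mu0_unique: "\<And>\<mu>. \<mu> \<in> profile_dom F m \<Theta> lam P0 \<Longrightarrow> \<mu> \<noteq> mu P0 \<Longrightarrow>
                       profile F m lam P0 \<mu> < profile F m lam P0 (mu P0)"
    and mu_cont: "isCont mu P0"
  shows "conv_in_prob M (\<lambda>n \<omega>. muhat n (Phat n \<omega>) \<omega>) (mu P0) \<and>
         mu differentiable (at P0) \<and>
         o_pr M (\<lambda>n. 1 / sqrt (real n))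
           (\<lambda>n \<omega>. muhat n (Phat n \<omega>) \<omega> -
                   (muhat n P0 \<omega> +
                    jacobian mu (at P0) *v (Phat n \<omega> - P0)))"
proof -
  obtain \<mu>0 l0 P0' where \<alpha>0: "\<alpha>0 = (\<mu>0, l0, P0')" by (cases \<alpha>0) auto
  have rt: "\<mu>0 \<in> \<Theta>" "integrable F (\<lambda>y. h y P0')" "Gamma_EL F m h (\<mu>0, l0, P0') = 0"
    using Gamma_unique_root[of \<alpha>0] unfolding \<alpha>0 Gamma_root_def by auto
  \<comment> \<open>The \<open>h\<close>-block of the root equation is the equation that
    characterises \<open>P0\<close>.\<close>
  have "(\<integral>y. h y P0' \<partial>F) = 0" using arg_cong[of _ _ snd, OF rt(3)] by (simp add: Gamma_EL_def)
  then have [simp]: "P0' = P0" using P0[of P0'] rt(2) by blast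
  note \<alpha>0 = \<alpha>0[simplified]
  interpret iid_sample M F Y
    using prob indep ident by (intro iid_sample.intro iid_sample_axioms.intro)
  let ?mm = "\<lambda>y (\<mu>, P). m y \<mu> P"
  define d where "d = real (DIM((real^'s) \<times> (real^'r)))"
  define dr where "dr = real (DIM(real^'r))"
  obtain R where R: "R > 0" "ball (\<mu>0, l0, P0) R \<subseteq> N"
    using open_N(1,2) open_contains_ball unfolding \<alpha>0 by blast
  \<comment> \<open>Both coordinatewise paths, in \<open>(\<mu>, P)\<close> and in \<open>P\<close>
    alone, starting in the ball of radius \<open>\<rho>\<close> then stay within
    \<open>R\<close>.\<close>
  define \<rho> where "\<rho> = R / (2 * (1 + 2 * d + 2 * dr))"
  have dn: "d \<ge> 0" "dr \<ge> 0" by (auto simp: d_def dr_def)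
  have rho: "\<rho> > 0" using R dn by (simp add: \<rho>_def)
  have "x * (R / (2 * x)) = R / 2" if "x > 0" for x using that by simp
  from this[of "1 + 2 * d + 2 * dr"] have "(1 + 2 * d + 2 * dr) * \<rho> = R / 2"
    using dn by (simp only: \<rho>_def)
  moreover have "2 * d * \<rho> \<ge> 0" "2 * dr * \<rho> \<ge> 0" using dn rho by auto
  ultimately have rhoR: "(1 + 2 * d) * \<rho> < R" "(1 + 2 * dr) * \<rho> < R" "\<rho> < R"
    using R(1) by (auto simp: algebra_simps)
  have inN: "a \<in> N" if "a \<in> ball (\<mu>0, l0, P0) R" for a using R(2) that by blast
  have BN: "cball (\<mu>0, l0, P0) \<rho> \<subseteq> N" using inN rhoR(3) by auto
  have Th: "\<mu> \<in> \<Theta>" if "(\<mu>, l, P) \<in> N" for \<mu> l P using open_N(3) that by blast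
  have mdiff: "?mm y differentiable (at (\<mu>, P))" if "\<mu> \<in> \<Theta>" for y \<mu> P
    using m_C1[of y] that unfolding C1_on_def differentiable_def by blast
  have mcont: "continuous_on (\<Theta> \<times> UNIV) (?mm y)" for y
    by (rule differentiable_imp_continuous_on)
       (use mdiff in \<open>auto simp: differentiable_on_def intro: differentiable_at_withinI\<close>)
  have "AE y in F. \<forall>a\<in>N. L \<le> 1 + fst (snd a) \<bullet> ?mm y (fst a, snd (snd a))"
  proof (rule AE_bound_open[OF open_N(1)])
    show "continuous_on N (\<lambda>a. 1 + fst (snd a) \<bullet> ?mm y (fst a, snd (snd a)))" for y
      by (intro continuous_intros continuous_on_compose2[OF mcont[of y]]) (use Th in auto)
    show "AE y in F. L < 1 + fst (snd a) \<bullet> ?mm y (fst a, snd (snd a))" if "a \<in> N" for a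
      using cond2(2)[of "fst a" "fst (snd a)" "snd (snd a)"] that by simp
  qed
  then have posN: "AE y in F. \<forall>\<mu> l P. (\<mu>, l, P) \<in> N \<longrightarrow> L \<le> 1 + l \<bullet> m y \<mu> P"
    by eventually_elim force
  define \<Lambda> where "\<Lambda> = norm l0 + \<rho>"
  define k where "k = 1 + \<Lambda> * d"
  define C where "C = (1/L + d/L + k/L\<^sup>2) + real CARD('s) * (\<Lambda>/L + k/L + \<Lambda>*k/L\<^sup>2) + (1 + dr) + d + 1"
  \<comment> \<open>\<open>p0\<close> and \<open>p1\<close> enter squared because products of them
    occur in the Lipschitz bound for \<psi>; square integrability of \<open>Q\<close> then calls for
    their fourth moments and the second moments of the other envelopes.\<close>
  define Q where "Q y = C * (1 + (p0 y)\<^sup>2 + (p1 y)\<^sup>2 + p2 y + q1 y + q2 y)" for y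
  have good_y: "el_good m h (cball (\<mu>0, l0, P0) \<rho>) L (Q y) y" if pos: "\<forall>\<mu> l P. (\<mu>, l, P) \<in> N \<longrightarrow> L \<le> 1 + l \<bullet> m y \<mu> P" for y
    unfolding Q_def
  proof (rule el_goodI[where R = R and \<Lambda> = \<Lambda> and k = k, OF rho rhoR(1,2)[unfolded d_def dr_def]])
    show "?mm y differentiable (at (\<mu>, P))" if "(\<mu>, l, P) \<in> ball (\<mu>0, l0, P0) R" for \<mu> l P
      using Th[OF inN[OF that]] by (rule mdiff)
    show "norm (m y \<mu> P) \<le> p0 y" if "(\<mu>, l, P) \<in> ball (\<mu>0, l0, P0) R" for \<mu> l P
      using inN[OF that] by (rule cond3_m)
    show "norm (partial (?mm y) e (\<mu>, P)) \<le> p1 y" if "(\<mu>, l, P) \<in> ball (\<mu>0, l0, P0) R" "e \<in> Basis" for \<mu> l P e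
      using inN[OF that(1)] that(2) by (rule cond3_m1)
    show "has_partial (partial (?mm y) e) c (\<mu>, P) \<and> norm (partial (partial (?mm y) e) c (\<mu>, P)) \<le> p2 y"
      if "(\<mu>, l, P) \<in> ball (\<mu>0, l0, P0) R" "e \<in> Basis" "c \<in> Basis" for \<mu> l P e c
      using inN[OF that(1)] that(2,3) by (rule cond3_m2)
    show "norm (h y P) \<le> q1 y" if "(\<mu>, l, P) \<in> ball (\<mu>0, l0, P0) R" for \<mu> l P
      using inN[OF that] by (rule cond4_h)
    show "has_partial (h y) e P \<and> norm (partial (h y) e P) \<le> q2 y"
      if "(\<mu>, l, P) \<in> ball (\<mu>0, l0, P0) R" "e \<in> Basis" for \<mu> l P e
      using inN[OF that(1)] that(2) by (rule cond4_h1)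
    show "L \<le> 1 + l \<bullet> m y \<mu> P" if "(\<mu>, l, P) \<in> cball (\<mu>0, l0, P0) \<rho>" for \<mu> l P
      using pos BN that by blast
  qed (use cond2(1) in \<open>simp_all add: \<Lambda>_def k_def C_def d_def dr_def\<close>)
  have good: "AE y in F. el_good m h (cball (\<mu>0, l0, P0) \<rho>) L (Q y) y"
    using posN by eventually_elim (rule good_y)
  have c0: "(\<mu>0, l0, P0) \<in> N" using open_N(2) by (simp add: \<alpha>0)
  obtain e0 :: "(real^'s) \<times> (real^'r)" where e0: "e0 \<in> Basis" using nonempty_Basis by blast
  obtain e1 :: "real^'r" where e1: "e1 \<in> Basis" using nonempty_Basis by blast
  have nn: "p0 y \<ge> 0" "p1 y \<ge> 0" "p2 y \<ge> 0" "q1 y \<ge> 0" "q2 y \<ge> 0" for y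
    using order_trans[OF norm_ge_zero cond3_m[OF c0]] order_trans[OF norm_ge_zero cond3_m1[OF c0 e0]]
      order_trans[OF norm_ge_zero conjunct2[OF cond3_m2[OF c0 e0 e0]]] order_trans[OF norm_ge_zero cond4_h[OF c0]]
      order_trans[OF norm_ge_zero conjunct2[OF cond4_h1[OF c0 e1]]] by auto
  have k0: "\<Lambda> \<ge> 0" "k \<ge> 0" using rho dn by (auto simp: \<Lambda>_def k_def)
  have C0: "C \<ge> 0" using cond2(1) dn k0 by (simp add: C_def)
  have Q0: "0 \<le> Q y" for y using nn[of y] C0 by (simp add: Q_def)
  have [measurable]: "(\<lambda>y. (p0 y)\<^sup>2) \<in> borel_measurable F" "(\<lambda>y. (p1 y)\<^sup>2) \<in> borel_measurable F"
    by (rule measurable_of_square; use borel_measurable_integrable[OF cond3_p(1)]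
        borel_measurable_integrable[OF cond3_p(2)] in simp)+
  have [measurable]: "p2 \<in> borel_measurable F" "q1 \<in> borel_measurable F" "q2 \<in> borel_measurable F"
    by (rule measurable_of_square[OF borel_measurable_integrable[OF cond3_p(3)] nn(3)]
        measurable_of_square[OF borel_measurable_integrable[OF cond4_q(1)] nn(4)]
        measurable_of_square[OF borel_measurable_integrable[OF cond4_q(2)] nn(5)])+
  have Qm: "Q \<in> borel_measurable F" unfolding Q_def by measurable
  have Q2: "integrable F (\<lambda>y. (Q y)\<^sup>2)"
  proof (rule Bochner_Integration.integrable_bound)
    show "integrable F (\<lambda>y. C\<^sup>2 * (6 * (1 + p0 y ^ 4 + p1 y ^ 4 + (p2 y)\<^sup>2 + (q1 y)\<^sup>2 + (q2 y)\<^sup>2)))"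
      using cond3_p cond4_q by simp
    \<comment> \<open>The Cauchy-Schwarz inequality for six summands; the gap is the sum of all
      squared pairwise differences.\<close>
    have s6: "(a + b + c + u + v + w)\<^sup>2 \<le> 6 * (a\<^sup>2 + b\<^sup>2 + c\<^sup>2 + u\<^sup>2 + v\<^sup>2 + w\<^sup>2)" for a b c u v w :: real
    proof -
      have "6 * (a\<^sup>2 + b\<^sup>2 + c\<^sup>2 + u\<^sup>2 + v\<^sup>2 + w\<^sup>2) - (a + b + c + u + v + w)\<^sup>2 =
        (a-b)\<^sup>2 + (a-c)\<^sup>2 + (a-u)\<^sup>2 + (a-v)\<^sup>2 + (a-w)\<^sup>2 + (b-c)\<^sup>2 + (b-u)\<^sup>2 + (b-v)\<^sup>2 + (b-w)\<^sup>2 +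
        (c-u)\<^sup>2 + (c-v)\<^sup>2 + (c-w)\<^sup>2 + (u-v)\<^sup>2 + (u-w)\<^sup>2 + (v-w)\<^sup>2"
        by (simp add: power2_eq_square algebra_simps)
      also have "\<dots> \<ge> 0" by (intro add_nonneg_nonneg zero_le_power2)
      finally show ?thesis by simp
    qed
    show "AE y in F. norm ((Q y)\<^sup>2) \<le> norm (C\<^sup>2 * (6 * (1 + p0 y ^ 4 + p1 y ^ 4 + (p2 y)\<^sup>2 + (q1 y)\<^sup>2 + (q2 y)\<^sup>2)))"
    proof (rule AE_I2)
      fix y
      have "(Q y)\<^sup>2 \<le> C\<^sup>2 * (6 * (1 + p0 y ^ 4 + p1 y ^ 4 + (p2 y)\<^sup>2 + (q1 y)\<^sup>2 + (q2 y)\<^sup>2))"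
        unfolding Q_def power_mult_distrib
        using mult_left_mono[OF s6[of 1 "(p0 y)\<^sup>2" "(p1 y)\<^sup>2" "p2 y" "q1 y" "q2 y"], of "C\<^sup>2"] by simp
      then show "norm ((Q y)\<^sup>2) \<le> norm (C\<^sup>2 * (6 * (1 + p0 y ^ 4 + p1 y ^ 4 + (p2 y)\<^sup>2 + (q1 y)\<^sup>2 + (q2 y)\<^sup>2)))"
        by simp
    qed
  qed (use Qm in simp)
  obtain D' where D': "(Gamma_EL F m h has_derivative blinfun_apply D') (at (\<mu>0, l0, P0))"
    using cond1(1) c0 unfolding C1_on_def by blast
  have bijD: "bij (blinfun_apply D')"
    using cond1(2) frechet_derivative_at[OF D'] by (simp add: \<alpha>0)
  have mder: "((\<lambda>\<mu>'. m y \<mu>' P) has_derivative (\<lambda>e. jacobian (\<lambda>\<mu>'. m y \<mu>' P) (at \<mu>) *v e)) (at \<mu>)"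
    if "\<mu> \<in> \<Theta>" for y \<mu> P
    by (rule jacobian_slice(1)[OF mdiff[OF that]])
  have psi_meas: "(\<lambda>y. psi_EL m y a) \<in> borel_measurable borel" if a: "a \<in> cball (\<mu>0, l0, P0) \<rho>" for a
  proof -
    obtain \<mu> l P where aa: "a = (\<mu>, l, P)" by (cases a) auto
    have mu: "\<mu> \<in> \<Theta>" using Th[OF subsetD[OF BN]] a aa by blast
    note [measurable] = m_meas[OF mu, of P]
    have "(\<lambda>y. l v* jacobian (\<lambda>\<mu>'. m y \<mu>' P) (at \<mu>)) \<in> borel_measurable borel"
    proof (rule borel_measurable_euclidean_space[THEN iffD2], rule ballI)
      fix e :: "real^'s"
      have "(\<lambda>y. l \<bullet> (jacobian (\<lambda>\<mu>'. m y \<mu>' P) (at \<mu>) *v e)) \<in> borel_measurable borel"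
      proof (rule measurable_directional[OF open_Theta mu, where g = "\<lambda>y \<mu>'. l \<bullet> m y \<mu>' P"
            and g' = "\<lambda>y e. l \<bullet> (jacobian (\<lambda>\<mu>'. m y \<mu>' P) (at \<mu>) *v e)"])
        show "(\<lambda>y. l \<bullet> m y x P) \<in> borel_measurable borel" if "x \<in> \<Theta>" for x
          using m_meas[OF that, of P] by measurable
        show "((\<lambda>\<mu>'. l \<bullet> m y \<mu>' P) has_derivative (\<lambda>e. l \<bullet> (jacobian (\<lambda>\<mu>'. m y \<mu>' P) (at \<mu>) *v e))) (at \<mu>)" for y
          by (rule has_derivative_inner_right[OF mder[OF mu]])
      qed
      then show "(\<lambda>y. (l v* jacobian (\<lambda>\<mu>'. m y \<mu>' P) (at \<mu>)) \<bullet> e) \<in> borel_measurable borel"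
        by (simp add: dot_lmul_matrix)
    qed
    note [measurable] = this
    show ?thesis unfolding aa psi_EL_def by simp
  qed
  have h_sec: "(\<lambda>y. h y P) \<in> borel_measurable borel" for P
  proof -
    have "(\<lambda>y::real^'d. (y, P)) \<in> borel_measurable borel" by measurable
    from measurable_compose[OF this h_meas] show ?thesis by simp
  qed
  interpret E: el_regular M F Y m h \<Theta> \<mu>0 l0 P0 \<rho> L Q lam "blinfun_apply D'"
  proof unfold_locales
    show "cball (\<mu>0, l0, P0) \<rho> \<subseteq> \<Theta> \<times> UNIV \<times> UNIV" using BN open_N(3) by blast
    show "Q \<in> borel_measurable borel" using Qm by (simp add: measurable_F)
    show "Gamma_EL F m h (\<mu>0, l0, P0) = 0" using rt(3) by simp
  qed (fact open_Theta m_meas mder rho psi_meas h_sec cond2(1) Q2 Q0 good D' bijD lam)+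
  have P: "likely M (\<lambda>n \<omega>. norm (Phat n \<omega> - P0) \<le> \<delta>)" if "\<delta> > 0" for \<delta>
    using o_pr_likely[OF Phat_consistent[unfolded conv_in_prob_def] _ that] Phat_meas by simp
  have crit: "likely M (\<lambda>n \<omega>. unique_log_critical \<Theta> (\<lambda>\<mu>. emp_lik n (\<lambda>i. m (Y i \<omega>) \<mu> (Phat n \<omega>))) (muhat n (Phat n \<omega>) \<omega>))"
    using whp_likely[OF muhat] by (rule likely_mono') (simp add: EL_def)
  have crit0: "likely M (\<lambda>n \<omega>. unique_log_critical \<Theta> (\<lambda>\<mu>. emp_lik n (\<lambda>i. m (Y i \<omega>) \<mu> P0)) (muhat n P0 \<omega>))"
    using whp_likely[OF muhat0] by (rule likely_mono') (simp add: EL_def)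
  have mel0: "likely M (\<lambda>n \<omega>. is_MEL \<Theta> (\<lambda>\<mu>. emp_lik n (\<lambda>i. m (Y i \<omega>) \<mu> P0)) (muhat n P0 \<omega>))"
    using whp_likely[OF muhat0] by (rule likely_mono') (simp add: EL_def)
  have l0: "lam \<mu>0 P0 = l0" by (rule lam[OF rt(1) E.root_solves_pop])
  \<comment> \<open>The root of \<Gamma> and the maximiser \<open>mu P0\<close> come from separate
    hypotheses; they are matched here by showing that the first maximises the profile at
    \<open>P0\<close>.\<close>
  have "\<mu>0 \<in> profile_dom F m \<Theta> lam P0"
    using E.alpha0_in E.root by (intro E.profile_dom_in) (simp_all add: l0 E.G1_def)
  moreover have "profile F m lam P0 (mu P0) \<le> profile F m lam P0 \<mu>0"
    using mu[of P0] by (intro E.profile_le_root[OF _ mel0 crit0]) blast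
  ultimately have mu0: "mu P0 = \<mu>0" using mu0_unique[of \<mu>0] by force
  have derT: "(mu has_derivative E.T) (at P0)"
    by (rule E.mu_has_derivative[OF _ _ mu0 mu_cont]) (use mu in blast)+
  \<comment> \<open>Uniqueness of the derivative lets the linear map \<open>E.T\<close> of the root
    expansion be replaced by the Jacobian matrix in the conclusion.\<close>
  have "(mu has_derivative (\<lambda>e. jacobian mu (at P0) *v e)) (at P0)"
    using derT unfolding jacobian_works[symmetric] by (auto simp: differentiable_def)
  from has_derivative_unique[OF this derT]
  have T: "jacobian mu (at P0) *v e = E.T e" for e by (simp add: fun_eq_iff)
  have heq: "likely M (\<lambda>n \<omega>. norm (emean n (\<lambda>i. h (Y i \<omega>) (Phat n \<omega>))) \<le> \<delta> * (1 / sqrt (real n)))"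
    if "\<delta> > 0" for \<delta>
    unfolding emean_def
  proof (rule o_pr_likely[OF Phat_eq _ that])
    have "(\<lambda>\<omega>. h (Y i \<omega>) (Phat n \<omega>)) \<in> borel_measurable M" for i n
    proof -
      have "(\<lambda>\<omega>. (Y i \<omega>, Phat n \<omega>)) \<in> borel_measurable M"
        using Y_measurable Phat_meas by (intro borel_measurable_Pair) auto
      from measurable_compose[OF this h_meas] show ?thesis by simp
    qed
    then show "(\<lambda>\<omega>. (\<Sum>i<n. h (Y i \<omega>) (Phat n \<omega>)) /\<^sub>R real n) \<in> borel_measurable M" for n
      by measurable
  qed simp
  show ?thesis
  proof (intro conjI)
    show "conv_in_prob M (\<lambda>n \<omega>. muhat n (Phat n \<omega>) \<omega>) (mu P0)"
      unfolding conv_in_prob_def mu0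
    proof (rule o_prI)
      show "(\<lambda>\<omega>. muhat n (Phat n \<omega>) \<omega> - \<mu>0) \<in> borel_measurable M" for n
        using muhat_meas by measurable
      show "\<forall>\<^sub>F n in sequentially. prob_ge M (1 - \<eta>) (\<lambda>\<omega>. norm (muhat n (Phat n \<omega>) \<omega> - \<mu>0) \<le> \<epsilon> * 1)"
        if "\<epsilon> > 0" "\<eta> > 0" for \<epsilon> \<eta>
        using E.estimator_consistent[OF P crit that(1)] that(2) unfolding likely_def by simp
    qed simp
    show "mu differentiable (at P0)" using derT by (auto simp: differentiable_def)
    show "o_pr M (\<lambda>n. 1 / sqrt (real n)) (\<lambda>n \<omega>. muhat n (Phat n \<omega>) \<omega> -
        (muhat n P0 \<omega> + jacobian mu (at P0) *v (Phat n \<omega> - P0)))"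
      unfolding T
    proof (rule o_prI)
      have "continuous_on UNIV E.T"
        by (intro linear_continuous_on E.linear_T[THEN linear_conv_bounded_linear[THEN iffD1]])
      then have [measurable]: "E.T \<in> borel_measurable borel" by (rule borel_measurable_continuous_onI)
      show "(\<lambda>\<omega>. muhat n (Phat n \<omega>) \<omega> - (muhat n P0 \<omega> + E.T (Phat n \<omega> - P0))) \<in> borel_measurable M" for n
        using muhat_meas[of n] muhat0_meas[of n] Phat_meas[of n] by measurable
      show "\<forall>\<^sub>F n in sequentially. prob_ge M (1 - \<eta>) (\<lambda>\<omega>. norm (muhat n (Phat n \<omega>) \<omega> -
          (muhat n P0 \<omega> + E.T (Phat n \<omega> - P0))) \<le> \<epsilon> * (1 / sqrt (real n)))"
        if "\<epsilon> > 0" "\<eta> > 0" for \<epsilon> \<eta>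
        by (rule E.estimator_expansion[OF P crit crit0 heq that])
    qed simp
  qed
qed

end
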